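(* (a) For an accumulation point $\tilde\nu$ of $(\nu_n)_{n\in\mathbb N}$ (with respect to weak convergence) and a subsequence of indices $n_k$ with $\nu_{n_k}\Rightarrow\tilde\nu$ as $k\to\infty$, let $\mathcal C$ be the set defined in the context relative to $\tilde\nu$, let $\hat C(E)$ be a linear subset of $\mathcal C$, and let $\hat C_b(E):=\hat C(E)\cap B_b(E)$ be dense in $L^2(E,\tilde\nu)$. Consider the following conditions. (i) For every $g\in\hat C_b(E)$, $\beta>0$, and $n\in\mathbb N$, there exists a $v_n\in\hat C_b(E)$ such that $G_{n,\beta}g=v_n$ $\nu_n$-a.e. (ii) For $g\in\hat C_b(E)$ and any $\beta>0$ there is a $v\in\hat C_b(E)$ such that $G_\beta g=v$ $\tilde\nu$-a.e. (iii) $S_{n_k}$ converges to $S_{\tilde\nu}$ or to $S^c_{\tilde\nu}$, in the first or in the second sense of convergence of forms defined in the context, taken relative to $\hat C(E)$. (iv) There is a set $\Gamma\subseteq\bigcap_{k\in\mathbb N}D(A_{n_k})\cap\hat C_b(E)$ that separates the points in $E$ such that $A_{n_k}g$ $s$-converges to zero as $k\to\infty$ for $g\in\Gamma$. (v) The trajectories $X_t$, $t\ge0$, relative to $(T_t)_{t\ge0}$ regarded as a semigroup in $B_b(E)$ are non-random given the initial value, and there is exactly one $\mu_0\in E$ such that $X_0=\mu_0$ implies $X_t=\mu_0$, $t>0$. Suppose that the measure $\nu$ is concentrated on $\mu_0$ with $\mu_0\in E_0:=E\setminus\bigcup_{n\ge1}E_n$, and that (v) holds. Suppose that for all accumulation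 points $\tilde\nu$ of $(\nu_n)_{n\in\mathbb N}$ (with a corresponding subsequence $n_k$ and set $\hat C(E)$) conditions (i)-(iv) hold. Then $\nu_n\Rightarrow\nu=\delta_{\mu_0}$ as $n\to\infty$. (b) Assume $\nu_n\Rightarrow\nu=\delta_{\mu_0}$ as $n\to\infty$. Then, for $\beta>0$, $$\langle\beta G_{n,\beta}g-g,\ \beta G_{n,\beta}g-g\rangle_n\longrightarrow0\quad\text{as }n\to\infty,\qquad g\in C_b(E).$$
   Context: Let $E$ be a compact metric space with Borel $\sigma$-algebra $\mathcal B$; $C_b(E)$, $B_b(E)$ are the bounded continuous, respectively bounded measurable, functions; $\Rightarrow$ is weak convergence of probability measures. $\nu_n$, $n\in\mathbb N$, and $\nu$ are mutually orthogonal probability measures on $(E,\mathcal B)$; there are pairwise disjoint $E_n\subseteq E$ with $\nu_n(E\setminus E_n)=0$. $\langle\cdot,\cdot\rangle_n$ is the inner product in $L^2(E,\nu_n)$. Semigroups. For each $n$, $(T_{n,t})_{t\ge0}$ is a strongly continuous semigroup in $L^2(E,\nu_n)$ possessing a transition probability function, with invariant measure $\nu_n$ ($\int T_{n,t}f\,d\nu_n=\int f\,d\nu_n$, $f\in L^\infty(E,\nu_n)$), generator $A_n$ and resolvent $G_{n,\beta}=(\beta-A_n)^{-1}$, $\beta>0$. $(T^b_t)_{t\ge0}$ (also written $(T_t)_{t\ge0}$) is a semigroup in $B_b(E)$ possessing a transition probability function; it induces a strongly continuous contraction semigroup on $L^2(E,\nu)$. All these semigroups are associated with cadlag stochastic processes;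 the one associated with $(T^b_t)$ is $X=(X_t)_{t\ge0}$. For every accumulation point $\tilde\nu$ of $(\nu_n)$, $(T^b_t)$ induces a semigroup $(T_t)_{t\ge0}$ on $L^2(E,\tilde\nu)$, assumed strongly continuous and contractive there, with generator $A_{\tilde\nu}$ and resolvent $G_\beta=(\beta-A_{\tilde\nu})^{-1}$. Write $\langle\cdot,\cdot\rangle$ for the inner product of $L^2(E,\tilde\nu)$. Forms. $D(S_{\tilde\nu}):=\{u\in L^2(E,\tilde\nu):\lim_{t\to0}\langle\frac1t(u-T_tu),v\rangle\text{ exists for all }v\in L^2(E,\tilde\nu)\}=D(A_{\tilde\nu})$ and $S_{\tilde\nu}(u,v):=\lim_{t\to0}\langle\frac1t(u-T_tu),v\rangle$ for $u\in D(S_{\tilde\nu})$, $v\in L^2(E,\tilde\nu)$; $S_{\tilde\nu}(u,v):=\infty$ if $u\notin D(S_{\tilde\nu})$. $S_n$ is defined in the same way on $L^2(E,\nu_n)$ from $(T_{n,t})$. The form $S^c_{\tilde\nu}$ is considered only when $t\mapsto\langle T_tu,u\rangle$ is convex for every $u\in L^2(E,\tilde\nu)$; then $D(S^c_{\tilde\nu}):=\{u\in L^2(E,\tilde\nu):\lim_{t\to0}\langle\frac1t(u-T_tu),u\rangle<\infty\}$, it is assumed that $S^c_{\tilde\nu}(u,v):=\lim_{t\to0}\langle\frac1t(u-T_tu),v\rangle$ exists for all $u,v\in D(S^c_{\tilde\nu})$, and $S^c_{\tilde\nu}(u,v):=\infty$ if $u\notin D(S^c_{\tilde\nu})$ or $v\notin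 D(S^c_{\tilde\nu})$. For $\beta>0$, adding $\beta$ times the respective inner product to a form is denoted by the additional subscript $\beta$ (e.g. $S_{n,\beta}$). The set $\mathcal C$ relative to $\tilde\nu$ and $n_k$. Functions in $\bigcap_kL^2(E,\nu_{n_k})\cap L^2(E,\tilde\nu)$ are everywhere defined measurable functions identified when equal $\tilde\nu$-a.e. and $\nu_{n_k}$-a.e. for all $k$. Such a $g$ belongs to $\mathcal C$ if: there is a sequence $g_{0,r}\in C_b(E)$, $r\in\mathbb N$, with $g_{0,r}\to g$ in $L^2(E,\tilde\nu)$ as $r\to\infty$ and $\limsup_{r\to\infty}\limsup_{k\to\infty}\langle g_{0,r},g_{0,r}\rangle_{n_k}<\infty$; for every $n=n_k$ there is $g_n\in C_b(E)$ with $g=g_n$ $\nu_n$-a.e. and $\langle g_{n_k},g_{0,r}\rangle_{n_k}\to\langle g,g_{0,r}\rangle$ as $k\to\infty$ for every $r$; and $\langle g_{n_k},g_{n_k}\rangle_{n_k}\to\langle g,g\rangle$ as $k\to\infty$. $w$- and $s$-convergence (relative to a linear set $\mathcal C'\subseteq\mathcal C$, e.g. $\mathcal C'=\hat C(E)$). $\varphi_{n_k}\in\mathcal C'$ $w$-converges to $\varphi\in L^2(E,\tilde\nu)$ if $\langle\varphi_{n_k},\psi\rangle_{n_k}\to\langle\varphi,\psi\rangle$ for all $\psi\in\mathcal C'$; it $s$-converges to $\varphi$ if in addition $\langle\varphi_{n_k},\varphi_{n_k}\rangle_{n_k}\to\langle\varphi,\varphi\rangle$. Elements of $L^2(E,\nu_{n_k})$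 are identified with elements of $\mathcal C'$ that equal them $\nu_{n_k}$-a.e. Similarly for further subsequences. Convergence of forms (relative to $\mathcal C'$). Let $S'$ be $S_{\tilde\nu}$ or $S^c_{\tilde\nu}$. First sense: (1) for every $\varphi\in L^2(E,\tilde\nu)$, every subsequence $m_j$ of $(n_k)$ and all $\varphi_{m_j}\in\mathcal C'$ $w$-converging to $\varphi$, $S'(\varphi,\varphi)\le\liminf_jS_{m_j}(\varphi_{m_j},\varphi_{m_j})$; (2) for every $\psi\in D(S')$ there are $\psi_{n_k}\in D(S_{n_k})\cap\mathcal C'$ $s$-converging to $\psi$ with $\limsup_kS_{n_k}(\psi_{n_k},\psi_{n_k})\le S'(\psi,\psi)$; (3) for all $g\in\mathcal C'\cap B_b(E)$, $\beta>0$, $\psi\in D(S')$ and every $\psi_{n_k}\in D(S_{n_k})\cap\mathcal C'$ $s$-converging to $\psi$ with $\limsup_kS_{n_k}(\psi_{n_k},\psi_{n_k})\le S'(\psi,\psi)$, $\lim_kS_{n_k,\beta}(\psi_{n_k},G_{n_k,\beta}g)=S'_\beta(\psi,G_\beta g)$. Second sense: (1) together with (2') for every subsequence $n_q$ of $(n_k)$ and every $\psi\in D(S')$ there are a further subsequence $n_r$ of $n_q$ and $\psi_{n_r}\in D(S_{n_r})\cap\mathcal C'$ $s$-converging to $\psi$ with $\limsup_rS_{n_r}(\psi_{n_r},\psi_{n_r})\le S'(\psi,\psi)$; and (3') for all $g\in\mathcal C'\cap B_b(E)$, $\beta>0$, $\psi\in D(S')$ and every such subsequence $\psi_{n_r}\in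 D(S_{n_r})\cap\mathcal C'$ $s$-converging to $\psi$ with $\limsup_rS_{n_r}(\psi_{n_r},\psi_{n_r})\le S'(\psi,\psi)$, $\lim_rS_{n_r,\beta}(\psi_{n_r},G_{n_r,\beta}g)=S'_\beta(\psi,G_\beta g)$. *)

theory Defs
  imports "HOL-Probability.Probability"
begin

text \<open>
  The compact metric space \<open>E\<close> is the universe of a type of class \<open>metric_space\<close>.  A Borel
  probability measure on it is an element of \<open>space (prob_algebra borel)\<close>.  Elements of \<open>L\<^sup>2\<close>-spaces are represented by everywhere defined
  functions, and equality in \<open>L\<^sup>2\<close> is written out as almost everywhere equality.
\<close>

section \<open>Function spaces and weak convergence\<close>

definition Cb :: "('a::topological_space \<Rightarrow> real) set" where
  "Cb = {f. continuous_on UNIV f \<and> bounded (range f)}"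

definition Bb :: "('a::topological_space \<Rightarrow> real) set" where
  "Bb = {f \<in> borel_measurable borel. bounded (range f)}"

definition weakly_converges :: "(nat \<Rightarrow> 'a::topological_space measure) \<Rightarrow> 'a measure \<Rightarrow> bool" where
  "weakly_converges \<nu> \<mu> \<longleftrightarrow>
     (\<forall>f\<in>Cb. (\<lambda>n. \<integral>x. f x \<partial>\<nu> n) \<longlonglongrightarrow> (\<integral>x. f x \<partial>\<mu>))"

definition accumulation_point :: "(nat \<Rightarrow> 'a::topological_space measure) \<Rightarrow> 'a measure \<Rightarrow> bool" where
  "accumulation_point \<nu> \<mu> \<longleftrightarrow> \<mu> \<in> space (prob_algebra borel) \<and>
     (\<exists>s::nat \<Rightarrow> nat. strict_mono s \<and> weakly_converges (\<nu> \<circ> s) \<mu>)"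

definition orthogonal_measures :: "'a measure \<Rightarrow> 'a measure \<Rightarrow> bool" where
  "orthogonal_measures \<mu> \<mu>' \<longleftrightarrow>
     (\<exists>B\<in>sets \<mu>. emeasure \<mu> B = 0 \<and> emeasure \<mu>' (space \<mu> - B) = 0)"

definition L2 :: "'a measure \<Rightarrow> ('a \<Rightarrow> real) set" where
  "L2 \<mu> = {f \<in> borel_measurable \<mu>. integrable \<mu> (\<lambda>x. (f x)\<^sup>2)}"

definition ip :: "'a measure \<Rightarrow> ('a \<Rightarrow> real) \<Rightarrow> ('a \<Rightarrow> real) \<Rightarrow> real" where
  "ip \<mu> f g = (\<integral>x. f x * g x \<partial>\<mu>)"

definition norm2 :: "'a measure \<Rightarrow> ('a \<Rightarrow> real) \<Rightarrow> real" where
  "norm2 \<mu> f = sqrt (ip \<mu> f f)"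

definition dense_L2 :: "'a measure \<Rightarrow> ('a \<Rightarrow> real) set \<Rightarrow> bool" where
  "dense_L2 \<mu> D \<longleftrightarrow> D \<subseteq> L2 \<mu> \<and>
     (\<forall>f\<in>L2 \<mu>. \<forall>\<epsilon>>0. \<exists>g\<in>D. norm2 \<mu> (\<lambda>x. f x - g x) < \<epsilon>)"

definition linear_set :: "('a \<Rightarrow> real) set \<Rightarrow> bool" where
  "linear_set D \<longleftrightarrow> (\<lambda>x. 0) \<in> D \<and>
     (\<forall>f\<in>D. \<forall>g\<in>D. \<forall>a b. (\<lambda>x. a * f x + b * g x) \<in> D)"

section \<open>Semigroups, generators, resolvents\<close>

text \<open>
  The Chapman-Kolmogorov equations are not part of this definition; they are the semigroup property
  of \<open>trans_op P\<close>, required on \<open>L\<^sup>2\<close> or on \<open>Bb\<close>, respectively.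
\<close>

definition transition_probability :: "(real \<Rightarrow> 'a::topological_space \<Rightarrow> 'a measure) \<Rightarrow> bool" where
  "transition_probability P \<longleftrightarrow> (\<forall>t\<ge>0. P t \<in> borel \<rightarrow>\<^sub>M prob_algebra borel)"

definition trans_op :: "(real \<Rightarrow> 'a \<Rightarrow> 'a measure) \<Rightarrow> real \<Rightarrow> ('a \<Rightarrow> real) \<Rightarrow> 'a \<Rightarrow> real" where
  "trans_op P t f x = (\<integral>y. f y \<partial>P t x)"

definition Bb_semigroup :: "(real \<Rightarrow> ('a::topological_space \<Rightarrow> real) \<Rightarrow> 'a \<Rightarrow> real) \<Rightarrow> bool" where
  "Bb_semigroup T \<longleftrightarrow>
     (\<forall>t\<ge>0. \<forall>f\<in>Bb. T t f \<in> Bb) \<and>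
     (\<forall>t\<ge>0. \<forall>f\<in>Bb. \<forall>g\<in>Bb. \<forall>a b. T t (\<lambda>x. a * f x + b * g x) = (\<lambda>x. a * T t f x + b * T t g x)) \<and>
     (\<forall>f\<in>Bb. T 0 f = f) \<and>
     (\<forall>s\<ge>0. \<forall>t\<ge>0. \<forall>f\<in>Bb. T (s + t) f = T s (T t f))"

definition C0_semigroup_L2 :: "'a measure \<Rightarrow> (real \<Rightarrow> ('a \<Rightarrow> real) \<Rightarrow> 'a \<Rightarrow> real) \<Rightarrow> bool" where
  "C0_semigroup_L2 \<mu> T \<longleftrightarrow>
     (\<forall>t\<ge>0. \<forall>f\<in>L2 \<mu>. T t f \<in> L2 \<mu>) \<and>
     (\<forall>t\<ge>0. \<forall>f\<in>L2 \<mu>. \<forall>g\<in>L2 \<mu>. (AE x in \<mu>. f x = g x) \<longrightarrow> (AE x in \<mu>. T t f x = T t g x)) \<and>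
     (\<forall>t\<ge>0. \<forall>f\<in>L2 \<mu>. \<forall>g\<in>L2 \<mu>. \<forall>a b.
        AE x in \<mu>. T t (\<lambda>y. a * f y + b * g y) x = a * T t f x + b * T t g x) \<and>
     (\<forall>t\<ge>0. \<exists>K. \<forall>f\<in>L2 \<mu>. norm2 \<mu> (T t f) \<le> K * norm2 \<mu> f) \<and>
     (\<forall>f\<in>L2 \<mu>. AE x in \<mu>. T 0 f x = f x) \<and>
     (\<forall>s\<ge>0. \<forall>t\<ge>0. \<forall>f\<in>L2 \<mu>. AE x in \<mu>. T (s + t) f x = T s (T t f) x) \<and>
     (\<forall>f\<in>L2 \<mu>. ((\<lambda>t. norm2 \<mu> (\<lambda>x. T t f x - f x)) \<longlongrightarrow> 0) (at_right 0))"

definition contractive_L2 :: "'a measure \<Rightarrow> (real \<Rightarrow> ('a \<Rightarrow> real) \<Rightarrow> 'a \<Rightarrow> real) \<Rightarrow> bool" where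
  "contractive_L2 \<mu> T \<longleftrightarrow> (\<forall>t\<ge>0. \<forall>f\<in>L2 \<mu>. norm2 \<mu> (T t f) \<le> norm2 \<mu> f)"

definition invariant_measure :: "'a measure \<Rightarrow> (real \<Rightarrow> ('a \<Rightarrow> real) \<Rightarrow> 'a \<Rightarrow> real) \<Rightarrow> bool" where
  "invariant_measure \<mu> T \<longleftrightarrow>
     (\<forall>t\<ge>0. \<forall>f\<in>borel_measurable \<mu>. (\<exists>K. AE x in \<mu>. \<bar>f x\<bar> \<le> K) \<longrightarrow>
        (\<integral>x. T t f x \<partial>\<mu>) = (\<integral>x. f x \<partial>\<mu>))"

definition has_generator_value ::
    "'a measure \<Rightarrow> (real \<Rightarrow> ('a \<Rightarrow> real) \<Rightarrow> 'a \<Rightarrow> real) \<Rightarrow> ('a \<Rightarrow> real) \<Rightarrow> ('a \<Rightarrow> real) \<Rightarrow> bool" where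
  "has_generator_value \<mu> T u w \<longleftrightarrow> u \<in> L2 \<mu> \<and> w \<in> L2 \<mu> \<and>
     ((\<lambda>t. norm2 \<mu> (\<lambda>x. (T t u x - u x) / t - w x)) \<longlongrightarrow> 0) (at_right 0)"

definition gen_dom :: "'a measure \<Rightarrow> (real \<Rightarrow> ('a \<Rightarrow> real) \<Rightarrow> 'a \<Rightarrow> real) \<Rightarrow> ('a \<Rightarrow> real) set" where
  "gen_dom \<mu> T = {u. \<exists>w. has_generator_value \<mu> T u w}"

text \<open>
  \<open>generator\<close> and \<open>resolvent\<close> choose representatives of elements of \<open>L\<^sup>2\<close>, which are determined up
  to null sets.
\<close>

definition generator ::
    "'a measure \<Rightarrow> (real \<Rightarrow> ('a \<Rightarrow> real) \<Rightarrow> 'a \<Rightarrow> real) \<Rightarrow> ('a \<Rightarrow> real) \<Rightarrow> 'a \<Rightarrow> real" where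
  "generator \<mu> T u = (SOME w. has_generator_value \<mu> T u w)"

definition resolvent ::
    "'a measure \<Rightarrow> (real \<Rightarrow> ('a \<Rightarrow> real) \<Rightarrow> 'a \<Rightarrow> real) \<Rightarrow> real \<Rightarrow> ('a \<Rightarrow> real) \<Rightarrow> 'a \<Rightarrow> real" where
  "resolvent \<mu> T \<beta> g =
     (SOME v. v \<in> gen_dom \<mu> T \<and> (AE x in \<mu>. \<beta> * v x - generator \<mu> T v x = g x))"

section \<open>Associated processes\<close>

definition cadlag :: "(real \<Rightarrow> 'a::topological_space) \<Rightarrow> bool" where
  "cadlag \<xi> \<longleftrightarrow> (\<forall>t\<ge>0. (\<xi> \<longlongrightarrow> \<xi> t) (at_right t)) \<and> (\<forall>t>0. \<exists>l. (\<xi> \<longlongrightarrow> l) (at_left t))"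

definition natural_filtration ::
    "'w measure \<Rightarrow> (real \<Rightarrow> 'w \<Rightarrow> 'a::topological_space) \<Rightarrow> real \<Rightarrow> 'w measure" where
  "natural_filtration M X s =
     sigma (space M) {X r -` B \<inter> space M | r B. 0 \<le> r \<and> r \<le> s \<and> B \<in> sets borel}"

definition cadlag_Markov_process ::
    "(real \<Rightarrow> 'a::topological_space \<Rightarrow> 'a measure) \<Rightarrow> 'a measure \<Rightarrow> 'w measure \<Rightarrow> (real \<Rightarrow> 'w \<Rightarrow> 'a) \<Rightarrow> bool"
  where
  "cadlag_Markov_process P init M X \<longleftrightarrow>
     prob_space M \<and>
     (\<forall>t\<ge>0. X t \<in> M \<rightarrow>\<^sub>M borel) \<and>
     distr M borel (X 0) = init \<and>
     (\<forall>s\<ge>0. \<forall>t\<ge>0. \<forall>f\<in>Bb. AE \<omega> in M.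
        real_cond_exp M (natural_filtration M X s) (\<lambda>\<omega>'. f (X (s + t) \<omega>')) \<omega> = trans_op P t f (X s \<omega>)) \<and>
     (\<forall>\<omega>\<in>space M. cadlag (\<lambda>t. X t \<omega>))"

text \<open>In the following two definitions, \<open>M x\<close> is the law of the process started in \<open>x\<close>.\<close>

definition nonrandom_trajectories :: "('a \<Rightarrow> 'w measure) \<Rightarrow> (real \<Rightarrow> 'w \<Rightarrow> 'a) \<Rightarrow> bool" where
  "nonrandom_trajectories M X \<longleftrightarrow>
     (\<forall>x. \<exists>\<xi>. AE \<omega> in M x. \<forall>t\<ge>0. X t \<omega> = \<xi> t)"

definition resting_point :: "('a \<Rightarrow> 'w measure) \<Rightarrow> (real \<Rightarrow> 'w \<Rightarrow> 'a) \<Rightarrow> 'a \<Rightarrow> bool" where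
  "resting_point M X z \<longleftrightarrow> (AE \<omega> in M z. \<forall>t>0. X t \<omega> = z)"

section \<open>Forms\<close>

definition form_dom :: "'a measure \<Rightarrow> (real \<Rightarrow> ('a \<Rightarrow> real) \<Rightarrow> 'a \<Rightarrow> real) \<Rightarrow> ('a \<Rightarrow> real) set" where
  "form_dom \<mu> T = {u \<in> L2 \<mu>. \<forall>v\<in>L2 \<mu>.
     \<exists>l. ((\<lambda>t. ip \<mu> (\<lambda>x. (u x - T t u x) / t) v) \<longlongrightarrow> l) (at_right 0)}"

definition form ::
    "'a measure \<Rightarrow> (real \<Rightarrow> ('a \<Rightarrow> real) \<Rightarrow> 'a \<Rightarrow> real) \<Rightarrow> ('a \<Rightarrow> real) \<Rightarrow> ('a \<Rightarrow> real) \<Rightarrow> ereal" where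
  "form \<mu> T u v = (if u \<in> form_dom \<mu> T
     then ereal (Lim (at_right 0) (\<lambda>t. ip \<mu> (\<lambda>x. (u x - T t u x) / t) v)) else \<infinity>)"

definition cform_dom :: "'a measure \<Rightarrow> (real \<Rightarrow> ('a \<Rightarrow> real) \<Rightarrow> 'a \<Rightarrow> real) \<Rightarrow> ('a \<Rightarrow> real) set" where
  "cform_dom \<mu> T = {u \<in> L2 \<mu>.
     \<exists>l::ereal. l < \<infinity> \<and> ((\<lambda>t. ereal (ip \<mu> (\<lambda>x. (u x - T t u x) / t) u)) \<longlongrightarrow> l) (at_right 0)}"

definition cform ::
    "'a measure \<Rightarrow> (real \<Rightarrow> ('a \<Rightarrow> real) \<Rightarrow> 'a \<Rightarrow> real) \<Rightarrow> ('a \<Rightarrow> real) \<Rightarrow> ('a \<Rightarrow> real) \<Rightarrow> ereal" where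
  "cform \<mu> T u v = (if u \<in> cform_dom \<mu> T \<and> v \<in> cform_dom \<mu> T
     then ereal (Lim (at_right 0) (\<lambda>t. ip \<mu> (\<lambda>x. (u x - T t u x) / t) v)) else \<infinity>)"

definition cform_admissible :: "'a measure \<Rightarrow> (real \<Rightarrow> ('a \<Rightarrow> real) \<Rightarrow> 'a \<Rightarrow> real) \<Rightarrow> bool" where
  "cform_admissible \<mu> T \<longleftrightarrow>
     (\<forall>u\<in>L2 \<mu>. convex_on {0..} (\<lambda>t. ip \<mu> (T t u) u)) \<and>
     (\<forall>u\<in>cform_dom \<mu> T. \<forall>v\<in>cform_dom \<mu> T.
        \<exists>l. ((\<lambda>t. ip \<mu> (\<lambda>x. (u x - T t u x) / t) v) \<longlongrightarrow> l) (at_right 0))"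

definition form_shift ::
    "'a measure \<Rightarrow> (('a \<Rightarrow> real) \<Rightarrow> ('a \<Rightarrow> real) \<Rightarrow> ereal) \<Rightarrow> real \<Rightarrow> ('a \<Rightarrow> real) \<Rightarrow> ('a \<Rightarrow> real) \<Rightarrow> ereal" where
  "form_shift \<mu> S \<beta> u v = S u v + ereal (\<beta> * ip \<mu> u v)"

section \<open>The set \<open>\<C>\<close> and convergence relative to a subset of it\<close>

text \<open>
  In what follows, the subsequence \<open>n\<^sub>k\<close> is given by a strictly monotone \<open>s\<close> with \<open>n\<^sub>k = s k\<close>.
  The set \<open>\<C>\<close> and its subsets consist of functions, not of classes modulo equality almost everywhere
  with respect to the limit measure and all \<open>\<nu> (s k)\<close>; a set of such classes corresponds to the union
  of its members.
\<close>

definition class_C :: "(nat \<Rightarrow> 'a::topological_space measure) \<Rightarrow> (nat \<Rightarrow> nat) \<Rightarrow> 'a measure \<Rightarrow> ('a \<Rightarrow> real) set" where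
  "class_C \<nu> s \<mu> = {g \<in> borel_measurable borel.
     g \<in> L2 \<mu> \<and> (\<forall>k. g \<in> L2 (\<nu> (s k))) \<and>
     (\<exists>(g0 :: nat \<Rightarrow> 'a \<Rightarrow> real) (gn :: nat \<Rightarrow> 'a \<Rightarrow> real).
        (\<forall>r. g0 r \<in> Cb) \<and>
        (\<lambda>r. norm2 \<mu> (\<lambda>x. g0 r x - g x)) \<longlonglongrightarrow> 0 \<and>
        limsup (\<lambda>r. limsup (\<lambda>k. ereal (ip (\<nu> (s k)) (g0 r) (g0 r)))) < \<infinity> \<and>
        (\<forall>k. gn k \<in> Cb \<and> (AE x in \<nu> (s k). g x = gn k x)) \<and>
        (\<forall>r. (\<lambda>k. ip (\<nu> (s k)) (gn k) (g0 r)) \<longlonglongrightarrow> ip \<mu> g (g0 r)) \<and>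
        (\<lambda>k. ip (\<nu> (s k)) (gn k) (gn k)) \<longlonglongrightarrow> ip \<mu> g g)}"

definition w_converges ::
    "(nat \<Rightarrow> 'a measure) \<Rightarrow> (nat \<Rightarrow> nat) \<Rightarrow> 'a measure \<Rightarrow> ('a \<Rightarrow> real) set \<Rightarrow>
     (nat \<Rightarrow> 'a \<Rightarrow> real) \<Rightarrow> ('a \<Rightarrow> real) \<Rightarrow> bool" where
  "w_converges \<nu> s \<mu> C \<phi>s \<phi> \<longleftrightarrow> (\<forall>k. \<phi>s k \<in> C) \<and> \<phi> \<in> L2 \<mu> \<and>
     (\<forall>\<psi>\<in>C. (\<lambda>k. ip (\<nu> (s k)) (\<phi>s k) \<psi>) \<longlonglongrightarrow> ip \<mu> \<phi> \<psi>)"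

definition s_converges ::
    "(nat \<Rightarrow> 'a measure) \<Rightarrow> (nat \<Rightarrow> nat) \<Rightarrow> 'a measure \<Rightarrow> ('a \<Rightarrow> real) set \<Rightarrow>
     (nat \<Rightarrow> 'a \<Rightarrow> real) \<Rightarrow> ('a \<Rightarrow> real) \<Rightarrow> bool" where
  "s_converges \<nu> s \<mu> C \<phi>s \<phi> \<longleftrightarrow> w_converges \<nu> s \<mu> C \<phi>s \<phi> \<and>
     (\<lambda>k. ip (\<nu> (s k)) (\<phi>s k) (\<phi>s k)) \<longlonglongrightarrow> ip \<mu> \<phi> \<phi>"

section \<open>Convergence of forms\<close>

text \<open>
  \<open>Tn n\<close> is the semigroup on \<open>L2 (\<nu> n)\<close> and \<open>T\<close> the one on \<open>L2 \<mu>\<close>.  The limit form is a pair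
  of a domain \<open>D\<close> and a function \<open>S\<close>, to be instantiated by \<open>form\<close> or by \<open>cform\<close>.
\<close>

definition recovery_sequence ::
    "(nat \<Rightarrow> 'a measure) \<Rightarrow> (nat \<Rightarrow> real \<Rightarrow> ('a \<Rightarrow> real) \<Rightarrow> 'a \<Rightarrow> real) \<Rightarrow> (nat \<Rightarrow> nat) \<Rightarrow> 'a measure \<Rightarrow>
     ('a \<Rightarrow> real) set \<Rightarrow> (('a \<Rightarrow> real) \<Rightarrow> ('a \<Rightarrow> real) \<Rightarrow> ereal) \<Rightarrow>
     (nat \<Rightarrow> 'a \<Rightarrow> real) \<Rightarrow> ('a \<Rightarrow> real) \<Rightarrow> bool" where
  "recovery_sequence \<nu> Tn s \<mu> C S \<psi>s \<psi> \<longleftrightarrow>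
     (\<forall>k. \<psi>s k \<in> form_dom (\<nu> (s k)) (Tn (s k)) \<inter> C) \<and>
     s_converges \<nu> s \<mu> C \<psi>s \<psi> \<and>
     limsup (\<lambda>k. form (\<nu> (s k)) (Tn (s k)) (\<psi>s k) (\<psi>s k)) \<le> S \<psi> \<psi>"

definition form_liminf ::
    "(nat \<Rightarrow> 'a measure) \<Rightarrow> (nat \<Rightarrow> real \<Rightarrow> ('a \<Rightarrow> real) \<Rightarrow> 'a \<Rightarrow> real) \<Rightarrow> (nat \<Rightarrow> nat) \<Rightarrow> 'a measure \<Rightarrow>
     ('a \<Rightarrow> real) set \<Rightarrow> (('a \<Rightarrow> real) \<Rightarrow> ('a \<Rightarrow> real) \<Rightarrow> ereal) \<Rightarrow> bool" where
  "form_liminf \<nu> Tn s \<mu> C S \<longleftrightarrow>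
     (\<forall>\<phi>\<in>L2 \<mu>. \<forall>r \<phi>s. strict_mono r \<and> w_converges \<nu> (s \<circ> r) \<mu> C \<phi>s \<phi> \<longrightarrow>
        S \<phi> \<phi> \<le> liminf (\<lambda>j. form (\<nu> (s (r j))) (Tn (s (r j))) (\<phi>s j) (\<phi>s j)))"

definition resolvent_limit ::
    "(nat \<Rightarrow> 'a measure) \<Rightarrow> (nat \<Rightarrow> real \<Rightarrow> ('a \<Rightarrow> real) \<Rightarrow> 'a \<Rightarrow> real) \<Rightarrow> (nat \<Rightarrow> nat) \<Rightarrow> 'a measure \<Rightarrow>
     (real \<Rightarrow> ('a \<Rightarrow> real) \<Rightarrow> 'a \<Rightarrow> real) \<Rightarrow> (('a \<Rightarrow> real) \<Rightarrow> ('a \<Rightarrow> real) \<Rightarrow> ereal) \<Rightarrow>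
     (nat \<Rightarrow> 'a \<Rightarrow> real) \<Rightarrow> ('a \<Rightarrow> real) \<Rightarrow> real \<Rightarrow> ('a \<Rightarrow> real) \<Rightarrow> bool" where
  "resolvent_limit \<nu> Tn s \<mu> T S \<psi>s \<psi> \<beta> g \<longleftrightarrow>
     (\<lambda>k. form_shift (\<nu> (s k)) (form (\<nu> (s k)) (Tn (s k))) \<beta>
            (\<psi>s k) (resolvent (\<nu> (s k)) (Tn (s k)) \<beta> g))
       \<longlonglongrightarrow> form_shift \<mu> S \<beta> \<psi> (resolvent \<mu> T \<beta> g)"

definition form_convergence_first ::
    "(nat \<Rightarrow> 'a::topological_space measure) \<Rightarrow> (nat \<Rightarrow> real \<Rightarrow> ('a \<Rightarrow> real) \<Rightarrow> 'a \<Rightarrow> real) \<Rightarrow> (nat \<Rightarrow> nat) \<Rightarrow>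
     'a measure \<Rightarrow> (real \<Rightarrow> ('a \<Rightarrow> real) \<Rightarrow> 'a \<Rightarrow> real) \<Rightarrow> ('a \<Rightarrow> real) set \<Rightarrow>
     ('a \<Rightarrow> real) set \<Rightarrow> (('a \<Rightarrow> real) \<Rightarrow> ('a \<Rightarrow> real) \<Rightarrow> ereal) \<Rightarrow> bool" where
  "form_convergence_first \<nu> Tn s \<mu> T C D S \<longleftrightarrow>
     form_liminf \<nu> Tn s \<mu> C S \<and>
     (\<forall>\<psi>\<in>D. \<exists>\<psi>s. recovery_sequence \<nu> Tn s \<mu> C S \<psi>s \<psi>) \<and>
     (\<forall>g\<in>C \<inter> Bb. \<forall>\<beta>>0. \<forall>\<psi>\<in>D. \<forall>\<psi>s.
        recovery_sequence \<nu> Tn s \<mu> C S \<psi>s \<psi> \<longrightarrow> resolvent_limit \<nu> Tn s \<mu> T S \<psi>s \<psi> \<beta> g)"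

definition form_convergence_second ::
    "(nat \<Rightarrow> 'a::topological_space measure) \<Rightarrow> (nat \<Rightarrow> real \<Rightarrow> ('a \<Rightarrow> real) \<Rightarrow> 'a \<Rightarrow> real) \<Rightarrow> (nat \<Rightarrow> nat) \<Rightarrow>
     'a measure \<Rightarrow> (real \<Rightarrow> ('a \<Rightarrow> real) \<Rightarrow> 'a \<Rightarrow> real) \<Rightarrow> ('a \<Rightarrow> real) set \<Rightarrow>
     ('a \<Rightarrow> real) set \<Rightarrow> (('a \<Rightarrow> real) \<Rightarrow> ('a \<Rightarrow> real) \<Rightarrow> ereal) \<Rightarrow> bool" where
  "form_convergence_second \<nu> Tn s \<mu> T C D S \<longleftrightarrow>
     form_liminf \<nu> Tn s \<mu> C S \<and>
     (\<forall>q::nat \<Rightarrow> nat. strict_mono q \<longrightarrow> (\<forall>\<psi>\<in>D. \<exists>(r::nat \<Rightarrow> nat) \<psi>s.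
        strict_mono r \<and> recovery_sequence \<nu> Tn (s \<circ> q \<circ> r) \<mu> C S \<psi>s \<psi>)) \<and>
     (\<forall>g\<in>C \<inter> Bb. \<forall>\<beta>>0. \<forall>\<psi>\<in>D. \<forall>(r::nat \<Rightarrow> nat) \<psi>s.
        strict_mono r \<and> recovery_sequence \<nu> Tn (s \<circ> r) \<mu> C S \<psi>s \<psi> \<longrightarrow>
        resolvent_limit \<nu> Tn (s \<circ> r) \<mu> T S \<psi>s \<psi> \<beta> g)"

section \<open>Hypotheses on the accumulation points and on the limit process\<close>

text \<open>
  \<open>C\<close> is the linear subset of \<open>\<C>\<close>, and \<open>C \<inter> Bb\<close> the set of its bounded elements.
\<close>

definition cond_i where
  "cond_i (\<nu> :: nat \<Rightarrow> 'a::topological_space measure) Tn C \<longleftrightarrow>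
     (\<forall>g\<in>C \<inter> Bb. \<forall>\<beta>>0. \<forall>n. \<exists>v\<in>C \<inter> Bb. AE x in \<nu> n. resolvent (\<nu> n) (Tn n) \<beta> g x = v x)"

definition cond_ii where
  "cond_ii (\<mu> :: 'a::topological_space measure) T C \<longleftrightarrow>
     (\<forall>g\<in>C \<inter> Bb. \<forall>\<beta>>0. \<exists>v\<in>C \<inter> Bb. AE x in \<mu>. resolvent \<mu> T \<beta> g x = v x)"

definition cond_iii where
  "cond_iii (\<nu> :: nat \<Rightarrow> 'a::topological_space measure) Tn s \<mu> T C \<longleftrightarrow>
     form_convergence_first \<nu> Tn s \<mu> T C (form_dom \<mu> T) (form \<mu> T) \<or>
     form_convergence_second \<nu> Tn s \<mu> T C (form_dom \<mu> T) (form \<mu> T) \<or>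
     cform_admissible \<mu> T \<and>
       (form_convergence_first \<nu> Tn s \<mu> T C (cform_dom \<mu> T) (cform \<mu> T) \<or>
        form_convergence_second \<nu> Tn s \<mu> T C (cform_dom \<mu> T) (cform \<mu> T))"

text \<open>
  The functions \<open>\<phi>s k\<close> are the elements of \<open>C\<close> with which the images of \<open>g\<close> under the generators
  are identified.
\<close>

definition cond_iv where
  "cond_iv (\<nu> :: nat \<Rightarrow> 'a::topological_space measure) Tn s \<mu> C \<longleftrightarrow>
     (\<exists>\<Gamma>. \<Gamma> \<subseteq> (\<Inter>k. gen_dom (\<nu> (s k)) (Tn (s k))) \<inter> (C \<inter> Bb) \<and>
        (\<forall>x y. x \<noteq> y \<longrightarrow> (\<exists>g\<in>\<Gamma>. g x \<noteq> g y)) \<and>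
        (\<forall>g\<in>\<Gamma>. \<exists>\<phi>s. (\<forall>k. AE x in \<nu> (s k). generator (\<nu> (s k)) (Tn (s k)) g x = \<phi>s k x) \<and>
           s_converges \<nu> s \<mu> C \<phi>s (\<lambda>x. 0)))"

definition cond_v where
  "cond_v M X \<mu>0 \<longleftrightarrow> nonrandom_trajectories M X \<and> (\<forall>z. resting_point M X z \<longleftrightarrow> z = \<mu>0)"

end

theory Submission
  imports Defs
begin

text \<open>
  Part (a).  By (v) the transition kernels are Dirac measures along a flow \<open>\<Phi>\<close>, and contractivity on
  \<open>L\<^sup>2\<close> of an accumulation point \<open>\<mu>\<close>, applied to indicators, makes \<open>\<mu>\<close> invariant under \<open>\<Phi>\<close>; so
  \<open>T\<^sub>t\<close> is isometric there.  Then (iii) forces \<open>T\<^sub>t\<close> to be the identity on indicators.  For the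
  convex form this follows from convexity of \<open>t \<mapsto> \<langle>T\<^sub>t u, u\<rangle>\<close> for \<open>u\<close> and for \<open>u - T\<^sub>h u\<close>.  For the
  other form, isometry gives \<open>S(\<psi>,\<psi>) = 0\<close> on the domain of the generator, and a diagonal sequence
  built from recovery sequences and inserted in the lower bound gives \<open>S(\<phi>,\<phi>) \<le> 0\<close> for all \<open>\<phi>\<close>.  Hence
  \<open>\<mu>\<close>-almost every point rests, \<open>\<mu> = \<delta>\<close> at the only resting point, and sequential compactness of
  the probability measures on \<open>E\<close> yields convergence.

  Part (b).  \<open>\<beta> G g - g\<close> does not change when a constant is subtracted from \<open>g\<close>, and its norm is at most
  that of \<open>g - g(\<mu>\<^sub>0)\<close>, which tends to zero.
\<close>

section \<open>Square-integrable functions\<close>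

text \<open>The operator \<open>resolvent\<close> is a choice, so part (b) is accessible only once
  \<open>\<beta> - A\<close> is known to be onto the bounded functions. The Laplace integral of
  \<open>T t g x\<close> cannot be formed pointwise: a transition probability is measurable in the
  starting point for each fixed time, which gives no joint measurability in time and space. The
  resolvent is therefore found weakly, as the density, with respect to the invariant measure, of a
  mixture over an exponential time of the measures with densities \<open>T t g\<close>. Domination
  by the invariant measure keeps this density bounded. Adjoints of \<open>T s\<close> on bounded
  functions arise as densities in the same way, so all duality stays within \<open>Bb\<close>, whose
  members can serve as their own test functions. In part (a) the same construction approximates
  indicators by elements of the generator domain. For compactness, the space is coded into the unit
  interval by a Borel map with continuous inverse; tightness on the real line then applies.\<close>

lemma L2_measurable: "f \<in> L2 \<mu> \<Longrightarrow> f \<in> borel_measurable \<mu>"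
  by (simp add: L2_def)

lemma L2_integrable_mult:
  assumes "f \<in> L2 \<mu>" "g \<in> L2 \<mu>"
  shows "integrable \<mu> (\<lambda>x. f x * g x)"
proof (rule Bochner_Integration.integrable_bound)
  show "integrable \<mu> (\<lambda>x. (f x)\<^sup>2 + (g x)\<^sup>2)"
    using assms by (auto simp: L2_def)
  show "(\<lambda>x. f x * g x) \<in> borel_measurable \<mu>"
    using assms by (auto simp: L2_def)
  have "norm (a * b) \<le> norm (a\<^sup>2 + b\<^sup>2)" for a b :: real
  proof -
    have "2 * (\<bar>a\<bar> * \<bar>b\<bar>) \<le> a\<^sup>2 + b\<^sup>2"
      using sum_squares_bound[of "\<bar>a\<bar>" "\<bar>b\<bar>"] by simp
    moreover have "0 \<le> \<bar>a\<bar> * \<bar>b\<bar>" by simp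
    moreover have "0 \<le> a\<^sup>2 + b\<^sup>2" by simp
    ultimately show ?thesis unfolding real_norm_def abs_mult by linarith
  qed
  then show "AE x in \<mu>. norm (f x * g x) \<le> norm ((f x)\<^sup>2 + (g x)\<^sup>2)"
    by blast
qed

lemma L2_lincomb:
  assumes "f \<in> L2 \<mu>" "g \<in> L2 \<mu>"
  shows "(\<lambda>x. a * f x + b * g x) \<in> L2 \<mu>"
proof -
  have "(a * f x + b * g x)\<^sup>2 = a\<^sup>2 * (f x)\<^sup>2 + b\<^sup>2 * (g x)\<^sup>2 + 2 * a * b * (f x * g x)" for x
    by (simp add: power2_eq_square algebra_simps)
  then show ?thesis
    using assms L2_integrable_mult[OF assms] by (auto simp: L2_def)
qed

lemma L2_diff: "f \<in> L2 \<mu> \<Longrightarrow> g \<in> L2 \<mu> \<Longrightarrow> (\<lambda>x. f x - g x) \<in> L2 \<mu>"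
  using L2_lincomb[of f \<mu> g 1 "-1"] by simp

lemma L2_add: "f \<in> L2 \<mu> \<Longrightarrow> g \<in> L2 \<mu> \<Longrightarrow> (\<lambda>x. f x + g x) \<in> L2 \<mu>"
  using L2_lincomb[of f \<mu> g 1 1] by simp

lemma L2_mult: "f \<in> L2 \<mu> \<Longrightarrow> (\<lambda>x. a * f x) \<in> L2 \<mu>"
  using L2_lincomb[of f \<mu> f a 0] by simp

lemma L2_divide: "f \<in> L2 \<mu> \<Longrightarrow> (\<lambda>x. f x / a) \<in> L2 \<mu>"
  using L2_mult[of f \<mu> "1 / a"] by simp

lemma L2_bounded:
  assumes "finite_measure \<mu>" "f \<in> borel_measurable \<mu>" "AE x in \<mu>. \<bar>f x\<bar> \<le> K"
  shows "f \<in> L2 \<mu>"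
proof -
  interpret finite_measure \<mu> by fact
  have "AE x in \<mu>. norm ((f x)\<^sup>2) \<le> K\<^sup>2"
    using assms(3) by eventually_elim (auto intro: power2_le_iff_abs_le[THEN iffD2] simp: abs_le_square_iff[symmetric])
  then have "integrable \<mu> (\<lambda>x. (f x)\<^sup>2)"
    using assms(2) by (intro integrable_const_bound[where B="K\<^sup>2"]) auto
  then show ?thesis using assms(2) by (simp add: L2_def)
qed

lemma ip_commute: "ip \<mu> f g = ip \<mu> g f"
  by (simp add: ip_def mult.commute)

lemma ip_self_nonneg: "0 \<le> ip \<mu> f f"
  by (simp add: ip_def)

lemma norm2_nonneg: "0 \<le> norm2 \<mu> f"
  by (simp add: norm2_def ip_self_nonneg)

lemma norm2_sq: "(norm2 \<mu> f)\<^sup>2 = ip \<mu> f f"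
  by (simp add: norm2_def ip_self_nonneg)

lemma ip_lincomb_left:
  assumes "f \<in> L2 \<mu>" "g \<in> L2 \<mu>" "h \<in> L2 \<mu>"
  shows "ip \<mu> (\<lambda>x. a * f x + b * g x) h = a * ip \<mu> f h + b * ip \<mu> g h"
proof -
  have "ip \<mu> (\<lambda>x. a * f x + b * g x) h = (\<integral>x. a * (f x * h x) + b * (g x * h x) \<partial>\<mu>)"
    unfolding ip_def by (simp add: algebra_simps)
  then show ?thesis
    using L2_integrable_mult[OF assms(1,3)] L2_integrable_mult[OF assms(2,3)]
    by (simp add: ip_def)
qed

lemma ip_lincomb_right:
  assumes "f \<in> L2 \<mu>" "g \<in> L2 \<mu>" "h \<in> L2 \<mu>"
  shows "ip \<mu> h (\<lambda>x. a * f x + b * g x) = a * ip \<mu> h f + b * ip \<mu> h g"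
  using ip_lincomb_left[OF assms] by (simp add: ip_commute)

lemma ip_diff_left:
  "f \<in> L2 \<mu> \<Longrightarrow> g \<in> L2 \<mu> \<Longrightarrow> h \<in> L2 \<mu> \<Longrightarrow> ip \<mu> (\<lambda>x. f x - g x) h = ip \<mu> f h - ip \<mu> g h"
  using ip_lincomb_left[of f \<mu> g h 1 "-1"] by simp

lemma ip_diff_right:
  "f \<in> L2 \<mu> \<Longrightarrow> g \<in> L2 \<mu> \<Longrightarrow> h \<in> L2 \<mu> \<Longrightarrow> ip \<mu> h (\<lambda>x. f x - g x) = ip \<mu> h f - ip \<mu> h g"
  using ip_lincomb_right[of f \<mu> g h 1 "-1"] by simp

lemma ip_mult_left: "ip \<mu> (\<lambda>x. a * f x) g = a * ip \<mu> f g"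
  by (simp add: ip_def mult.assoc)

lemma ip_divide_left: "ip \<mu> (\<lambda>x. f x / a) g = ip \<mu> f g / a"
  using ip_mult_left[of \<mu> "1 / a" f g] by simp

lemma ip_diff_self:
  assumes "f \<in> L2 \<mu>" "g \<in> L2 \<mu>"
  shows "ip \<mu> (\<lambda>x. f x - g x) (\<lambda>x. f x - g x) = ip \<mu> f f - 2 * ip \<mu> f g + ip \<mu> g g"
  using assms by (simp add: ip_diff_left ip_diff_right L2_diff ip_commute[of \<mu> g f])

lemma ip_cong_AE:
  assumes "AE x in \<mu>. f x = f' x" "AE x in \<mu>. g x = g' x"
    "f \<in> L2 \<mu>" "f' \<in> L2 \<mu>" "g \<in> L2 \<mu>" "g' \<in> L2 \<mu>"
  shows "ip \<mu> f g = ip \<mu> f' g'"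
  unfolding ip_def
proof (rule integral_cong_AE)
  show "AE x in \<mu>. f x * g x = f' x * g' x" using assms(1,2) by eventually_elim simp
qed (use assms(3-6) in \<open>auto simp: L2_def\<close>)

lemma norm2_cong_AE:
  assumes "AE x in \<mu>. f x = g x" "f \<in> L2 \<mu>" "g \<in> L2 \<mu>"
  shows "norm2 \<mu> f = norm2 \<mu> g"
  using ip_cong_AE[OF assms(1,1,2,3,2,3)] by (simp add: norm2_def)

lemma norm2_eq_0_AE:
  assumes "f \<in> L2 \<mu>" "norm2 \<mu> f = 0"
  shows "AE x in \<mu>. f x = 0"
proof -
  have "(\<integral>x. (f x)\<^sup>2 \<partial>\<mu>) = 0"
    using assms(2) norm2_sq[of \<mu> f] by (simp add: ip_def power2_eq_square)
  then have "AE x in \<mu>. (f x)\<^sup>2 = 0"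
    using assms(1) by (subst (asm) integral_nonneg_eq_0_iff_AE) (auto simp: L2_def)
  then show ?thesis by simp
qed

lemma ip_Cauchy_Schwarz:
  assumes f: "f \<in> L2 \<mu>" and g: "g \<in> L2 \<mu>"
  shows "\<bar>ip \<mu> f g\<bar> \<le> norm2 \<mu> f * norm2 \<mu> g"
proof -
  let ?A = "ip \<mu> f f" and ?B = "ip \<mu> f g" and ?C = "ip \<mu> g g"
  have *: "0 \<le> a\<^sup>2 * ?A + 2 * a * b * ?B + b\<^sup>2 * ?C" for a b
  proof -
    have "ip \<mu> (\<lambda>x. a * f x + b * g x) (\<lambda>x. a * f x + b * g x) = a\<^sup>2 * ?A + 2 * a * b * ?B + b\<^sup>2 * ?C"
      using f g by (simp add: ip_lincomb_left ip_lincomb_right L2_lincomb ip_commute[of \<mu> g f]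
          power2_eq_square algebra_simps)
    then show ?thesis using ip_self_nonneg by metis
  qed
  have "?B\<^sup>2 \<le> ?A * ?C"
  proof (cases "?C = 0")
    case True
    have "?B = 0"
    proof (rule ccontr)
      assume "?B \<noteq> 0"
      \<comment> \<open>With \<open>?C = 0\<close> the form is affine in its second coefficient, and
        this choice gives it the value -1.\<close>
      with *[of 1 "- (?A + 1) / (2 * ?B)"] True show False by (simp add: field_simps)
    qed
    then show ?thesis using True by simp
  next
    case False
    then have "0 < ?C" using ip_self_nonneg[of \<mu> g] by simp
    moreover have "0 \<le> ?C * (?A * ?C - ?B\<^sup>2)"
      using *[of "?C" "- ?B"] by (simp add: power2_eq_square algebra_simps)
    ultimately show ?thesis by (simp add: zero_le_mult_iff)
  qed
  also have "\<dots> = (norm2 \<mu> f * norm2 \<mu> g)\<^sup>2"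
    by (simp add: power_mult_distrib norm2_sq)
  finally show ?thesis
    using norm2_nonneg by (metis abs_le_square_iff abs_of_nonneg mult_nonneg_nonneg)
qed

lemma norm2_mult: "norm2 \<mu> (\<lambda>x. a * f x) = \<bar>a\<bar> * norm2 \<mu> f"
proof -
  have "ip \<mu> (\<lambda>x. a * f x) (\<lambda>x. a * f x) = a\<^sup>2 * ip \<mu> f f"
    unfolding ip_def by (simp add: power2_eq_square ac_simps flip: integral_mult_right_zero)
  then show ?thesis by (simp add: norm2_def real_sqrt_mult)
qed

lemma norm2_triangle:
  assumes f: "f \<in> L2 \<mu>" and g: "g \<in> L2 \<mu>"
  shows "norm2 \<mu> (\<lambda>x. f x + g x) \<le> norm2 \<mu> f + norm2 \<mu> g"
proof -
  have "(norm2 \<mu> (\<lambda>x. f x + g x))\<^sup>2 = (norm2 \<mu> f)\<^sup>2 + 2 * ip \<mu> f g + (norm2 \<mu> g)\<^sup>2"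
    using f g ip_lincomb_left[OF f g, of _ 1 1] ip_lincomb_right[OF f g, of _ 1 1] L2_add[OF f g]
    by (simp add: norm2_sq ip_commute[of \<mu> g f])
  also have "\<dots> \<le> (norm2 \<mu> f + norm2 \<mu> g)\<^sup>2"
    using ip_Cauchy_Schwarz[OF f g] by (simp add: power2_sum)
  finally show ?thesis
    by (rule power2_le_imp_le) (simp add: norm2_nonneg)
qed

lemma norm2_le_const:
  assumes "prob_space \<mu>" "f \<in> borel_measurable \<mu>" "AE x in \<mu>. \<bar>f x\<bar> \<le> K" "0 \<le> K"
  shows "norm2 \<mu> f \<le> K"
proof -
  interpret prob_space \<mu> by fact
  have i: "integrable \<mu> (\<lambda>x. (f x)\<^sup>2)"
    using L2_bounded[OF finite_measure_axioms assms(2,3)] by (simp add: L2_def)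
  have "ip \<mu> f f = (\<integral>x. (f x)\<^sup>2 \<partial>\<mu>)" by (simp add: ip_def power2_eq_square)
  also have "\<dots> \<le> (\<integral>x. K\<^sup>2 \<partial>\<mu>)"
    using assms(3) i by (intro integral_mono_AE) (auto elim!: eventually_mono simp: abs_le_square_iff[symmetric])
  finally have "(norm2 \<mu> f)\<^sup>2 \<le> K\<^sup>2" by (simp add: prob_space norm2_sq)
  then show ?thesis using assms(4) by (rule power2_le_imp_le)
qed

lemma tendsto_ip_left:
  assumes L: "\<forall>\<^sub>F t in F. f t \<in> L2 \<mu>" and g: "g \<in> L2 \<mu>" and h: "h \<in> L2 \<mu>"
    and lim: "((\<lambda>t. norm2 \<mu> (\<lambda>x. f t x - g x)) \<longlongrightarrow> 0) F"
  shows "((\<lambda>t. ip \<mu> (f t) h) \<longlongrightarrow> ip \<mu> g h) F"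
proof (rule LIM_zero_cancel, rule tendsto_rabs_zero_cancel, rule tendsto_sandwich[OF _ _ tendsto_const])
  show "\<forall>\<^sub>F t in F. 0 \<le> \<bar>ip \<mu> (f t) h - ip \<mu> g h\<bar>" by simp
  show "\<forall>\<^sub>F t in F. \<bar>ip \<mu> (f t) h - ip \<mu> g h\<bar> \<le> norm2 \<mu> (\<lambda>x. f t x - g x) * norm2 \<mu> h"
    using L
  proof eventually_elim
    case (elim t)
    then show ?case
      using ip_Cauchy_Schwarz[OF L2_diff[OF elim g] h] by (simp add: ip_diff_left g h)
  qed
  show "((\<lambda>t. norm2 \<mu> (\<lambda>x. f t x - g x) * norm2 \<mu> h) \<longlongrightarrow> 0) F"
    using tendsto_mult_left_zero[OF lim] .
qed

section \<open>Markovian semigroups with an invariant measure\<close>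

lemma Bb_measurable: "f \<in> Bb \<Longrightarrow> f \<in> borel_measurable borel"
  by (simp add: Bb_def)

lemma Bb_boundedE:
  assumes "f \<in> Bb"
  obtains K where "0 < K" "\<And>x. \<bar>f x\<bar> \<le> K"
proof -
  from assms obtain K where "0 < K" "\<forall>x\<in>range f. norm x \<le> K"
    unfolding Bb_def bounded_pos by blast
  then show ?thesis by (intro that[of K]) auto
qed

lemma BbI: "f \<in> borel_measurable borel \<Longrightarrow> (\<And>x. \<bar>f x\<bar> \<le> K) \<Longrightarrow> f \<in> Bb"
  unfolding Bb_def bounded_iff by auto

lemma Bb_lincomb:
  assumes "f \<in> Bb" "g \<in> Bb"
  shows "(\<lambda>x. a * f x + b * g x) \<in> Bb"
proof -
  obtain K L where KL: "\<And>x. \<bar>f x\<bar> \<le> K" "\<And>x. \<bar>g x\<bar> \<le> L"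
    using Bb_boundedE[OF assms(1)] Bb_boundedE[OF assms(2)] by metis
  show ?thesis
  proof (rule BbI[where K="\<bar>a\<bar> * K + \<bar>b\<bar> * L"])
    show "(\<lambda>x. a * f x + b * g x) \<in> borel_measurable borel"
      using assms by (auto simp: Bb_def)
    show "\<bar>a * f x + b * g x\<bar> \<le> \<bar>a\<bar> * K + \<bar>b\<bar> * L" for x
    proof -
      have "\<bar>a * f x + b * g x\<bar> \<le> \<bar>a\<bar> * \<bar>f x\<bar> + \<bar>b\<bar> * \<bar>g x\<bar>"
        using abs_triangle_ineq[of "a * f x" "b * g x"] by (simp add: abs_mult)
      also have "\<dots> \<le> \<bar>a\<bar> * K + \<bar>b\<bar> * L"
        using KL by (intro add_mono mult_left_mono) auto
      finally show ?thesis .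
    qed
  qed
qed

lemma Bb_diff: "f \<in> Bb \<Longrightarrow> g \<in> Bb \<Longrightarrow> (\<lambda>x. f x - g x) \<in> Bb"
  using Bb_lincomb[of f g 1 "-1"] by simp

lemma Bb_const: "(\<lambda>x. c) \<in> Bb"
  by (rule BbI[where K="\<bar>c\<bar>"]) auto

lemma Bb_indicator: "B \<in> sets borel \<Longrightarrow> indicator B \<in> Bb"
  by (rule BbI[where K=1]) auto

lemma Cb_subset_Bb: "Cb \<subseteq> Bb"
  by (auto simp: Cb_def Bb_def intro: borel_measurable_continuous_onI)

lemma Bb_L2:
  assumes "\<mu> \<in> space (prob_algebra borel)" "f \<in> Bb"
  shows "f \<in> L2 \<mu>"
proof -
  obtain K where "\<And>x. \<bar>f x\<bar> \<le> K" using Bb_boundedE[OF assms(2)] by metis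
  moreover have "prob_space \<mu>" "sets \<mu> = sets borel" using assms(1) by (auto simp: space_prob_algebra)
  ultimately show ?thesis
    using Bb_measurable[OF assms(2)]
    by (intro L2_bounded[where K=K]) (auto simp: prob_space.finite_measure cong: measurable_cong_sets)
qed

text \<open>This is the source of all functions in \<open>Bb\<close> that are constructed below:
  adjoints and resolvents are first found as measures dominated by \<mu> and then become functions
  with bounds that hold everywhere.\<close>

lemma exists_bounded_density:
  assumes "finite_measure \<mu>" "sets N = sets \<mu>" and le: "\<And>B. B \<in> sets \<mu> \<Longrightarrow> emeasure N B \<le> emeasure \<mu> B"
  obtains \<rho> :: "'a \<Rightarrow> real" where "\<rho> \<in> borel_measurable \<mu>" "\<And>x. 0 \<le> \<rho> x" "\<And>x. \<rho> x \<le> 1" "N = density \<mu> \<rho>"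
proof -
  interpret finite_measure \<mu> by fact
  have ac: "absolutely_continuous \<mu> N"
    unfolding absolutely_continuous_def using le assms(2)
    by (auto simp: null_sets_def) (metis le_zero_eq)
  define f where "f = RN_deriv \<mu> N"
  have f[measurable]: "f \<in> borel_measurable \<mu>" by (simp add: f_def)
  have N: "density \<mu> f = N"
    unfolding f_def by (rule density_RN_deriv[OF ac assms(2)])
  \<comment> \<open>On \<open>B\<close> the excess \<open>f - 1\<close> is strictly positive, while
    the domination of \<open>N\<close> by \<mu> makes its integral over \<open>B\<close> vanish;
    hence \<open>B\<close> is a null set.\<close>
  define B where "B = {x\<in>space \<mu>. 1 < f x}"
  have B[measurable]: "B \<in> sets \<mu>" unfolding B_def by measurable
  have fin_B: "(\<integral>\<^sup>+x. indicator B x \<partial>\<mu>) \<noteq> \<infinity>" by (simp add: emeasure_eq_measure)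
  have "(\<integral>\<^sup>+x. f x * indicator B x - indicator B x \<partial>\<mu>) =
      (\<integral>\<^sup>+x. f x * indicator B x \<partial>\<mu>) - (\<integral>\<^sup>+x. indicator B x \<partial>\<mu>)"
    by (rule nn_integral_diff) (use fin_B in \<open>auto simp: B_def split: split_indicator\<close>)
  also have "(\<integral>\<^sup>+x. f x * indicator B x \<partial>\<mu>) = emeasure N B"
    by (simp add: N[symmetric] emeasure_density)
  also have "emeasure N B - (\<integral>\<^sup>+x. indicator B x \<partial>\<mu>) = 0"
    using le[OF B] le_less_trans[OF le[OF B], of top] by (simp add: diff_eq_0_iff_ennreal emeasure_eq_measure)
  finally have "AE x in \<mu>. f x * indicator B x - indicator B x = 0"
    by (subst (asm) nn_integral_0_iff_AE) auto
  with AE_space have AE1: "AE x in \<mu>. f x \<le> 1"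
  proof eventually_elim
    case (elim x)
    show ?case
    proof (rule ccontr)
      assume "\<not> f x \<le> 1"
      then have "1 < f x" "x \<in> B" using elim by (auto simp: B_def)
      then show False using elim by (auto simp: diff_eq_0_iff_ennreal)
    qed
  qed
  define \<rho> where "\<rho> x = enn2real (min 1 (f x))" for x
  have fin: "min 1 (f x) < top" for x using le_less_trans[of "min 1 (f x)" 1 top] by simp
  show ?thesis
  proof (rule that)
    show m: "\<rho> \<in> borel_measurable \<mu>" unfolding \<rho>_def by measurable
    show "0 \<le> \<rho> x" for x by (simp add: \<rho>_def)
    show "\<rho> x \<le> 1" for x
      using fin[of x] by (auto simp: \<rho>_def intro!: enn2real_leI)
    have "AE x in \<mu>. f x = ennreal (\<rho> x)"
      using AE1
    proof eventually_elim
      case (elim x)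
      then show ?case using fin[of x] by (simp add: \<rho>_def min_absorb2 ennreal_enn2real)
    qed
    then have "density \<mu> f = density \<mu> \<rho>"
      using m by (intro density_cong) auto
    then show "N = density \<mu> \<rho>" using N by simp
  qed
qed

lemma trans_op_indicator:
  assumes "t \<ge> 0" "transition_probability P" "B \<in> sets borel"
  shows "trans_op P t (indicator B) x = measure (P t x) B"
proof -
  have "sets (P t x) = sets borel"
    using measurable_space[of "P t" borel "prob_algebra borel" x] assms
    by (auto simp: transition_probability_def space_prob_algebra)
  then show ?thesis using assms(3) by (simp add: trans_op_def sets_eq_imp_space_eq[of _ borel])
qed

text \<open>Contractivity is not an assumption but follows from invariance in
  \<open>contraction\<close>. The locale thus covers every \<open>\<nu>s n\<close>, and also an
  accumulation point as soon as its flow is shown to preserve it.\<close>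

locale invariant_semigroup =
  fixes \<mu> :: "'a::topological_space measure" and P :: "real \<Rightarrow> 'a \<Rightarrow> 'a measure"
  assumes mu: "\<mu> \<in> space (prob_algebra borel)"
    and kernel: "transition_probability P"
    and C0: "C0_semigroup_L2 \<mu> (trans_op P)"
    and inv: "invariant_measure \<mu> (trans_op P)"
begin

abbreviation T where "T \<equiv> trans_op P"

sublocale prob_space \<mu>
  using mu by (simp add: space_prob_algebra)

lemma sets_mu[simp, measurable_cong]: "sets \<mu> = sets borel"
  using mu by (simp add: space_prob_algebra)

lemma space_mu[simp]: "space \<mu> = UNIV"
  using sets_eq_imp_space_eq[OF sets_mu] by simp

lemma kernel_measurable: "t \<ge> 0 \<Longrightarrow> P t \<in> borel \<rightarrow>\<^sub>M prob_algebra borel"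
  using kernel by (simp add: transition_probability_def)

lemma kernel_subprob: "t \<ge> 0 \<Longrightarrow> P t \<in> \<mu> \<rightarrow>\<^sub>M subprob_algebra borel"
  using measurable_prob_algebraD[OF kernel_measurable] by (simp cong: measurable_cong_sets)

lemma kernel_space: "t \<ge> 0 \<Longrightarrow> P t x \<in> space (prob_algebra borel)"
  using measurable_space[OF kernel_measurable] by auto

lemma kernel_prob: "t \<ge> 0 \<Longrightarrow> prob_space (P t x)"
  and sets_kernel[simp]: "t \<ge> 0 \<Longrightarrow> sets (P t x) = sets borel"
  and space_kernel[simp]: "t \<ge> 0 \<Longrightarrow> space (P t x) = UNIV"
  using kernel_space[of t x] sets_eq_imp_space_eq[of "P t x" borel] by (auto simp: space_prob_algebra)

lemma Bb_in_L2: "f \<in> Bb \<Longrightarrow> f \<in> L2 \<mu>"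
  by (rule Bb_L2[OF mu])

lemma T_L2: "t \<ge> 0 \<Longrightarrow> f \<in> L2 \<mu> \<Longrightarrow> T t f \<in> L2 \<mu>"
  using C0[unfolded C0_semigroup_L2_def, THEN conjunct1] by blast

lemma T_lincomb:
  "t \<ge> 0 \<Longrightarrow> f \<in> L2 \<mu> \<Longrightarrow> g \<in> L2 \<mu> \<Longrightarrow>
    AE x in \<mu>. T t (\<lambda>y. a * f y + b * g y) x = a * T t f x + b * T t g x"
  using C0[unfolded C0_semigroup_L2_def, THEN conjunct2, THEN conjunct2, THEN conjunct1] by simp

lemma T_zero: "f \<in> L2 \<mu> \<Longrightarrow> AE x in \<mu>. T 0 f x = f x"
  using C0[unfolded C0_semigroup_L2_def, THEN conjunct2, THEN conjunct2, THEN conjunct2,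
      THEN conjunct2, THEN conjunct1] by simp

lemma T_add: "s \<ge> 0 \<Longrightarrow> t \<ge> 0 \<Longrightarrow> f \<in> L2 \<mu> \<Longrightarrow> AE x in \<mu>. T (s + t) f x = T s (T t f) x"
  using C0[unfolded C0_semigroup_L2_def, THEN conjunct2, THEN conjunct2, THEN conjunct2,
      THEN conjunct2, THEN conjunct2, THEN conjunct1] by simp

lemma T_cont: "f \<in> L2 \<mu> \<Longrightarrow> ((\<lambda>t. norm2 \<mu> (\<lambda>x. T t f x - f x)) \<longlongrightarrow> 0) (at_right 0)"
  using C0[unfolded C0_semigroup_L2_def, THEN conjunct2, THEN conjunct2, THEN conjunct2,
      THEN conjunct2, THEN conjunct2, THEN conjunct2] by simp

lemma T_diff:
  "t \<ge> 0 \<Longrightarrow> f \<in> L2 \<mu> \<Longrightarrow> g \<in> L2 \<mu> \<Longrightarrow> AE x in \<mu>. T t (\<lambda>y. f y - g y) x = T t f x - T t g x"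
  using T_lincomb[of t f g 1 "-1"] by simp

lemma T_const: "t \<ge> 0 \<Longrightarrow> T t (\<lambda>x. c) x = c"
  using kernel_prob[of t x] prob_space.prob_space[of "P t x"] by (simp add: trans_op_def)

lemma T_abs_le:
  assumes "t \<ge> 0" "f \<in> borel_measurable borel" "\<And>x. \<bar>f x\<bar> \<le> K"
  shows "\<bar>T t f x\<bar> \<le> K"
proof -
  interpret P: prob_space "P t x" using assms by (simp add: kernel_prob)
  have "\<bar>T t f x\<bar> \<le> (\<integral>y. \<bar>f y\<bar> \<partial>P t x)"
    unfolding trans_op_def by simp
  also have "\<dots> \<le> (\<integral>y. K \<partial>P t x)"
    using assms abs_ge_zero[of "f x"] order_trans[OF abs_ge_zero assms(3)]
    by (intro integral_mono P.integrable_const_bound[where B=K]) (auto cong: measurable_cong_sets)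
  finally show ?thesis by (simp add: P.prob_space)
qed

lemma T_Bb:
  assumes "t \<ge> 0" "f \<in> Bb"
  shows "T t f \<in> Bb"
proof -
  obtain K where K: "\<And>x. \<bar>f x\<bar> \<le> K" using Bb_boundedE[OF assms(2)] by metis
  have "T t f \<in> borel_measurable borel"
    using L2_measurable[OF T_L2[OF assms(1) Bb_in_L2[OF assms(2)]]] by (simp cong: measurable_cong_sets)
  then show ?thesis
    using T_abs_le[OF assms(1) Bb_measurable[OF assms(2)] K] by (rule BbI)
qed

lemma T_nonneg: "(\<And>x. 0 \<le> f x) \<Longrightarrow> 0 \<le> T t f x"
  unfolding trans_op_def by simp

lemma T_le_1:
  assumes "t \<ge> 0" "f \<in> borel_measurable borel" "\<And>x. 0 \<le> f x" "\<And>x. f x \<le> 1"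
  shows "T t f x \<le> 1"
  using T_abs_le[of t f 1 x] assms by (auto simp: abs_le_iff)

lemma ennreal_T:
  assumes "t \<ge> 0" "f \<in> Bb" "\<And>x. 0 \<le> f x"
  shows "ennreal (T t f x) = (\<integral>\<^sup>+y. ennreal (f y) \<partial>P t x)"
proof -
  interpret P: prob_space "P t x" using assms by (simp add: kernel_prob)
  obtain K where "\<And>x. \<bar>f x\<bar> \<le> K" using Bb_boundedE[OF assms(2)] by metis
  then have "integrable (P t x) f"
    using Bb_measurable[OF assms(2)] assms(1)
    by (intro P.integrable_const_bound[where B=K]) (auto cong: measurable_cong_sets)
  then show ?thesis unfolding trans_op_def using assms(3) by (simp add: nn_integral_eq_integral)
qed

text \<open>Invariance is given for integrals of essentially bounded functions. As an identity of
  measures it extends in \<open>nn_invariant\<close> to all nonnegative Borel functions, in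
  particular to squares of unbounded ones.\<close>

lemma bind_kernel:
  assumes "t \<ge> 0"
  shows "\<mu> \<bind> P t = \<mu>"
proof (rule measure_eqI)
  show "sets (\<mu> \<bind> P t) = sets \<mu>"
    using assms by (simp add: sets_bind[where N=borel])
  fix B assume "B \<in> sets (\<mu> \<bind> P t)"
  then have B[measurable]: "B \<in> sets borel"
    using assms by (simp add: sets_bind[where N=borel])
  note T_Bb[OF assms Bb_indicator[OF B]]
  then have m: "T t (indicator B) \<in> borel_measurable \<mu>"
    by (auto simp: Bb_def cong: measurable_cong_sets)
  have "emeasure (\<mu> \<bind> P t) B = (\<integral>\<^sup>+x. emeasure (P t x) B \<partial>\<mu>)"
    using assms by (intro emeasure_bind[OF _ kernel_subprob]) auto
  also have "\<dots> = (\<integral>\<^sup>+x. ennreal (T t (indicator B) x) \<partial>\<mu>)"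
    using assms by (simp add: ennreal_T Bb_indicator ennreal_indicator)
  also have "\<dots> = ennreal (\<integral>x. T t (indicator B) x \<partial>\<mu>)"
    using m T_le_1[OF assms, of "indicator B"]
    by (intro nn_integral_eq_integral integrable_const_bound[where B=1])
       (auto simp: T_nonneg)
  also have "(\<integral>x. T t (indicator B) x \<partial>\<mu>) = (\<integral>x. indicator B x \<partial>\<mu>)"
    by (rule inv[unfolded invariant_measure_def, rule_format, OF assms])
       (auto intro!: exI[where x=1] AE_I2)
  finally show "emeasure (\<mu> \<bind> P t) B = emeasure \<mu> B"
    by (simp add: emeasure_eq_measure)
qed

lemma nn_invariant:
  assumes "t \<ge> 0" "f \<in> borel_measurable borel"
  shows "(\<integral>\<^sup>+x. \<integral>\<^sup>+y. f y \<partial>P t x \<partial>\<mu>) = (\<integral>\<^sup>+x. f x \<partial>\<mu>)"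
  using nn_integral_bind[OF assms(2) kernel_subprob[OF assms(1)]] bind_kernel[OF assms(1)] by simp

text \<open>Jensen's inequality for the kernel, integrated against the invariant measure.\<close>

lemma contraction:
  assumes t: "t \<ge> 0" and f: "f \<in> L2 \<mu>"
  shows "norm2 \<mu> (T t f) \<le> norm2 \<mu> f"
proof -
  have fm: "f \<in> borel_measurable borel"
    using L2_measurable[OF f] by (simp cong: measurable_cong_sets)
  have *: "ennreal ((T t f x)\<^sup>2) \<le> (\<integral>\<^sup>+y. ennreal ((f y)\<^sup>2) \<partial>P t x)" for x
  proof (cases "integrable (P t x) (\<lambda>y. (f y)\<^sup>2)")
    case True
    interpret P: prob_space "P t x" using t by (simp add: kernel_prob)
    have "f \<in> L2 (P t x)" using True fm t by (simp add: L2_def cong: measurable_cong_sets)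
    moreover have "(\<lambda>x. 1) \<in> L2 (P t x)" by (simp add: L2_def)
    ultimately have "\<bar>ip (P t x) f (\<lambda>x. 1)\<bar> \<le> norm2 (P t x) f * norm2 (P t x) (\<lambda>x. 1)"
      by (rule ip_Cauchy_Schwarz)
    then have "\<bar>T t f x\<bar> \<le> norm2 (P t x) f"
      by (simp add: norm2_def ip_def trans_op_def P.prob_space)
    then have "(T t f x)\<^sup>2 \<le> (norm2 (P t x) f)\<^sup>2"
      using norm2_nonneg by (metis abs_le_square_iff abs_of_nonneg)
    then have "(T t f x)\<^sup>2 \<le> (\<integral>y. (f y)\<^sup>2 \<partial>P t x)"
      by (simp only: norm2_sq ip_def flip: power2_eq_square)
    then show ?thesis using True by (simp add: nn_integral_eq_integral ennreal_leI)
  next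
    \<comment> \<open>Where the square is not integrable the right side is infinite, whatever
      default value \<open>T t f x\<close> takes.\<close>
    case False
    then have "(\<integral>\<^sup>+y. ennreal ((f y)\<^sup>2) \<partial>P t x) = \<infinity>"
      using fm t by (subst (asm) integrable_iff_bounded) (auto simp: not_less top_unique cong: measurable_cong_sets)
    then show ?thesis by simp
  qed
  have "ennreal (ip \<mu> (T t f) (T t f)) = (\<integral>\<^sup>+x. ennreal ((T t f x)\<^sup>2) \<partial>\<mu>)"
    using T_L2[OF t f] by (simp add: L2_def ip_def nn_integral_eq_integral flip: power2_eq_square)
  also have "\<dots> \<le> (\<integral>\<^sup>+x. \<integral>\<^sup>+y. ennreal ((f y)\<^sup>2) \<partial>P t x \<partial>\<mu>)"
    by (intro nn_integral_mono *)
  also have "\<dots> = (\<integral>\<^sup>+x. ennreal ((f x)\<^sup>2) \<partial>\<mu>)"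
    using t fm by (intro nn_invariant) auto
  also have "\<dots> = ennreal (ip \<mu> f f)"
    using f by (simp add: L2_def ip_def nn_integral_eq_integral flip: power2_eq_square)
  finally show ?thesis
    by (simp add: norm2_def ip_self_nonneg)
qed

text \<open>Contraction makes the modulus of continuity at time 0 valid at all times.\<close>

lemma norm2_T_diff_le:
  assumes "s \<ge> 0" "r \<ge> 0" "f \<in> L2 \<mu>"
  shows "norm2 \<mu> (\<lambda>x. T (s + r) f x - T s f x) \<le> norm2 \<mu> (\<lambda>x. T r f x - f x)"
proof -
  have "AE x in \<mu>. T (s + r) f x - T s f x = T s (\<lambda>y. T r f y - f y) x"
    using T_add[OF assms] T_diff[OF assms(1) T_L2[OF assms(2,3)] assms(3)] by eventually_elim simp
  then have "norm2 \<mu> (\<lambda>x. T (s + r) f x - T s f x) = norm2 \<mu> (T s (\<lambda>y. T r f y - f y))"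
    using assms by (intro norm2_cong_AE L2_diff T_L2) auto
  also have "\<dots> \<le> norm2 \<mu> (\<lambda>x. T r f x - f x)"
    using assms by (intro contraction L2_diff T_L2)
  finally show ?thesis .
qed

end

section \<open>Adjoints on bounded functions and weak continuity in time\<close>

lemma (in invariant_semigroup) integrable_mult_Bb:
  "f \<in> Bb \<Longrightarrow> g \<in> Bb \<Longrightarrow> integrable \<mu> (\<lambda>x. f x * g x)"
  by (intro L2_integrable_mult Bb_in_L2)

text \<open>Reduces identities that are linear in a bounded function to functions with values in
  [0,1], which act as densities of measures dominated by the reference measure.\<close>

lemma affine_to_unit_interval:
  assumes "f \<in> Bb"
  obtains a b :: real and h where "h \<in> Bb" "\<And>x. 0 \<le> h x" "\<And>x. h x \<le> 1" "f = (\<lambda>x. a * h x + b * 1)" "0 < a"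
proof -
  obtain K where K: "0 < K" "\<And>x. \<bar>f x\<bar> \<le> K" using Bb_boundedE[OF assms] by metis
  have b: "- K \<le> f x" "f x \<le> K" for x using K(2)[of x] by (auto simp: abs_le_iff)
  define h where "h x = (1 / (2 * K)) * f x + (1 / 2) * 1" for x
  show ?thesis
  proof (rule that[of h "2 * K" "- K"])
    show "h \<in> Bb" unfolding h_def by (intro Bb_lincomb assms Bb_const)
    show "0 \<le> h x" "h x \<le> 1" for x using b[of x] K(1) by (auto simp: h_def field_simps)
    show "f = (\<lambda>x. 2 * K * h x + - K * 1)" using K(1) by (auto simp: h_def field_simps)
  qed (use K(1) in simp)
qed

context invariant_semigroup
begin

text \<open>Since \<open>\<phi> \<le> 1\<close>, the measure with density \<phi> pushed through
  \<open>P s\<close> is dominated by \<mu> pushed through \<open>P s\<close>, which is \<mu> by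
  invariance. Its density \<rho> is the adjoint of \<open>T s\<close> applied to \<phi>, obtained as
  a bounded function and not only as an element of \<open>L2 \<mu>\<close>.\<close>

lemma adjoint_unit:
  assumes s: "s \<ge> 0" and \<phi>: "\<phi> \<in> Bb" "\<And>x. 0 \<le> \<phi> x" "\<And>x. \<phi> x \<le> 1"
  obtains \<rho> where "\<rho> \<in> Bb" "\<And>f. f \<in> Bb \<Longrightarrow> ip \<mu> (T s f) \<phi> = ip \<mu> f \<rho>"
proof -
  have \<phi>m[measurable]: "\<phi> \<in> borel_measurable borel" using \<phi> by (simp add: Bb_def)
  define M where "M = density \<mu> \<phi> \<bind> P s"
  have k: "P s \<in> density \<mu> \<phi> \<rightarrow>\<^sub>M subprob_algebra borel"
    using kernel_subprob[OF s] by simp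
  have sM: "sets M = sets \<mu>"
    unfolding M_def using s by (simp add: sets_bind[where N=borel])
  have nnM: "(\<integral>\<^sup>+x. f x \<partial>M) = (\<integral>\<^sup>+x. \<phi> x * (\<integral>\<^sup>+y. f y \<partial>P s x) \<partial>\<mu>)" if f[measurable]: "f \<in> borel_measurable borel" for f
  proof -
    have m: "(\<lambda>x. \<integral>\<^sup>+y. f y \<partial>P s x) \<in> borel_measurable \<mu>"
      using measurable_compose[OF kernel_subprob[OF s] nn_integral_measurable_subprob_algebra[OF f]] .
    have "(\<integral>\<^sup>+x. f x \<partial>M) = (\<integral>\<^sup>+x. (\<integral>\<^sup>+y. f y \<partial>P s x) \<partial>density \<mu> \<phi>)"
      unfolding M_def by (rule nn_integral_bind[OF f k])
    also have "\<dots> = (\<integral>\<^sup>+x. \<phi> x * (\<integral>\<^sup>+y. f y \<partial>P s x) \<partial>\<mu>)"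
      by (rule nn_integral_density) (use m in auto)
    finally show ?thesis .
  qed
  have le: "emeasure M B \<le> emeasure \<mu> B" if B: "B \<in> sets \<mu>" for B
  proof -
    have "emeasure M B = (\<integral>\<^sup>+x. indicator B x \<partial>M)" using B sM by simp
    also have "\<dots> = (\<integral>\<^sup>+x. \<phi> x * (\<integral>\<^sup>+y. indicator B y \<partial>P s x) \<partial>\<mu>)"
      using B by (intro nnM) auto
    also have "\<dots> \<le> (\<integral>\<^sup>+x. 1 * (\<integral>\<^sup>+y. indicator B y \<partial>P s x) \<partial>\<mu>)"
      using \<phi> by (intro nn_integral_mono mult_right_mono) auto
    also have "\<dots> = (\<integral>\<^sup>+x. indicator B x \<partial>\<mu>)"
      using nn_invariant[OF s, of "indicator B"] B by simp
    finally show ?thesis using B by simp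
  qed
  obtain \<rho> :: "'a \<Rightarrow> real" where \<rho>: "\<rho> \<in> borel_measurable \<mu>" "\<And>x. 0 \<le> \<rho> x" "\<And>x. \<rho> x \<le> 1" "M = density \<mu> \<rho>"
    using exists_bounded_density[OF finite_measure_axioms sM le] by blast
  have \<rho>m[measurable]: "\<rho> \<in> borel_measurable borel" using \<rho>(1) by (simp cong: measurable_cong_sets)
  have \<rho>B: "\<rho> \<in> Bb" using \<rho> by (intro BbI[where K=1]) (auto simp: abs_le_iff)
  have nonneg: "ip \<mu> (T s f) \<phi> = ip \<mu> f \<rho>" if f: "f \<in> Bb" and f0: "\<And>x. 0 \<le> f x" for f
  proof -
    have fm[measurable]: "f \<in> borel_measurable borel" using f by (simp add: Bb_def)
    have "ennreal (ip \<mu> (T s f) \<phi>) = (\<integral>\<^sup>+x. ennreal (T s f x * \<phi> x) \<partial>\<mu>)"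
      unfolding ip_def using T_nonneg[of f s] f0 \<phi>
      by (intro nn_integral_eq_integral[symmetric] integrable_mult_Bb T_Bb s f AE_I2) auto
    also have "\<dots> = (\<integral>\<^sup>+x. \<phi> x * (\<integral>\<^sup>+y. f y \<partial>P s x) \<partial>\<mu>)"
      using \<phi>(2) f0 by (intro nn_integral_cong) (simp add: ennreal_mult' ennreal_T[OF s f, symmetric] mult.commute)
    also have "\<dots> = (\<integral>\<^sup>+x. f x \<partial>M)"
      by (rule nnM[symmetric]) auto
    also have "\<dots> = (\<integral>\<^sup>+x. \<rho> x * ennreal (f x) \<partial>\<mu>)"
      unfolding \<rho>(4) by (rule nn_integral_density) (use \<rho> in auto)
    also have "\<dots> = (\<integral>\<^sup>+x. ennreal (f x * \<rho> x) \<partial>\<mu>)"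
      using f0 \<rho>(2) by (simp add: ennreal_mult mult.commute)
    also have "\<dots> = ennreal (ip \<mu> f \<rho>)"
      unfolding ip_def using f0 \<rho>
      by (intro nn_integral_eq_integral integrable_mult_Bb f \<rho>B AE_I2) auto
    finally show ?thesis
      using T_nonneg[of f s] f0 \<phi> \<rho> by (subst (asm) ennreal_inj) (auto simp: ip_def)
  qed
  have "ip \<mu> (T s f) \<phi> = ip \<mu> f \<rho>" if f: "f \<in> Bb" for f
  proof -
    obtain a b h where h: "h \<in> Bb" "\<And>x. 0 \<le> h x" "f = (\<lambda>x. a * h x + b * 1)"
      using affine_to_unit_interval[OF f] by metis
    have L: "h \<in> L2 \<mu>" "(\<lambda>x. 1) \<in> L2 \<mu>" "T s h \<in> L2 \<mu>" "T s (\<lambda>x. 1) \<in> L2 \<mu>" "\<phi> \<in> L2 \<mu>" "\<rho> \<in> L2 \<mu>" "f \<in> L2 \<mu>"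
      using h f \<phi> \<rho>B s by (auto intro!: Bb_in_L2 T_Bb Bb_const)
    have "ip \<mu> (T s f) \<phi> = ip \<mu> (\<lambda>x. a * T s h x + b * T s (\<lambda>x. 1) x) \<phi>"
      unfolding h(3) using L s T_lincomb[OF s L(1,2), of a b]
      by (intro ip_cong_AE T_L2 L2_lincomb) auto
    also have "\<dots> = a * ip \<mu> h \<rho> + b * ip \<mu> (\<lambda>x. 1) \<rho>"
      using L nonneg[OF h(1,2)] nonneg[OF Bb_const[of 1]] by (simp add: ip_lincomb_left)
    also have "\<dots> = ip \<mu> f \<rho>"
      unfolding h(3) using L by (subst ip_lincomb_left) auto
    finally show ?thesis .
  qed
  then show ?thesis using \<rho>B that by blast
qed

text \<open>A function known only through its pairings with \<open>Bb\<close> can be acted on by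
  \<open>T s\<close> only if \<open>T s\<close> is moved to the test function and the result is
  again in \<open>Bb\<close>.\<close>

lemma adjoint:
  assumes s: "s \<ge> 0" and \<phi>: "\<phi> \<in> Bb"
  obtains \<rho> where "\<rho> \<in> Bb" "\<And>f. f \<in> Bb \<Longrightarrow> ip \<mu> (T s f) \<phi> = ip \<mu> f \<rho>"
proof -
  obtain a b h where h: "h \<in> Bb" "\<And>x. 0 \<le> h x" "\<And>x. h x \<le> 1" "\<phi> = (\<lambda>x. a * h x + b * 1)"
    using affine_to_unit_interval[OF \<phi>] by metis
  obtain \<rho> where \<rho>: "\<rho> \<in> Bb" "\<And>f. f \<in> Bb \<Longrightarrow> ip \<mu> (T s f) h = ip \<mu> f \<rho>"
    using adjoint_unit[OF s h(1-3)] by metis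
  obtain \<rho>1 where \<rho>1: "\<rho>1 \<in> Bb" "\<And>f. f \<in> Bb \<Longrightarrow> ip \<mu> (T s f) (\<lambda>x. 1) = ip \<mu> f \<rho>1"
    using adjoint_unit[OF s Bb_const[of 1]] by auto
  show ?thesis
  proof (rule that)
    show "(\<lambda>x. a * \<rho> x + b * \<rho>1 x) \<in> Bb" using \<rho> \<rho>1 by (intro Bb_lincomb)
    fix f :: "'a \<Rightarrow> real" assume f: "f \<in> Bb"
    show "ip \<mu> (T s f) \<phi> = ip \<mu> f (\<lambda>x. a * \<rho> x + b * \<rho>1 x)"
      unfolding h(4) using f \<rho> \<rho>1 h(1) s
      by (subst (1 2) ip_lincomb_right) (auto intro!: Bb_in_L2 T_Bb Bb_const)
  qed
qed

lemma norm2_T_continuous: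
  assumes "0 \<le> s" "0 \<le> t" "f \<in> L2 \<mu>"
  shows "norm2 \<mu> (\<lambda>x. T t f x - T s f x) \<le> norm2 \<mu> (\<lambda>x. T \<bar>t - s\<bar> f x - f x)"
proof (cases "s \<le> t")
  case True
  then show ?thesis using norm2_T_diff_le[of s "t - s" f] assms by simp
next
  case False
  have "norm2 \<mu> (\<lambda>x. T t f x - T s f x) = norm2 \<mu> (\<lambda>x. T s f x - T t f x)"
    using norm2_mult[of \<mu> "-1" "\<lambda>x. T s f x - T t f x"] by simp
  then show ?thesis using norm2_T_diff_le[of t "s - t" f] assms False by simp
qed

text \<open>Strong continuity is given at time 0 from the right; contraction carries it to both
  sides of every time. The cut \<open>max 0 t\<close> continues the function constantly to negative
  times, so that it is Borel on the whole line and can be integrated against a law there.\<close>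

lemma continuous_ip_T:
  assumes f: "f \<in> L2 \<mu>" and \<phi>: "\<phi> \<in> L2 \<mu>"
  shows "continuous_on UNIV (\<lambda>t. ip \<mu> (T (max 0 t) f) \<phi>)"
proof (rule continuous_onI, simp)
  fix t e :: real assume e: "0 < e"
  define e' where "e' = e / (norm2 \<mu> \<phi> + 1)"
  have pos: "0 < norm2 \<mu> \<phi> + 1" using norm2_nonneg[of \<mu> \<phi>] by simp
  then have e': "0 < e'" using e by (simp add: e'_def)
  from tendstoD[OF T_cont[OF f] e'] obtain d where d: "0 < d"
    "\<And>r. 0 < r \<Longrightarrow> r < d \<Longrightarrow> norm2 \<mu> (\<lambda>x. T r f x - f x) < e'"
    unfolding eventually_at_right_field by (auto simp: norm2_nonneg)
  show "\<exists>d>0. \<forall>s. dist s t < d \<longrightarrow> dist (ip \<mu> (T (max 0 s) f) \<phi>) (ip \<mu> (T (max 0 t) f) \<phi>) \<le> e"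
  proof (intro exI conjI allI impI)
    fix s assume s: "dist s t < d"
    define a b where "a = max 0 s" and "b = max 0 t"
    have ab: "0 \<le> a" "0 \<le> b" "\<bar>a - b\<bar> < d" using s by (auto simp: a_def b_def dist_real_def)
    show "dist (ip \<mu> (T (max 0 s) f) \<phi>) (ip \<mu> (T (max 0 t) f) \<phi>) \<le> e"
    proof (cases "a = b")
      case False
      have "\<bar>ip \<mu> (T a f) \<phi> - ip \<mu> (T b f) \<phi>\<bar> = \<bar>ip \<mu> (\<lambda>x. T a f x - T b f x) \<phi>\<bar>"
        using f \<phi> ab by (simp add: ip_diff_left T_L2)
      also have "\<dots> \<le> norm2 \<mu> (\<lambda>x. T a f x - T b f x) * norm2 \<mu> \<phi>"
        using f \<phi> ab by (intro ip_Cauchy_Schwarz L2_diff T_L2)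
      also have "\<dots> \<le> e' * norm2 \<mu> \<phi>"
        using norm2_T_continuous[OF ab(2,1) f] d(2)[of "\<bar>a - b\<bar>"] False ab
        by (intro mult_right_mono norm2_nonneg) auto
      also have "\<dots> \<le> e" using e pos norm2_nonneg[of \<mu> \<phi>] by (simp add: e'_def field_simps)
      finally show ?thesis by (simp add: dist_real_def a_def b_def)
    qed (use e in \<open>simp add: a_def b_def\<close>)
  qed (rule d(1))
qed

end

section \<open>Exponential times and the resolvent as an averaged semigroup\<close>

text \<open>Averaging \<open>T t g\<close> over this law gives \<beta> times the resolvent of
  \<open>g\<close>. The normalisation as a probability keeps averages of functions with values in
  [0,1] in the same range.\<close>

definition exponential :: "real \<Rightarrow> real measure" where
  "exponential \<beta> = density lborel (exponential_density \<beta>)"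

lemma prob_space_exponential: "0 < \<beta> \<Longrightarrow> prob_space (exponential \<beta>)"
  unfolding exponential_def by (rule prob_space_exponential_density)

lemma sets_exponential[simp, measurable_cong]: "sets (exponential \<beta>) = sets borel"
  and space_exponential[simp]: "space (exponential \<beta>) = UNIV"
  by (simp_all add: exponential_def)

lemma AE_exponential_nonneg: "AE t in exponential \<beta>. 0 \<le> t"
  unfolding exponential_def by (subst AE_density) (auto simp: exponential_density_def)

lemma integral_exponential:
  assumes "F \<in> borel_measurable borel" "0 < \<beta>"
  shows "(\<integral>t. F t \<partial>exponential \<beta>) = (\<integral>t. exponential_density \<beta> t * F t \<partial>lborel)"
  unfolding exponential_def using assms
  by (subst integral_density) (auto simp: exponential_density_nonneg)

context invariant_semigroup
begin

text \<open>The function \<open>w\<close> is \<open>\<beta>\<close> times the resolvent applied to \<open>g\<close>.\<close>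

lemma exists_weak_resolvent:
  assumes \<beta>: "0 < \<beta>" and g: "g \<in> Bb" "\<And>x. 0 \<le> g x" "\<And>x. g x \<le> 1"
  obtains w where "w \<in> Bb" "\<And>\<phi>. \<phi> \<in> Bb \<Longrightarrow> ip \<mu> w \<phi> = (\<integral>t. ip \<mu> (T (max 0 t) g) \<phi> \<partial>exponential \<beta>)"
proof -
  interpret Q: prob_space "exponential \<beta>" by (rule prob_space_exponential[OF \<beta>])
  define m where "m t = density \<mu> (T (max 0 t) g)" for t
  have Tg: "T (max 0 t) g \<in> Bb" for t using g by (intro T_Bb) auto
  then have Tm[measurable]: "T (max 0 t) g \<in> borel_measurable borel" for t by (simp add: Bb_def)
  have T01: "0 \<le> T (max 0 t) g x" "T (max 0 t) g x \<le> 1" for t x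
    using g by (auto intro!: T_nonneg T_le_1 simp: Bb_def)
  have nn: "(\<integral>\<^sup>+x. ennreal (T (max 0 t) g x) * ennreal (\<phi> x) \<partial>\<mu>) = ennreal (ip \<mu> (T (max 0 t) g) \<phi>)"
    if "\<phi> \<in> Bb" "\<And>x. 0 \<le> \<phi> x" for t \<phi>
  proof -
    have "(\<integral>\<^sup>+x. ennreal (T (max 0 t) g x) * ennreal (\<phi> x) \<partial>\<mu>) = (\<integral>\<^sup>+x. ennreal (T (max 0 t) g x * \<phi> x) \<partial>\<mu>)"
      using T01 by (simp add: ennreal_mult')
    also have "\<dots> = ennreal (ip \<mu> (T (max 0 t) g) \<phi>)"
      unfolding ip_def using that T01
      by (intro nn_integral_eq_integral integrable_mult_Bb Tg AE_I2) auto
    finally show ?thesis .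
  qed
  have em: "emeasure (m t) B = ennreal (ip \<mu> (T (max 0 t) g) (indicator B))" if B: "B \<in> sets borel" for t B
  proof -
    have "emeasure (m t) B = (\<integral>\<^sup>+x. ennreal (T (max 0 t) g x) * indicator B x \<partial>\<mu>)"
      unfolding m_def using B by (intro emeasure_density) auto
    then show ?thesis using nn[OF Bb_indicator[OF B], of t] by (simp add: ennreal_indicator)
  qed
  have em_le: "emeasure (m t) B \<le> emeasure \<mu> B" if B: "B \<in> sets borel" for t B
  proof -
    have "emeasure (m t) B = (\<integral>\<^sup>+x. ennreal (T (max 0 t) g x) * indicator B x \<partial>\<mu>)"
      unfolding m_def using B by (intro emeasure_density) auto
    also have "\<dots> \<le> (\<integral>\<^sup>+x. indicator B x \<partial>\<mu>)"
      using T01 by (intro nn_integral_mono) (auto split: split_indicator)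
    finally show ?thesis using B by simp
  qed
  have meas: "(\<lambda>t. ip \<mu> (T (max 0 t) g) \<phi>) \<in> borel_measurable borel" if "\<phi> \<in> Bb" for \<phi>
    using that g by (intro borel_measurable_continuous_onI continuous_ip_T Bb_in_L2)
  have m: "m \<in> exponential \<beta> \<rightarrow>\<^sub>M subprob_algebra borel"
  proof (rule measurable_subprob_algebra)
    show "subprob_space (m t)" for t
      using em_le[of UNIV t] emeasure_space_1 by (intro subprob_spaceI) (auto simp: m_def)
    show "sets (m t) = sets borel" for t by (simp add: m_def)
    fix B :: "'a set" assume B: "B \<in> sets borel"
    show "(\<lambda>t. emeasure (m t) B) \<in> borel_measurable (exponential \<beta>)"
      using meas[OF Bb_indicator[OF B]] by (simp add: em[OF B] cong: measurable_cong_sets)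
  qed
  \<comment> \<open>Mixing the measures \<open>m t\<close> requires only that
    \<open>t \<mapsto> m t B\<close> is measurable for each \<open>B\<close>, which is the weak
    continuity proved above; averaging \<open>T t g x\<close> for fixed \<open>x\<close> would
    require measurability in \<open>t\<close> pointwise.\<close>
  define N where "N = exponential \<beta> \<bind> m"
  have sN: "sets N = sets \<mu>"
    unfolding N_def by (subst sets_bind[where N=borel]) (auto simp: m_def)
  have le: "emeasure N B \<le> emeasure \<mu> B" if B: "B \<in> sets \<mu>" for B
  proof -
    have "emeasure N B = (\<integral>\<^sup>+t. emeasure (m t) B \<partial>exponential \<beta>)"
      unfolding N_def using B m by (intro emeasure_bind) auto
    also have "\<dots> \<le> (\<integral>\<^sup>+t. emeasure \<mu> B \<partial>exponential \<beta>)"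
      using B em_le by (intro nn_integral_mono) auto
    finally show ?thesis using Q.emeasure_space_1 by simp
  qed
  obtain w :: "'a \<Rightarrow> real" where w: "w \<in> borel_measurable \<mu>" "\<And>x. 0 \<le> w x" "\<And>x. w x \<le> 1" "N = density \<mu> w"
    using exists_bounded_density[OF finite_measure_axioms sN le] by blast
  have wm[measurable]: "w \<in> borel_measurable borel" using w(1) by (simp cong: measurable_cong_sets)
  have wB: "w \<in> Bb" using w by (intro BbI[where K=1]) (auto simp: abs_le_iff)
  have int: "integrable (exponential \<beta>) (\<lambda>t. ip \<mu> (T (max 0 t) g) \<phi>)" if "\<phi> \<in> Bb" for \<phi>
  proof (rule Q.integrable_const_bound[where B="norm2 \<mu> g * norm2 \<mu> \<phi>"])
    have "\<bar>ip \<mu> (T (max 0 t) g) \<phi>\<bar> \<le> norm2 \<mu> g * norm2 \<mu> \<phi>" for t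
      using that g by (intro order_trans[OF ip_Cauchy_Schwarz] mult_right_mono contraction norm2_nonneg T_L2 Bb_in_L2) auto
    then show "AE t in exponential \<beta>. norm (ip \<mu> (T (max 0 t) g) \<phi>) \<le> norm2 \<mu> g * norm2 \<mu> \<phi>"
      by simp
  qed (use meas[OF that] in \<open>simp cong: measurable_cong_sets\<close>)
  have nonneg: "ip \<mu> w \<phi> = (\<integral>t. ip \<mu> (T (max 0 t) g) \<phi> \<partial>exponential \<beta>)"
    if \<phi>: "\<phi> \<in> Bb" "\<And>x. 0 \<le> \<phi> x" for \<phi>
  proof -
    have \<phi>m[measurable]: "\<phi> \<in> borel_measurable borel" using \<phi> by (simp add: Bb_def)
    have ip0: "0 \<le> ip \<mu> (T (max 0 t) g) \<phi>" for t
      using \<phi> T01 by (simp add: ip_def)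
    have "ennreal (ip \<mu> w \<phi>) = (\<integral>\<^sup>+x. ennreal (w x * \<phi> x) \<partial>\<mu>)"
      unfolding ip_def using \<phi> w
      by (intro nn_integral_eq_integral[symmetric] integrable_mult_Bb wB AE_I2) auto
    also have "\<dots> = (\<integral>\<^sup>+x. ennreal (w x) * ennreal (\<phi> x) \<partial>\<mu>)"
      using w by (simp add: ennreal_mult')
    also have "\<dots> = (\<integral>\<^sup>+x. \<phi> x \<partial>N)"
      unfolding w(4) by (rule nn_integral_density[symmetric]) auto
    also have "\<dots> = (\<integral>\<^sup>+t. \<integral>\<^sup>+x. \<phi> x \<partial>m t \<partial>exponential \<beta>)"
      unfolding N_def by (rule nn_integral_bind[OF _ m]) auto
    also have "\<dots> = (\<integral>\<^sup>+t. ennreal (ip \<mu> (T (max 0 t) g) \<phi>) \<partial>exponential \<beta>)"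
    proof (intro nn_integral_cong)
      fix t
      have "(\<integral>\<^sup>+x. \<phi> x \<partial>m t) = (\<integral>\<^sup>+x. ennreal (T (max 0 t) g x) * ennreal (\<phi> x) \<partial>\<mu>)"
        unfolding m_def by (rule nn_integral_density) auto
      then show "(\<integral>\<^sup>+x. \<phi> x \<partial>m t) = ennreal (ip \<mu> (T (max 0 t) g) \<phi>)"
        using nn[OF \<phi>] by simp
    qed
    also have "\<dots> = ennreal (\<integral>t. ip \<mu> (T (max 0 t) g) \<phi> \<partial>exponential \<beta>)"
      using int[OF \<phi>(1)] ip0 by (intro nn_integral_eq_integral) auto
    finally show ?thesis
      using ip0 \<phi> w by (subst (asm) ennreal_inj) (auto simp: ip_def[of \<mu> w] intro!: integral_nonneg_AE)
  qed
  show ?thesis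
  proof (rule that[OF wB])
    fix \<phi> :: "'a \<Rightarrow> real" assume \<phi>: "\<phi> \<in> Bb"
    obtain a b h where h: "h \<in> Bb" "\<And>x. 0 \<le> h x" "\<phi> = (\<lambda>x. a * h x + b * 1)"
      using affine_to_unit_interval[OF \<phi>] by metis
    have lin: "ip \<mu> u \<phi> = a * ip \<mu> u h + b * ip \<mu> u (\<lambda>x. 1)" if "u \<in> Bb" for u
      unfolding h(3) using that h(1) by (intro ip_lincomb_right Bb_in_L2 Bb_const)
    show "ip \<mu> w \<phi> = (\<integral>t. ip \<mu> (T (max 0 t) g) \<phi> \<partial>exponential \<beta>)"
      unfolding lin[OF wB] lin[OF Tg] using int[OF h(1)] int[OF Bb_const[of 1]]
        nonneg[OF h(1,2)] nonneg[OF Bb_const[of 1]] by simp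
  qed
qed

end

text \<open>Lack of memory: translation by \<open>s\<close> multiplies the density by
  \<open>exp (\<beta> * s)\<close> and removes the times below \<open>s\<close>.\<close>

lemma exponential_shift:
  assumes \<beta>: "0 < \<beta>" and s: "0 \<le> s" and F[measurable]: "F \<in> borel_measurable borel" and K: "\<And>t. \<bar>F t\<bar> \<le> K"
  shows "(\<integral>t. F (t + s) \<partial>exponential \<beta>) =
    exp (\<beta> * s) * ((\<integral>t. F t \<partial>exponential \<beta>) - (\<integral>t. indicator {..<s} t * F t \<partial>exponential \<beta>))"
proof -
  interpret Q: prob_space "exponential \<beta>" by (rule prob_space_exponential[OF \<beta>])
  have dens: "exponential_density \<beta> (u - s) = exp (\<beta> * s) * (exponential_density \<beta> u * (1 - indicator {..<s} u))" for u
    using s by (auto simp: exponential_density_def indicator_def algebra_simps simp flip: exp_add)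
  have i1: "integrable (exponential \<beta>) F"
    using K by (intro Q.integrable_const_bound[where B=K]) auto
  have i2: "integrable (exponential \<beta>) (\<lambda>t. indicator {..<s} t * F t)"
    using K order_trans[OF abs_ge_zero K] by (intro Q.integrable_const_bound[where B=K]) (auto split: split_indicator)
  have "(\<integral>t. F (t + s) \<partial>exponential \<beta>) = (\<integral>t. exponential_density \<beta> t * F (t + s) \<partial>lborel)"
    using \<beta> by (intro integral_exponential) auto
  also have "\<dots> = (\<integral>u. exponential_density \<beta> (u - s) * F u \<partial>lborel)"
    by (subst lborel_integral_real_affine[where c=1 and t=s]) (auto simp: add.commute)
  also have "\<dots> = exp (\<beta> * s) * (\<integral>u. exponential_density \<beta> u * (F u - indicator {..<s} u * F u) \<partial>lborel)"
    unfolding dens by (simp only: mult.assoc integral_mult_right_zero left_diff_distrib mult_1)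
  also have "(\<integral>u. exponential_density \<beta> u * (F u - indicator {..<s} u * F u) \<partial>lborel) =
      (\<integral>u. F u - indicator {..<s} u * F u \<partial>exponential \<beta>)"
    using \<beta> by (intro integral_exponential[symmetric]) auto
  finally show ?thesis using i1 i2 by simp
qed

lemma exponential_lessThan:
  assumes "0 < \<beta>" "0 \<le> s"
  shows "exp (\<beta> * s) * (\<integral>t. indicator {..<s} t \<partial>exponential \<beta>) = exp (\<beta> * s) - 1"
proof -
  interpret Q: prob_space "exponential \<beta>" by (rule prob_space_exponential[OF assms(1)])
  show ?thesis
    using exponential_shift[OF assms, of "\<lambda>_. 1" 1] Q.prob_space by (simp add: algebra_simps)
qed

text \<open>Scalar form of the identity \<open>A w = \<beta> (w - g)\<close> for
  \<open>w = \<beta> G g\<close>. With \<open>F t\<close> the pairing of \<open>T t g\<close> with a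
  test function, \<open>W\<close> is the pairing of \<open>w\<close>, \<open>F 0\<close> that of
  \<open>g\<close>, and the shifted integral that of \<open>T s w\<close>. The bound is explicit
  because convergence in norm requires uniformity over the test functions.\<close>

lemma exponential_difference_quotient:
  assumes \<beta>: "0 < \<beta>" and s: "0 < s" and F[measurable]: "F \<in> borel_measurable borel" and K: "\<And>t. \<bar>F t\<bar> \<le> K"
    and \<delta>: "\<And>t. 0 \<le> t \<Longrightarrow> t < s \<Longrightarrow> \<bar>F t - F 0\<bar> \<le> \<delta>"
  defines "W \<equiv> \<integral>t. F t \<partial>exponential \<beta>"
  shows "\<bar>((\<integral>t. F (t + s) \<partial>exponential \<beta>) - W) / s - \<beta> * (W - F 0)\<bar> \<le>
    \<bar>(exp (\<beta> * s) - 1) / s - \<beta>\<bar> * \<bar>W - F 0\<bar> + (exp (\<beta> * s) - 1) / s * \<delta>"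
proof -
  interpret Q: prob_space "exponential \<beta>" by (rule prob_space_exponential[OF \<beta>])
  \<comment> \<open>\<open>q\<close> is the probability that the exponential time falls below
    \<open>s\<close>, and \<open>R\<close> is the error made by freezing \<open>F\<close> at
    \<open>F 0\<close> on that event. The relation \<open>p * q = p - 1\<close> is what produces the
    difference quotient of the exponential.\<close>
  define p where "p = exp (\<beta> * s)"
  define q where "q = (\<integral>t. indicat_real {..<s} t \<partial>exponential \<beta>)"
  define R where "R = (\<integral>t. indicator {..<s} t * (F t - F 0) \<partial>exponential \<beta>)"
  have p0: "0 < p" by (simp add: p_def)
  have pq: "p * q = p - 1"
    using exponential_lessThan[OF \<beta>, of s] s by (simp add: p_def q_def)
  have K0: "0 \<le> K" using order_trans[OF abs_ge_zero K] .
  have \<delta>0: "0 \<le> \<delta>" using \<delta>[of 0] s by simp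
  have i1: "integrable (exponential \<beta>) (\<lambda>t. indicator {..<s} t * F t)"
    using K K0 by (intro Q.integrable_const_bound[where B=K]) (auto split: split_indicator)
  have i2: "integrable (exponential \<beta>) (\<lambda>t. indicator {..<s} t * F 0)"
    using K K0 by (intro Q.integrable_const_bound[where B=K]) (auto split: split_indicator)
  have split: "(\<integral>t. indicator {..<s} t * F t \<partial>exponential \<beta>) = q * F 0 + R"
    using i1 i2 by (simp add: R_def q_def right_diff_distrib)
  have shift: "(\<integral>t. F (t + s) \<partial>exponential \<beta>) = p * (W - (q * F 0 + R))"
    using exponential_shift[OF \<beta> _ F K, of s] s by (simp add: p_def W_def split)
  have "\<bar>R\<bar> \<le> (\<integral>t. \<bar>indicator {..<s} t * (F t - F 0)\<bar> \<partial>exponential \<beta>)"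
    unfolding R_def by simp
  also have "\<dots> \<le> (\<integral>t. indicator {..<s} t * \<delta> \<partial>exponential \<beta>)"
  proof (rule integral_mono_AE)
    show "integrable (exponential \<beta>) (\<lambda>t. \<bar>indicator {..<s} t * (F t - F 0)\<bar>)"
      using i1 i2 by (simp add: right_diff_distrib)
    show "integrable (exponential \<beta>) (\<lambda>t. indicator {..<s} t * \<delta>)"
      using \<delta>0 by (intro Q.integrable_const_bound[where B=\<delta>]) (auto split: split_indicator)
    show "AE t in exponential \<beta>. \<bar>indicator {..<s} t * (F t - F 0)\<bar> \<le> indicator {..<s} t * \<delta>"
      using AE_exponential_nonneg[of \<beta>] by eventually_elim (auto simp: \<delta> split: split_indicator)
  qed
  finally have "\<bar>R\<bar> \<le> q * \<delta>" by (simp add: q_def)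
  then have "p * \<bar>R\<bar> \<le> (p - 1) * \<delta>"
    using mult_left_mono[of "\<bar>R\<bar>" "q * \<delta>" p] p0 pq by (simp flip: mult.assoc)
  then have pR: "\<bar>p * R / s\<bar> \<le> (p - 1) / s * \<delta>"
    using s p0 by (simp add: abs_mult divide_right_mono)
  have "p * (W - (q * F 0 + R)) - W = p * W - (p * q) * F 0 - p * R - W"
    by (simp add: algebra_simps)
  also have "\<dots> = (p - 1) * (W - F 0) - p * R"
    unfolding pq by (simp add: algebra_simps)
  finally have "p * (W - (q * F 0 + R)) - W = (p - 1) * (W - F 0) - p * R" .
  then have "((\<integral>t. F (t + s) \<partial>exponential \<beta>) - W) / s - \<beta> * (W - F 0) =
      ((p - 1) / s - \<beta>) * (W - F 0) - p * R / s"
    unfolding shift by (simp only: left_diff_distrib diff_divide_distrib times_divide_eq_left)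
  also have "\<bar>\<dots>\<bar> \<le> \<bar>(p - 1) / s - \<beta>\<bar> * \<bar>W - F 0\<bar> + (p - 1) / s * \<delta>"
    using pR abs_triangle_ineq4[of "((p - 1) / s - \<beta>) * (W - F 0)" "p * R / s"] by (simp add: abs_mult)
  finally show ?thesis by (simp add: p_def)
qed

context invariant_semigroup
begin

text \<open>A bounded \<open>f\<close> is its own test function, so no density argument is
  involved.\<close>

lemma norm2_le_by_testing:
  assumes f: "f \<in> Bb" and c: "0 \<le> c" and *: "\<And>\<phi>. \<phi> \<in> Bb \<Longrightarrow> \<bar>ip \<mu> f \<phi>\<bar> \<le> c * norm2 \<mu> \<phi>"
  shows "norm2 \<mu> f \<le> c"
proof (cases "norm2 \<mu> f = 0")
  case False
  then have "0 < norm2 \<mu> f" using norm2_nonneg[of \<mu> f] by simp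
  moreover have "norm2 \<mu> f * norm2 \<mu> f \<le> c * norm2 \<mu> f"
    using *[OF f] norm2_sq[of \<mu> f] by (simp add: power2_eq_square)
  ultimately show ?thesis by simp
qed (use c in simp)

text \<open>The scalar estimate bounds the pairing of the error \<open>D s\<close> with \<phi> by a
  multiple of the norm of \<phi>, with a factor independent of \<phi>. Testing with bounded
  functions turns this into a bound for the norm of \<open>D s\<close>, which tends to 0.\<close>

lemma generator_weak_resolvent:
  assumes \<beta>: "0 < \<beta>" and g: "g \<in> Bb" and w: "w \<in> Bb"
    and weak: "\<And>\<phi>. \<phi> \<in> Bb \<Longrightarrow> ip \<mu> w \<phi> = (\<integral>t. ip \<mu> (T (max 0 t) g) \<phi> \<partial>exponential \<beta>)"
  shows "has_generator_value \<mu> T w (\<lambda>x. \<beta> * (w x - g x))"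
  unfolding has_generator_value_def
proof (intro conjI)
  show "w \<in> L2 \<mu>" "(\<lambda>x. \<beta> * (w x - g x)) \<in> L2 \<mu>"
    by (intro Bb_in_L2 w L2_mult L2_diff g)+
  define c where "c = norm2 \<mu> (\<lambda>x. w x - g x)"
  have c0: "0 \<le> c" by (simp add: c_def norm2_nonneg)
  define D where "D s = (\<lambda>x. (T s w x - w x) / s - \<beta> * (w x - g x))" for s
  have gL: "g \<in> L2 \<mu>" by (rule Bb_in_L2[OF g])
  have DB: "D s \<in> Bb" if "0 < s" for s
    using that w g Bb_lincomb[OF Bb_diff[OF T_Bb w] Bb_diff[OF w g], of s w "1 / s" "- \<beta>"]
    by (simp add: D_def)
  \<comment> \<open>Only pairings of \<open>w\<close> are known, so \<open>T s\<close> passes to its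
    adjoint, then under the integral, and is there absorbed into \<open>T t g\<close> by the
    semigroup law.\<close>
  have Tshift: "ip \<mu> (T s w) \<phi> = (\<integral>t. ip \<mu> (T (max 0 (t + s)) g) \<phi> \<partial>exponential \<beta>)"
    if s: "0 \<le> s" and \<phi>: "\<phi> \<in> Bb" for s \<phi>
  proof -
    obtain \<rho> where \<rho>: "\<rho> \<in> Bb" "\<And>f. f \<in> Bb \<Longrightarrow> ip \<mu> (T s f) \<phi> = ip \<mu> f \<rho>"
      using adjoint[OF s \<phi>] by metis
    have m: "(\<lambda>t. ip \<mu> (T (max 0 t) g) \<phi>') \<in> borel_measurable borel" if "\<phi>' \<in> Bb" for \<phi>'
      by (intro borel_measurable_continuous_onI continuous_ip_T gL Bb_in_L2 that)
    have "ip \<mu> (T s w) \<phi> = (\<integral>t. ip \<mu> (T (max 0 t) g) \<rho> \<partial>exponential \<beta>)"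
      using \<rho> w weak by simp
    also have "\<dots> = (\<integral>t. ip \<mu> (T (max 0 (t + s)) g) \<phi> \<partial>exponential \<beta>)"
    proof (rule integral_cong_AE)
      show "(\<lambda>t. ip \<mu> (T (max 0 t) g) \<rho>) \<in> borel_measurable (exponential \<beta>)"
        using m[OF \<rho>(1)] by (simp cong: measurable_cong_sets)
      show "(\<lambda>t. ip \<mu> (T (max 0 (t + s)) g) \<phi>) \<in> borel_measurable (exponential \<beta>)"
        using measurable_compose[OF _ m[OF \<phi>], of "\<lambda>t. t + s" borel] by (simp cong: measurable_cong_sets)
      show "AE t in exponential \<beta>. ip \<mu> (T (max 0 t) g) \<rho> = ip \<mu> (T (max 0 (t + s)) g) \<phi>"
        using AE_exponential_nonneg[of \<beta>]
      proof eventually_elim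
        case (elim t)
        have "ip \<mu> (T t g) \<rho> = ip \<mu> (T s (T t g)) \<phi>"
          using \<rho>(2)[OF T_Bb[OF elim g]] by simp
        also have "\<dots> = ip \<mu> (T (t + s) g) \<phi>"
          using T_add[OF s elim gL] elim s gL Bb_in_L2[OF \<phi>]
          by (intro ip_cong_AE) (auto simp: add.commute intro!: T_L2 elim!: eventually_mono)
        finally show ?case using elim s by simp
      qed
    qed
    finally show ?thesis .
  qed
  have bound: "norm2 \<mu> (D s) \<le> \<bar>(exp (\<beta> * s) - 1) / s - \<beta>\<bar> * c + (exp (\<beta> * s) - 1) / s * \<delta>"
    if s: "0 < s" and \<delta>: "\<And>t. 0 < t \<Longrightarrow> t < s \<Longrightarrow> norm2 \<mu> (\<lambda>x. T t g x - g x) \<le> \<delta>" and \<delta>0: "0 \<le> \<delta>" for s \<delta>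
  proof (rule norm2_le_by_testing[OF DB[OF s]])
    have e: "0 \<le> (exp (\<beta> * s) - 1) / s" using \<beta> s by simp
    show "0 \<le> \<bar>(exp (\<beta> * s) - 1) / s - \<beta>\<bar> * c + (exp (\<beta> * s) - 1) / s * \<delta>"
      using e c0 \<delta>0 by (intro add_nonneg_nonneg mult_nonneg_nonneg) auto
    fix \<phi> :: "'a \<Rightarrow> real" assume \<phi>: "\<phi> \<in> Bb"
    note \<phi>L = Bb_in_L2[OF \<phi>] and wL = Bb_in_L2[OF w]
    have TwL: "T s w \<in> L2 \<mu>" using wL s by (intro T_L2) auto
    define F where "F t = ip \<mu> (T (max 0 t) g) \<phi>" for t
    have F0: "F 0 = ip \<mu> g \<phi>"
      unfolding F_def using T_zero[OF gL] gL \<phi>L by (auto intro!: ip_cong_AE T_L2)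
    have Fm: "F \<in> borel_measurable borel"
      unfolding F_def using gL \<phi>L by (intro borel_measurable_continuous_onI continuous_ip_T)
    have K: "\<bar>F t\<bar> \<le> norm2 \<mu> g * norm2 \<mu> \<phi>" for t
      unfolding F_def using gL \<phi>L
      by (intro order_trans[OF ip_Cauchy_Schwarz] mult_right_mono contraction norm2_nonneg T_L2) auto
    have \<delta>F: "\<bar>F t - F 0\<bar> \<le> \<delta> * norm2 \<mu> \<phi>" if t: "0 \<le> t" "t < s" for t
    proof (cases "t = 0")
      case False
      have "F t - F 0 = ip \<mu> (\<lambda>x. T t g x - g x) \<phi>"
        unfolding F0 using t gL \<phi>L by (simp add: F_def ip_diff_left T_L2)
      also have "\<bar>\<dots>\<bar> \<le> norm2 \<mu> (\<lambda>x. T t g x - g x) * norm2 \<mu> \<phi>"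
        using t gL \<phi>L by (intro ip_Cauchy_Schwarz L2_diff T_L2)
      also have "\<dots> \<le> \<delta> * norm2 \<mu> \<phi>"
        using False t \<delta> by (intro mult_right_mono norm2_nonneg) auto
      finally show ?thesis .
    qed (use \<delta>0 norm2_nonneg[of \<mu> \<phi>] in simp)
    have W: "(\<integral>t. F t \<partial>exponential \<beta>) = ip \<mu> w \<phi>"
      using weak[OF \<phi>] by (simp add: F_def)
    have S: "(\<integral>t. F (t + s) \<partial>exponential \<beta>) = ip \<mu> (T s w) \<phi>"
      using Tshift[OF _ \<phi>] s by (simp add: F_def)
    have WF: "ip \<mu> w \<phi> - F 0 = ip \<mu> (\<lambda>x. w x - g x) \<phi>"
      unfolding F0 using wL gL \<phi>L by (simp add: ip_diff_left)
    have "ip \<mu> (D s) \<phi> = (ip \<mu> (T s w) \<phi> - ip \<mu> w \<phi>) / s - \<beta> * (ip \<mu> w \<phi> - F 0)"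
      unfolding D_def WF using wL gL \<phi>L TwL
      by (simp add: ip_diff_left ip_divide_left ip_mult_left L2_diff L2_divide L2_mult)
    also have "\<bar>\<dots>\<bar> \<le> \<bar>(exp (\<beta> * s) - 1) / s - \<beta>\<bar> * \<bar>ip \<mu> w \<phi> - F 0\<bar> + (exp (\<beta> * s) - 1) / s * (\<delta> * norm2 \<mu> \<phi>)"
      using exponential_difference_quotient[OF \<beta> s Fm K \<delta>F] unfolding W S by blast
    also have "\<dots> \<le> \<bar>(exp (\<beta> * s) - 1) / s - \<beta>\<bar> * (c * norm2 \<mu> \<phi>) + (exp (\<beta> * s) - 1) / s * (\<delta> * norm2 \<mu> \<phi>)"
      unfolding WF c_def using wL gL \<phi>L by (intro add_right_mono mult_left_mono ip_Cauchy_Schwarz L2_diff) auto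
    finally show "\<bar>ip \<mu> (D s) \<phi>\<bar> \<le> (\<bar>(exp (\<beta> * s) - 1) / s - \<beta>\<bar> * c + (exp (\<beta> * s) - 1) / s * \<delta>) * norm2 \<mu> \<phi>"
      by (simp add: algebra_simps)
  qed
  have lim: "((\<lambda>s. (exp (\<beta> * s) - 1) / s) \<longlongrightarrow> \<beta>) (at_right 0)"
  proof -
    have "((\<lambda>s. exp (\<beta> * s)) has_field_derivative \<beta>) (at 0)"
      by (auto intro!: derivative_eq_intros)
    then show ?thesis
      by (auto simp: has_field_derivative_iff intro: filterlim_mono[OF _ order_refl at_le])
  qed
  show "((\<lambda>s. norm2 \<mu> (\<lambda>x. (T s w x - w x) / s - \<beta> * (w x - g x))) \<longlongrightarrow> 0) (at_right 0)"
    unfolding D_def[symmetric]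
  proof (rule tendstoI)
    fix e :: real assume e: "0 < e"
    \<comment> \<open>The final bound is \<open>\<eta> * c + (\<beta> + 1) * \<eta>\<close>, where
      \<open>\<eta> \<le> 1\<close> keeps the quotient of the exponential below
      \<open>\<beta> + 1\<close>. The denominator exceeds \<open>c + \<beta> + 1\<close> by 1 to
      make the last inequality strict.\<close>
    define \<eta> where "\<eta> = min 1 (e / (c + \<beta> + 2))"
    have pos: "0 < c + \<beta> + 2" using c0 \<beta> by simp
    have \<eta>: "0 < \<eta>" "\<eta> \<le> 1" using e pos by (auto simp: \<eta>_def)
    have \<eta>e: "\<eta> * (c + \<beta> + 1) < e"
    proof -
      have "\<eta> * (c + \<beta> + 1) < \<eta> * (c + \<beta> + 2)" using \<eta> by simp
      also have "\<dots> \<le> e / (c + \<beta> + 2) * (c + \<beta> + 2)" using pos by (intro mult_right_mono) (auto simp: \<eta>_def)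
      finally show ?thesis using pos by simp
    qed
    from tendstoD[OF T_cont[OF gL] \<eta>(1)] obtain d where d: "0 < d"
      "\<And>t. 0 < t \<Longrightarrow> t < d \<Longrightarrow> norm2 \<mu> (\<lambda>x. T t g x - g x) < \<eta>"
      unfolding eventually_at_right_field by (auto simp: norm2_nonneg)
    have ev: "\<forall>\<^sub>F s in at_right 0. 0 < s \<and> s < d"
      using d(1) unfolding eventually_at_right_field by auto
    show "\<forall>\<^sub>F s in at_right 0. dist (norm2 \<mu> (D s)) 0 < e"
      using tendstoD[OF lim \<eta>(1)] ev
    proof eventually_elim
      case (elim s)
      have "norm2 \<mu> (D s) \<le> \<bar>(exp (\<beta> * s) - 1) / s - \<beta>\<bar> * c + (exp (\<beta> * s) - 1) / s * \<eta>"
        using elim d \<eta> by (intro bound) (auto intro: less_imp_le)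
      also have "\<dots> \<le> \<eta> * c + (\<beta> + 1) * \<eta>"
        using elim(1) \<eta> c0 by (intro add_mono mult_right_mono) (auto simp: dist_real_def)
      also have "\<dots> < e" using \<eta>e by (simp add: algebra_simps)
      finally show ?case using norm2_nonneg[of \<mu> "D s"] by simp
    qed
  qed
qed

lemma exponential_tail:
  assumes "0 < d" "0 < (e::real)"
  obtains \<beta> where "0 < \<beta>" "exp (- (\<beta> * d)) \<le> e"
proof
  define \<beta> where "\<beta> = max 1 (- ln e / d)"
  show "0 < \<beta>" by (simp add: \<beta>_def)
  have "- ln e / d * d \<le> \<beta> * d" using assms by (intro mult_right_mono) (auto simp: \<beta>_def)
  then have "- (\<beta> * d) \<le> ln e" using assms by simp
  then show "exp (- (\<beta> * d)) \<le> e" using assms by (metis exp_le_cancel_iff exp_ln)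
qed

text \<open>For large \<beta> the exponential time concentrates at 0, so the average of
  \<open>T t g\<close> is close to \<open>g\<close> by strong continuity. The average lies in the
  generator domain.\<close>

lemma weak_resolvent_approx:
  assumes g: "g \<in> Bb" "\<And>x. 0 \<le> g x" "\<And>x. g x \<le> 1" and e: "0 < e"
  obtains w where "w \<in> gen_dom \<mu> T" "norm2 \<mu> (\<lambda>x. w x - g x) \<le> e"
proof -
  note gL = Bb_in_L2[OF g(1)]
  from tendstoD[OF T_cont[OF gL], of "e / 2"] e obtain d where d: "0 < d"
    "\<And>t. 0 < t \<Longrightarrow> t < d \<Longrightarrow> norm2 \<mu> (\<lambda>x. T t g x - g x) < e / 2"
    unfolding eventually_at_right_field by (auto simp: norm2_nonneg)
  have g1: "norm2 \<mu> g \<le> 1"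
    using g Bb_measurable[OF g(1)] by (intro norm2_le_const) (auto simp: prob_space_axioms abs_le_iff)
  \<comment> \<open>Times below \<open>d\<close> contribute \<open>e / 2\<close> through continuity.
    Later times contribute at most \<open>2 * N\<close> times their probability, so a tail of
    \<open>e / 4\<close> yields the other half.\<close>
  obtain \<beta> where \<beta>: "0 < \<beta>" "exp (- (\<beta> * d)) \<le> e / 4"
    using exponential_tail[of d "e / 4"] d e by auto
  interpret Q: prob_space "exponential \<beta>" by (rule prob_space_exponential[OF \<beta>(1)])
  obtain w where w: "w \<in> Bb" "\<And>\<phi>. \<phi> \<in> Bb \<Longrightarrow> ip \<mu> w \<phi> = (\<integral>t. ip \<mu> (T (max 0 t) g) \<phi> \<partial>exponential \<beta>)"
    using exists_weak_resolvent[OF \<beta>(1) g] by metis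
  have q: "(\<integral>t. 1 - indicator {..<d} t \<partial>exponential \<beta>) = exp (- (\<beta> * d))"
  proof -
    have "(\<integral>t. 1 - indicator {..<d} t \<partial>exponential \<beta>) = 1 - (\<integral>t. indicat_real {..<d} t \<partial>exponential \<beta>)"
      using Q.prob_space Q.integrable_const_bound[of "indicat_real {..<d}" 1]
      by (subst Bochner_Integration.integral_diff) auto
    moreover have "(\<integral>t. indicat_real {..<d} t \<partial>exponential \<beta>) = 1 - exp (- (\<beta> * d))"
      using exponential_lessThan[OF \<beta>(1), of d] d by (simp add: exp_minus field_simps)
    ultimately show ?thesis by simp
  qed
  have "norm2 \<mu> (\<lambda>x. w x - g x) \<le> e"
  proof (rule norm2_le_by_testing[OF Bb_diff[OF w(1) g(1)]])
    fix \<phi> :: "'a \<Rightarrow> real" assume \<phi>: "\<phi> \<in> Bb"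
    note \<phi>L = Bb_in_L2[OF \<phi>]
    define N where "N = norm2 \<mu> \<phi>"
    have N0: "0 \<le> N" by (simp add: N_def norm2_nonneg)
    define F where "F t = ip \<mu> (T (max 0 t) g) \<phi>" for t
    have Fm[measurable]: "F \<in> borel_measurable borel"
      unfolding F_def using gL \<phi>L by (intro borel_measurable_continuous_onI continuous_ip_T)
    have K: "\<bar>F t\<bar> \<le> N" for t
    proof -
      have "\<bar>F t\<bar> \<le> norm2 \<mu> g * norm2 \<mu> \<phi>"
        unfolding F_def using gL \<phi>L
        by (intro order_trans[OF ip_Cauchy_Schwarz] mult_right_mono contraction norm2_nonneg T_L2) auto
      then show ?thesis using mult_right_mono[OF g1 N0] by (simp add: N_def)
    qed
    have iF: "integrable (exponential \<beta>) F"
      using K by (intro Q.integrable_const_bound[where B=N]) auto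
    have gN: "\<bar>ip \<mu> g \<phi>\<bar> \<le> N"
      using ip_Cauchy_Schwarz[OF gL \<phi>L] mult_right_mono[OF g1 N0] by (simp add: N_def)
    have Fg: "F t - ip \<mu> g \<phi> = ip \<mu> (\<lambda>x. T (max 0 t) g x - g x) \<phi>" for t
      unfolding F_def using gL \<phi>L by (subst ip_diff_left) (auto intro!: T_L2)
    have pw: "\<bar>F t - ip \<mu> g \<phi>\<bar> \<le> e / 2 * N + 2 * N * (1 - indicator {..<d} t)" if t: "0 < t" for t
    proof (cases "t < d")
      case True
      have "\<bar>F t - ip \<mu> g \<phi>\<bar> \<le> norm2 \<mu> (\<lambda>x. T t g x - g x) * norm2 \<mu> \<phi>"
        unfolding Fg using t gL \<phi>L by (auto intro!: ip_Cauchy_Schwarz L2_diff T_L2)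
      also have "\<dots> \<le> e / 2 * N"
        unfolding N_def using t True d(2)[of t] by (intro mult_right_mono norm2_nonneg) auto
      finally show ?thesis using True by simp
    next
      case False
      have "\<bar>F t - ip \<mu> g \<phi>\<bar> \<le> 2 * N" using K[of t] gN by linarith
      then show ?thesis using False e N0 by (simp add: add_increasing)
    qed
    \<comment> \<open>The estimate \<open>pw\<close> is stated for \<open>0 < t\<close>, as strong
      continuity concerns right neighbourhoods of 0; the point 0 itself has measure 0.\<close>
    have AEpos: "AE t in exponential \<beta>. 0 < t"
    proof -
      have "AE t in lborel. 0 < ennreal (exponential_density \<beta> t) \<longrightarrow> 0 < t"
        using AE_lborel_singleton[of "0::real"]
        by eventually_elim (auto simp: exponential_density_def)
      then show ?thesis
        unfolding exponential_def by (subst AE_density) auto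
    qed
    have i1: "integrable (exponential \<beta>) (\<lambda>t. 2 * N * (1 - indicat_real {..<d} t))"
      by (intro integrable_mult_right Q.integrable_const_bound[where B=1]) (auto split: split_indicator)
    then have iH: "integrable (exponential \<beta>) (\<lambda>t. e / 2 * N + 2 * N * (1 - indicat_real {..<d} t))"
      by (intro Bochner_Integration.integrable_add) auto
    have "ip \<mu> (\<lambda>x. w x - g x) \<phi> = (\<integral>t. F t - ip \<mu> g \<phi> \<partial>exponential \<beta>)"
    proof -
      have "ip \<mu> (\<lambda>x. w x - g x) \<phi> = ip \<mu> w \<phi> - ip \<mu> g \<phi>"
        by (rule ip_diff_left[OF Bb_in_L2[OF w(1)] gL \<phi>L])
      also have "ip \<mu> w \<phi> = (\<integral>t. F t \<partial>exponential \<beta>)"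
        unfolding F_def by (rule w(2)[OF \<phi>])
      finally show ?thesis using iF Q.prob_space by simp
    qed
    also have "\<bar>\<dots>\<bar> \<le> (\<integral>t. \<bar>F t - ip \<mu> g \<phi>\<bar> \<partial>exponential \<beta>)" by simp
    also have "\<dots> \<le> (\<integral>t. e / 2 * N + 2 * N * (1 - indicator {..<d} t) \<partial>exponential \<beta>)"
    proof (rule integral_mono_AE[OF _ iH])
      show "AE t in exponential \<beta>. \<bar>F t - ip \<mu> g \<phi>\<bar> \<le> e / 2 * N + 2 * N * (1 - indicator {..<d} t)"
        using AEpos by eventually_elim (rule pw)
    qed (use iF in simp)
    also have "\<dots> = e / 2 * N + 2 * N * exp (- (\<beta> * d))"
      using Q.prob_space q i1 by simp
    also have "\<dots> \<le> e / 2 * N + 2 * N * (e / 4)"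
      using \<beta>(2) N0 by (intro add_left_mono mult_left_mono) auto
    finally show "\<bar>ip \<mu> (\<lambda>x. w x - g x) \<phi>\<bar> \<le> e * norm2 \<mu> \<phi>" by (simp add: N_def field_simps)
  qed (use e in simp)
  moreover have "w \<in> gen_dom \<mu> T"
    using generator_weak_resolvent[OF \<beta>(1) g(1) w] by (auto simp: gen_dom_def)
  ultimately show ?thesis using that by blast
qed

end

section \<open>Generators, dissipativity and the resolvent equation\<close>

context invariant_semigroup
begin

lemma difference_quotient_L2: "u \<in> L2 \<mu> \<Longrightarrow> 0 < t \<Longrightarrow> (\<lambda>x. (T t u x - u x) / t) \<in> L2 \<mu>"
  by (intro L2_divide L2_diff T_L2) auto

lemma has_generator_value_lincomb:
  assumes "has_generator_value \<mu> T u1 w1" "has_generator_value \<mu> T u2 w2"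
  shows "has_generator_value \<mu> T (\<lambda>x. a * u1 x + b * u2 x) (\<lambda>x. a * w1 x + b * w2 x)"
proof -
  let ?u = "\<lambda>x. a * u1 x + b * u2 x" and ?w = "\<lambda>x. a * w1 x + b * w2 x"
  define D1 where "D1 t = (\<lambda>x. (T t u1 x - u1 x) / t - w1 x)" for t
  define D2 where "D2 t = (\<lambda>x. (T t u2 x - u2 x) / t - w2 x)" for t
  from assms have L: "u1 \<in> L2 \<mu>" "w1 \<in> L2 \<mu>" "u2 \<in> L2 \<mu>" "w2 \<in> L2 \<mu>"
    and lim: "((\<lambda>t. norm2 \<mu> (D1 t)) \<longlongrightarrow> 0) (at_right 0)" "((\<lambda>t. norm2 \<mu> (D2 t)) \<longlongrightarrow> 0) (at_right 0)"
    by (auto simp: has_generator_value_def D1_def D2_def)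
  have le: "norm2 \<mu> (\<lambda>x. (T t ?u x - ?u x) / t - ?w x) \<le> \<bar>a\<bar> * norm2 \<mu> (D1 t) + \<bar>b\<bar> * norm2 \<mu> (D2 t)"
    if t: "0 < t" for t
  proof -
    have D: "D1 t \<in> L2 \<mu>" "D2 t \<in> L2 \<mu>"
      unfolding D1_def D2_def using L t by (intro L2_diff difference_quotient_L2; simp)+
    have "AE x in \<mu>. (T t ?u x - ?u x) / t - ?w x = a * D1 t x + b * D2 t x"
      using T_lincomb[OF less_imp_le[OF t] L(1,3), of a b]
      by eventually_elim (use t in \<open>simp add: D1_def D2_def field_simps\<close>)
    then have "norm2 \<mu> (\<lambda>x. (T t ?u x - ?u x) / t - ?w x) = norm2 \<mu> (\<lambda>x. a * D1 t x + b * D2 t x)"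
      using L D t by (intro norm2_cong_AE L2_diff difference_quotient_L2 L2_lincomb)
    also have "\<dots> \<le> norm2 \<mu> (\<lambda>x. a * D1 t x) + norm2 \<mu> (\<lambda>x. b * D2 t x)"
      using D by (intro norm2_triangle L2_mult)
    finally show ?thesis by (simp add: norm2_mult)
  qed
  have "((\<lambda>t. norm2 \<mu> (\<lambda>x. (T t ?u x - ?u x) / t - ?w x)) \<longlongrightarrow> 0) (at_right 0)"
  proof (rule tendsto_sandwich[OF _ _ tendsto_const])
    show "\<forall>\<^sub>F t in at_right 0. 0 \<le> norm2 \<mu> (\<lambda>x. (T t ?u x - ?u x) / t - ?w x)"
      by (simp add: norm2_nonneg)
    show "\<forall>\<^sub>F t in at_right 0. norm2 \<mu> (\<lambda>x. (T t ?u x - ?u x) / t - ?w x) \<le> \<bar>a\<bar> * norm2 \<mu> (D1 t) + \<bar>b\<bar> * norm2 \<mu> (D2 t)"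
      using eventually_at_right_less by eventually_elim (rule le)
    show "((\<lambda>t. \<bar>a\<bar> * norm2 \<mu> (D1 t) + \<bar>b\<bar> * norm2 \<mu> (D2 t)) \<longlongrightarrow> 0) (at_right 0)"
      using tendsto_add[OF tendsto_mult_right_zero[OF lim(1)] tendsto_mult_right_zero[OF lim(2)]] by simp
  qed
  then show ?thesis using L by (simp add: has_generator_value_def L2_lincomb)
qed

lemma has_generator_value_const: "has_generator_value \<mu> T (\<lambda>x. c) (\<lambda>x. 0)"
proof -
  have "((\<lambda>t. norm2 \<mu> (\<lambda>x. (T t (\<lambda>x. c) x - c) / t - 0)) \<longlongrightarrow> 0) (at_right 0)"
  proof (rule tendsto_eventually)
    show "\<forall>\<^sub>F t in at_right 0. norm2 \<mu> (\<lambda>x. (T t (\<lambda>x. c) x - c) / t - 0) = 0"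
      using eventually_at_right_less by eventually_elim (simp add: T_const norm2_def ip_def)
  qed
  then show ?thesis by (simp add: has_generator_value_def Bb_in_L2 Bb_const)
qed

text \<open>By linearity \<open>w - w'\<close> is a generator value of the zero function, whose
  difference quotients vanish.\<close>

lemma has_generator_value_unique:
  assumes "has_generator_value \<mu> T u w" "has_generator_value \<mu> T u w'"
  shows "AE x in \<mu>. w x = w' x"
proof -
  have "has_generator_value \<mu> T (\<lambda>x. 0) (\<lambda>x. w x - w' x)"
    using has_generator_value_lincomb[OF assms, of 1 "-1"] by simp
  then have L: "(\<lambda>x. w x - w' x) \<in> L2 \<mu>"
    and lim: "((\<lambda>t. norm2 \<mu> (\<lambda>x. (T t (\<lambda>x. 0) x - 0) / t - (w x - w' x))) \<longlongrightarrow> 0) (at_right 0)"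
    by (auto simp: has_generator_value_def)
  have "((\<lambda>t::real. norm2 \<mu> (\<lambda>x. w x - w' x)) \<longlongrightarrow> 0) (at_right 0)"
  proof (rule Lim_transform_eventually[OF lim])
    show "\<forall>\<^sub>F t in at_right 0. norm2 \<mu> (\<lambda>x. (T t (\<lambda>x. 0) x - 0) / t - (w x - w' x)) = norm2 \<mu> (\<lambda>x. w x - w' x)"
      using eventually_at_right_less
    proof eventually_elim
      case (elim t)
      then show ?case
        using norm2_mult[of \<mu> "-1" "\<lambda>x. w x - w' x"] by (simp add: T_const)
    qed
  qed
  then have "norm2 \<mu> (\<lambda>x. w x - w' x) = 0"
    by (simp add: tendsto_const_iff)
  from norm2_eq_0_AE[OF L this] show ?thesis by simp
qed

lemma has_generator_value_generator:
  assumes "u \<in> gen_dom \<mu> T"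
  shows "has_generator_value \<mu> T u (generator \<mu> T u)"
  using assms unfolding gen_dom_def generator_def by (auto intro: someI[of "has_generator_value \<mu> T u"])

lemma difference_quotient_ip_tendsto:
  assumes "has_generator_value \<mu> T u w" "v \<in> L2 \<mu>"
  shows "((\<lambda>t. ip \<mu> (\<lambda>x. (T t u x - u x) / t) v) \<longlongrightarrow> ip \<mu> w v) (at_right 0)"
proof (rule tendsto_ip_left)
  show "\<forall>\<^sub>F t in at_right 0. (\<lambda>x. (T t u x - u x) / t) \<in> L2 \<mu>"
    using eventually_at_right_less
    by eventually_elim (use assms in \<open>auto simp: has_generator_value_def intro: difference_quotient_L2\<close>)
qed (use assms in \<open>auto simp: has_generator_value_def\<close>)

lemma dissipative:
  assumes "has_generator_value \<mu> T u w"
  shows "ip \<mu> w u \<le> 0"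
proof -
  have u: "u \<in> L2 \<mu>" using assms by (simp add: has_generator_value_def)
  show ?thesis
  proof (rule tendsto_upperbound[OF difference_quotient_ip_tendsto[OF assms u]])
    show "\<forall>\<^sub>F t in at_right 0. ip \<mu> (\<lambda>x. (T t u x - u x) / t) u \<le> 0"
      using eventually_at_right_less
    proof eventually_elim
      case (elim t)
      have "ip \<mu> (T t u) u \<le> norm2 \<mu> (T t u) * norm2 \<mu> u"
        using ip_Cauchy_Schwarz[OF T_L2 u, of t u] u elim by simp
      also have "\<dots> \<le> norm2 \<mu> u * norm2 \<mu> u"
        using contraction[OF _ u, of t] elim by (intro mult_right_mono norm2_nonneg) auto
      also have "\<dots> = ip \<mu> u u" using norm2_sq[of \<mu> u] by (simp add: power2_eq_square)
      finally show ?case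
        using elim u by (simp add: ip_divide_left ip_diff_left T_L2 divide_le_0_iff)
    qed
  qed simp
qed

lemma exists_resolvent:
  assumes \<beta>: "0 < \<beta>" and g: "g \<in> Bb"
  obtains v w where "has_generator_value \<mu> T v w" "\<And>x. \<beta> * v x - w x = g x"
proof -
  obtain a b h where h: "h \<in> Bb" "\<And>x. 0 \<le> h x" "\<And>x. h x \<le> 1" "g = (\<lambda>x. a * h x + b * 1)"
    using affine_to_unit_interval[OF g] by metis
  obtain w where w: "w \<in> Bb" "\<And>\<phi>. \<phi> \<in> Bb \<Longrightarrow> ip \<mu> w \<phi> = (\<integral>t. ip \<mu> (T (max 0 t) h) \<phi> \<partial>exponential \<beta>)"
    using exists_weak_resolvent[OF \<beta> h(1-3)] by metis
  \<comment> \<open>\<open>w\<close> is \<beta> times the resolvent of \<open>h\<close>, whence the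
    factor \<open>a / \<beta>\<close>; the constant \<open>b\<close> has resolvent
    \<open>b / \<beta>\<close> and generator value 0.\<close>
  have "has_generator_value \<mu> T (\<lambda>x. (a / \<beta>) * w x + (b / \<beta>) * 1) (\<lambda>x. (a / \<beta>) * (\<beta> * (w x - h x)) + (b / \<beta>) * 0)"
    by (intro has_generator_value_lincomb generator_weak_resolvent \<beta> h(1) w has_generator_value_const)
  then show ?thesis
    by (rule that) (use \<beta> in \<open>simp add: h(4) field_simps\<close>)
qed

text \<open>Existence of a solution is what makes the choice in \<open>resolvent\<close> satisfy its
  equation; \<open>generator\<close> is itself a choice, which uniqueness almost everywhere
  reconciles with the value \<open>w\<close> of the constructed solution.\<close>

lemma resolvent_equation:
  assumes \<beta>: "0 < \<beta>" and g: "g \<in> Bb"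
  defines "r \<equiv> resolvent \<mu> T \<beta> g"
  shows "r \<in> gen_dom \<mu> T" "AE x in \<mu>. \<beta> * r x - generator \<mu> T r x = g x"
proof -
  obtain v w where v: "has_generator_value \<mu> T v w" "\<And>x. \<beta> * v x - w x = g x"
    using exists_resolvent[OF \<beta> g] by metis
  have vD: "v \<in> gen_dom \<mu> T" using v by (auto simp: gen_dom_def)
  have "AE x in \<mu>. \<beta> * v x - generator \<mu> T v x = g x"
    using has_generator_value_unique[OF has_generator_value_generator[OF vD] v(1)]
    by eventually_elim (use v(2) in simp)
  with vD have ex: "\<exists>v. v \<in> gen_dom \<mu> T \<and> (AE x in \<mu>. \<beta> * v x - generator \<mu> T v x = g x)" by blast
  from someI_ex[OF ex] show "r \<in> gen_dom \<mu> T" "AE x in \<mu>. \<beta> * r x - generator \<mu> T r x = g x"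
    unfolding r_def resolvent_def by blast+
qed

text \<open>
  The resolvent maps constants to constants, so \<open>A r = \<beta> r - g\<close> does not change when a constant is
  subtracted from \<open>g\<close>; the bound then follows from dissipativity of \<open>A\<close>.
\<close>

lemma resolvent_deviation:
  assumes \<beta>: "0 < \<beta>" and g: "g \<in> Bb"
  defines "r \<equiv> resolvent \<mu> T \<beta> g"
  shows "ip \<mu> (\<lambda>x. \<beta> * r x - g x) (\<lambda>x. \<beta> * r x - g x) \<le> ip \<mu> (\<lambda>x. g x - c) (\<lambda>x. g x - c)"
proof -
  define A where "A = generator \<mu> T r"
  have rA: "has_generator_value \<mu> T r A" and eq: "AE x in \<mu>. \<beta> * r x - A x = g x"
    unfolding A_def r_def using resolvent_equation[OF \<beta> g] has_generator_value_generator by auto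
  \<comment> \<open>\<open>u\<close> solves the resolvent equation for \<open>g - c\<close>, with
    the same generator value \<open>A\<close> as \<open>r\<close>.\<close>
  define u where "u x = 1 * r x + - (c / \<beta>) * 1" for x
  have uA: "has_generator_value \<mu> T u A"
    using has_generator_value_lincomb[OF rA has_generator_value_const[of 1], of 1 "- (c / \<beta>)"]
    by (simp add: u_def[abs_def])
  have L: "r \<in> L2 \<mu>" "A \<in> L2 \<mu>" "u \<in> L2 \<mu>" "g \<in> L2 \<mu>" "(\<lambda>x. c) \<in> L2 \<mu>"
    using rA uA g by (auto simp: has_generator_value_def intro: Bb_in_L2 Bb_const)
  have "AE x in \<mu>. \<beta> * r x - g x = A x" using eq by eventually_elim simp
  then have "ip \<mu> (\<lambda>x. \<beta> * r x - g x) (\<lambda>x. \<beta> * r x - g x) = ip \<mu> A A"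
    using L by (intro ip_cong_AE L2_diff L2_mult)
  \<comment> \<open>Dissipativity gives the cross term the right sign: the squared norm of
    \<open>\<beta> u - A\<close> is at least that of \<open>A\<close>.\<close>
  also have "\<dots> \<le> ip \<mu> (\<lambda>x. \<beta> * u x) (\<lambda>x. \<beta> * u x) - 2 * ip \<mu> (\<lambda>x. \<beta> * u x) A + ip \<mu> A A"
    using mult_nonneg_nonpos[OF less_imp_le[OF \<beta>] dissipative[OF uA]] ip_self_nonneg[of \<mu> "\<lambda>x. \<beta> * u x"]
    by (simp add: ip_mult_left ip_commute[of \<mu> u A])
  also have "\<dots> = ip \<mu> (\<lambda>x. \<beta> * u x - A x) (\<lambda>x. \<beta> * u x - A x)"
    using L by (intro ip_diff_self[symmetric] L2_mult)
  also have "\<dots> = ip \<mu> (\<lambda>x. g x - c) (\<lambda>x. g x - c)"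
  proof -
    have "AE x in \<mu>. \<beta> * u x - A x = g x - c"
      using eq by eventually_elim (use \<beta> in \<open>simp add: u_def field_simps\<close>)
    then show ?thesis using L by (intro ip_cong_AE L2_diff L2_mult)
  qed
  finally show ?thesis .
qed

end

lemma resolvent_converges:
  fixes \<nu>s :: "nat \<Rightarrow> 'a::metric_space measure"
  assumes sg: "\<And>n. invariant_semigroup (\<nu>s n) (Pn n)"
    and w: "weakly_converges \<nu>s (return borel z)" and \<beta>: "0 < \<beta>" and g: "g \<in> Cb"
  shows "(\<lambda>n. ip (\<nu>s n)
      (\<lambda>x. \<beta> * resolvent (\<nu>s n) (trans_op (Pn n)) \<beta> g x - g x)
      (\<lambda>x. \<beta> * resolvent (\<nu>s n) (trans_op (Pn n)) \<beta> g x - g x)) \<longlonglongrightarrow> 0"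
proof -
  \<comment> \<open>The constant subtracted from \<open>g\<close> is its value at the limit point,
    so the bound is the integral of a function in \<open>Cb\<close> that vanishes there.\<close>
  define h where "h x = (g x - g z) * (g x - g z)" for x
  obtain K where K: "\<And>x. \<bar>g x\<bar> \<le> K" using Bb_boundedE[of g] g Cb_subset_Bb by blast
  have hb: "\<bar>h x\<bar> \<le> (2 * K) * (2 * K)" for x
    unfolding h_def abs_mult using K[of x] K[of z] by (intro mult_mono) auto
  have h: "h \<in> Cb"
    using g hb by (auto simp: Cb_def h_def[abs_def] bounded_iff intro!: continuous_intros)
  have "(\<lambda>n. \<integral>x. h x \<partial>\<nu>s n) \<longlonglongrightarrow> (\<integral>x. h x \<partial>return borel z)"
    using w h by (simp add: weakly_converges_def)
  moreover have "(\<integral>x. h x \<partial>return borel z) = 0"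
    using h Cb_subset_Bb Bb_measurable by (subst integral_return) (auto simp: h_def)
  ultimately have lim: "(\<lambda>n. \<integral>x. h x \<partial>\<nu>s n) \<longlonglongrightarrow> 0" by simp
  show ?thesis
  proof (rule tendsto_sandwich[OF _ _ tendsto_const lim])
    show "\<forall>\<^sub>F n in sequentially. 0 \<le> ip (\<nu>s n)
      (\<lambda>x. \<beta> * resolvent (\<nu>s n) (trans_op (Pn n)) \<beta> g x - g x)
      (\<lambda>x. \<beta> * resolvent (\<nu>s n) (trans_op (Pn n)) \<beta> g x - g x)"
      by (simp add: ip_self_nonneg)
    have "ip (\<nu>s n)
      (\<lambda>x. \<beta> * resolvent (\<nu>s n) (trans_op (Pn n)) \<beta> g x - g x)
      (\<lambda>x. \<beta> * resolvent (\<nu>s n) (trans_op (Pn n)) \<beta> g x - g x) \<le> (\<integral>x. h x \<partial>\<nu>s n)" for n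
      using invariant_semigroup.resolvent_deviation[OF sg \<beta>, of g n "g z"] g Cb_subset_Bb
      by (auto simp: ip_def h_def)
    then show "\<forall>\<^sub>F n in sequentially. ip (\<nu>s n)
      (\<lambda>x. \<beta> * resolvent (\<nu>s n) (trans_op (Pn n)) \<beta> g x - g x)
      (\<lambda>x. \<beta> * resolvent (\<nu>s n) (trans_op (Pn n)) \<beta> g x - g x) \<le> (\<integral>x. h x \<partial>\<nu>s n)"
      by simp
  qed
qed

section \<open>Sequential compactness of the probability measures on a compact metric space\<close>

text \<open>The sets enumerate, over all k, the balls of a finite cover with radius
  \<open>1 / (real k + 1)\<close>. Agreement on the balls of one level puts both points into a
  common ball, and the largest index at that level serves as \<open>K\<close>. The sequence is used
  for coding points and later for separating them by countably many events.\<close>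

lemma compact_metric_separating_sequence:
  assumes "compact (UNIV :: 'a::metric_space set)"
  obtains U :: "nat \<Rightarrow> 'a::metric_space set"
  where "\<And>j. open (U j)" "\<And>e. 0 < e \<Longrightarrow> \<exists>K. \<forall>x y. (\<forall>j\<le>K. x \<in> U j \<longleftrightarrow> y \<in> U j) \<longrightarrow> dist x y < e"
proof -
  have "\<exists>F. finite F \<and> UNIV \<subseteq> (\<Union>x\<in>F. ball (x::'a) (1 / (real k + 1)))" for k
  proof -
    have "(UNIV::'a set) \<subseteq> (\<Union>x\<in>UNIV. ball x (1 / (real k + 1)))"
      by (auto intro!: exI[where P="\<lambda>y. dist y _ < _"])
    from compactE_image[OF assms _ this] show ?thesis by (metis open_ball)
  qed
  then obtain F where F: "\<And>k. finite (F k)" "\<And>k. UNIV \<subseteq> (\<Union>x\<in>F k. ball (x::'a) (1 / (real k + 1)))"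
    by metis
  define \<U> where "\<U> = (\<Union>k. (\<lambda>x. ball x (1 / (real k + 1))) ` F k)"
  have cnt: "countable \<U>" unfolding \<U>_def using F(1) by (auto intro: countable_finite)
  have ne: "\<U> \<noteq> {}"
  proof -
    obtain c where "c \<in> F 0" using F(2)[of 0] by auto
    then show ?thesis unfolding \<U>_def by auto
  qed
  define U where "U = from_nat_into \<U>"
  have rng: "range U = \<U>" unfolding U_def using range_from_nat_into[OF ne cnt] .
  show ?thesis
  proof (rule that[of U])
    show "open (U j)" for j
      using rangeI[of U j] unfolding rng by (auto simp: \<U>_def)
    fix e :: real assume e: "0 < e"
    obtain k where k: "2 / (real k + 1) < e"
    proof -
      obtain k where "2 / e < real k" using reals_Archimedean2 by blast
      then have "2 / (real k + 1) < e" using e by (simp add: field_simps)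
      then show ?thesis by (rule that)
    qed
    have "\<forall>x\<in>F k. \<exists>j. U j = ball x (1 / (real k + 1))"
    proof
      fix x assume "x \<in> F k"
      then have "ball x (1 / (real k + 1)) \<in> range U" unfolding rng \<U>_def by blast
      then show "\<exists>j. U j = ball x (1 / (real k + 1))" by (metis rangeE)
    qed
    then obtain J where J: "\<And>x. x \<in> F k \<Longrightarrow> U (J x) = ball x (1 / (real k + 1))" by metis
    show "\<exists>K. \<forall>x y. (\<forall>j\<le>K. x \<in> U j \<longleftrightarrow> y \<in> U j) \<longrightarrow> dist x y < e"
    proof (intro exI[of _ "Max (J ` F k)"] allI impI)
      fix x y assume *: "\<forall>j\<le>Max (J ` F k). x \<in> U j \<longleftrightarrow> y \<in> U j"
      obtain c where c: "c \<in> F k" "x \<in> ball c (1 / (real k + 1))" using F(2)[of k] by blast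
      have "J c \<le> Max (J ` F k)" using c F(1) by (intro Max_ge) auto
      then have "y \<in> ball c (1 / (real k + 1))" using * c J by metis
      then have "dist x y < 1 / (real k + 1) + 1 / (real k + 1)"
        using c(2) dist_triangle3[of x y c] by (simp add: dist_commute)
      then show "dist x y < e" using k by simp
    qed
  qed
qed

text \<open>Since only the ternary digits \<open>0\<close> and \<open>2\<close> occur, close codes share their first digits.\<close>

definition cantor_code :: "(nat \<Rightarrow> 'a set) \<Rightarrow> 'a \<Rightarrow> real" where
  "cantor_code U x = (\<Sum>j. 2 * indicator (U j) x * (1 / 3) ^ Suc j)"

lemma summable_third: "summable (\<lambda>k. 2 * (1 / 3 :: real) ^ Suc (k + n))"
proof -
  have "summable (\<lambda>k. 2 * (1 / 3) ^ Suc n * (1 / 3 :: real) ^ k)"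
    by (intro summable_mult summable_geometric) auto
  then show ?thesis by (simp add: power_add mult.commute mult.left_commute)
qed

lemma cantor_code_summable: "summable (\<lambda>j. 2 * indicator (U j) x * (1 / 3 :: real) ^ Suc j)"
  by (rule summable_comparison_test'[OF summable_third[of 0]]) (auto split: split_indicator)

lemma geometric_third: "(\<Sum>j. 2 * (1 / 3 :: real) ^ Suc (j + i)) = (1 / 3) ^ i"
proof -
  have "(\<Sum>j. 2 * (1 / 3 :: real) ^ Suc (j + i)) = (\<Sum>j. (2 * (1 / 3) ^ Suc i) * (1 / 3 :: real) ^ j)"
    by (simp add: power_add mult.commute mult.left_commute)
  also have "\<dots> = (2 * (1 / 3) ^ Suc i) * (\<Sum>j. (1 / 3 :: real) ^ j)"
    by (intro suminf_mult summable_geometric) simp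
  finally show ?thesis by (simp add: suminf_geometric)
qed

lemma cantor_code_range: "0 \<le> cantor_code U x" "cantor_code U x \<le> 1"
proof -
  show "0 \<le> cantor_code U x"
    unfolding cantor_code_def by (intro suminf_nonneg cantor_code_summable) auto
  have "cantor_code U x \<le> (\<Sum>j. 2 * (1 / 3 :: real) ^ Suc (j + 0))"
    unfolding cantor_code_def
    by (intro suminf_le cantor_code_summable summable_third) (auto split: split_indicator)
  then show "cantor_code U x \<le> 1" unfolding geometric_third by simp
qed

lemma cantor_code_measurable:
  assumes "\<And>j. open (U j)"
  shows "cantor_code U \<in> borel_measurable borel"
proof -
  have [measurable]: "U j \<in> sets borel" for j using assms by auto
  show ?thesis unfolding cantor_code_def[abs_def] by measurable
qed

text \<open>At the first differing index i this digit contributes \<open>2 * (1 / 3) ^ Suc i\<close>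
  and all later digits together at most \<open>(1 / 3) ^ Suc i\<close>, so the codes differ by at
  least the latter amount.\<close>

lemma cantor_code_digits:
  assumes close: "\<bar>cantor_code U x - cantor_code U y\<bar> < (1 / 3) ^ Suc K" and j: "j \<le> K"
  shows "x \<in> U j \<longleftrightarrow> y \<in> U j"
proof (rule ccontr)
  assume neq: "\<not> ?thesis"
  define differ where "differ k \<longleftrightarrow> \<not> (x \<in> U k \<longleftrightarrow> y \<in> U k)" for k
  define i where "i = (LEAST k. differ k)"
  have "differ j" using neq by (simp add: differ_def)
  then have "differ i" "i \<le> j" unfolding i_def by (rule LeastI, rule Least_le)
  then have i: "\<not> (x \<in> U i \<longleftrightarrow> y \<in> U i)" and iK: "i \<le> K" using j by (auto simp: differ_def)
  have less: "x \<in> U k \<longleftrightarrow> y \<in> U k" if "k < i" for k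
    using not_less_Least[of k differ] that unfolding i_def differ_def by blast
  define a where "a k = 2 * (indicator (U k) x - indicator (U k) y) * (1 / 3 :: real) ^ Suc k" for k
  have a_abs: "\<bar>a k\<bar> \<le> 2 * (1 / 3) ^ Suc k" for k
    by (auto simp: a_def split: split_indicator)
  have a_sum: "summable a"
    by (rule summable_comparison_test'[OF summable_third[of 0]]) (use a_abs in simp)
  have "cantor_code U x - cantor_code U y = suminf a"
    unfolding cantor_code_def a_def
    by (subst suminf_diff[OF cantor_code_summable cantor_code_summable]) (simp add: algebra_simps)
  also have "\<dots> = (\<Sum>k. a (k + Suc i)) + (\<Sum>k<Suc i. a k)"
    by (rule suminf_split_initial_segment[OF a_sum])
  also have "(\<Sum>k<Suc i. a k) = a i"
    using less by (simp add: a_def indicator_def)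
  finally have eq: "cantor_code U x - cantor_code U y = (\<Sum>k. a (k + Suc i)) + a i" .
  have sabs: "summable (\<lambda>k. \<bar>a (k + Suc i)\<bar>)"
    by (rule summable_comparison_test'[OF summable_third[of "Suc i"]]) (use a_abs[of "_ + Suc i"] in \<open>simp only: real_norm_def abs_idempotent\<close>)
  have "\<bar>\<Sum>k. a (k + Suc i)\<bar> \<le> (\<Sum>k. \<bar>a (k + Suc i)\<bar>)"
    using summable_norm[of "\<lambda>k. a (k + Suc i)"] sabs by simp
  also have "\<dots> \<le> (\<Sum>k. 2 * (1 / 3 :: real) ^ Suc (k + Suc i))"
    by (intro suminf_le sabs summable_third a_abs)
  also have "\<dots> = (1 / 3) ^ Suc i" by (rule geometric_third)
  finally have "\<bar>\<Sum>k. a (k + Suc i)\<bar> \<le> (1 / 3) ^ Suc i" .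
  moreover have "\<bar>a i\<bar> = 2 * (1 / 3) ^ Suc i"
    using i by (auto simp: a_def indicator_def)
  ultimately have "(1 / 3) ^ Suc i \<le> \<bar>cantor_code U x - cantor_code U y\<bar>"
    unfolding eq by linarith
  moreover have "(1 / 3 :: real) ^ Suc K \<le> (1 / 3) ^ Suc i"
    using iK by (intro power_decreasing) auto
  ultimately show False using close by linarith
qed

text \<open>The code is in general discontinuous, but by \<open>unif\<close> nearby codes come from
  nearby points, so its inverse is uniformly continuous. Compactness lets the inverse extend
  continuously to the closure of the range, which is the set on which a weak limit of the coded laws
  is concentrated.\<close>

lemma measurable_limit_decoder:
  fixes \<sigma> :: "'a::metric_space \<Rightarrow> real"
  assumes cpt: "compact (UNIV :: 'a set)"
    and unif: "\<And>e. 0 < e \<Longrightarrow> \<exists>d>0. \<forall>x y. \<bar>\<sigma> x - \<sigma> y\<bar> < d \<longrightarrow> dist x y < e"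
  obtains \<phi> where "\<phi> \<in> borel_measurable borel" "continuous_on (closure (range \<sigma>)) \<phi>" "\<And>x. \<phi> (\<sigma> x) = x"
proof -
  define Z where "Z = closure (range \<sigma>)"
  define lim where "lim p y \<longleftrightarrow> (\<forall>e>0. \<exists>d>0. \<forall>x. \<bar>\<sigma> x - p\<bar> < d \<longrightarrow> dist x y < e)" for p y
  have near: "\<exists>x. \<bar>\<sigma> x - p\<bar> < d" if "p \<in> Z" "0 < d" for p d
    using that unfolding Z_def closure_approachable by (auto simp: dist_real_def)
  have ex: "\<exists>y. lim p y" if p: "p \<in> Z" for p
  proof -
    obtain z where z: "\<And>n. \<sigma> (z n) \<in> range \<sigma>" "(\<lambda>n. \<sigma> (z n)) \<longlonglongrightarrow> p"
    proof -
      obtain s where s: "\<And>n. s n \<in> range \<sigma>" "s \<longlonglongrightarrow> p"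
        using p unfolding Z_def closure_sequential by blast
      then have "\<forall>n. \<exists>x. s n = \<sigma> x" by auto
      then obtain z where "\<And>n. s n = \<sigma> (z n)" by metis
      then have "s = (\<lambda>n. \<sigma> (z n))" by auto
      with s show ?thesis using that by auto
    qed
    obtain y r where r: "strict_mono r" "(z \<circ> r) \<longlonglongrightarrow> y"
      using cpt unfolding compact_def by blast
    have zr: "(\<lambda>n. \<sigma> (z (r n))) \<longlonglongrightarrow> p"
      using LIMSEQ_subseq_LIMSEQ[OF z(2) r(1)] by (simp add: comp_def)
    show ?thesis
    proof (intro exI[of _ y], unfold lim_def, intro allI impI)
      fix e :: real assume e: "0 < e"
      obtain d where d: "0 < d" "\<And>x x'. \<bar>\<sigma> x - \<sigma> x'\<bar> < d \<Longrightarrow> dist x x' < e / 2"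
        using unif[of "e / 2"] e by auto
      have "\<forall>\<^sub>F n in sequentially. dist (\<sigma> (z (r n))) p < d / 2 \<and> dist (z (r n)) y < e / 2"
        using tendstoD[OF zr, of "d / 2"] tendstoD[OF r(2), of "e / 2"] d e
        by (auto simp: comp_def intro: eventually_conj)
      then obtain n where n: "dist (\<sigma> (z (r n))) p < d / 2" "dist (z (r n)) y < e / 2"
        by (auto dest: eventually_happens)
      show "\<exists>d>0. \<forall>x. \<bar>\<sigma> x - p\<bar> < d \<longrightarrow> dist x y < e"
      proof (intro exI[of _ "d / 2"] conjI allI impI)
        fix x assume "\<bar>\<sigma> x - p\<bar> < d / 2"
        then have "\<bar>\<sigma> x - \<sigma> (z (r n))\<bar> < d" using n(1) unfolding dist_real_def by linarith
        from d(2)[OF this] show "dist x y < e" using n(2) dist_triangle_half_l[of x "z (r n)" e y]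
          by (simp add: dist_commute dist_triangle_half_r)
      qed (use d in simp)
    qed
  qed
  \<comment> \<open>Off the closed set \<open>Z\<close> the value is one fixed default, which keeps
    the extension Borel.\<close>
  define \<phi> where "\<phi> p = (if p \<in> Z then SOME y. lim p y else undefined)" for p
  have \<phi>: "lim p (\<phi> p)" if "p \<in> Z" for p
    using someI_ex[OF ex[OF that]] that by (simp add: \<phi>_def)
  have cont: "continuous_on Z \<phi>"
    unfolding continuous_on_iff
  proof (intro ballI allI impI)
    fix p and e :: real assume p: "p \<in> Z" and e: "0 < e"
    obtain d where d: "0 < d" "\<And>x. \<bar>\<sigma> x - p\<bar> < d \<Longrightarrow> dist x (\<phi> p) < e / 2"
      using \<phi>[OF p] e unfolding lim_def by (metis half_gt_zero)
    show "\<exists>d>0. \<forall>q\<in>Z. dist q p < d \<longrightarrow> dist (\<phi> q) (\<phi> p) < e"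
    proof (intro exI[of _ "d / 2"] conjI ballI impI)
      fix q assume q: "q \<in> Z" "dist q p < d / 2"
      obtain d' where d': "0 < d'" "\<And>x. \<bar>\<sigma> x - q\<bar> < d' \<Longrightarrow> dist x (\<phi> q) < e / 2"
        using \<phi>[OF q(1)] e unfolding lim_def by (metis half_gt_zero)
      obtain x where x: "\<bar>\<sigma> x - q\<bar> < min d' (d / 2)"
        using near[OF q(1), of "min d' (d / 2)"] d d' by auto
      then have "\<bar>\<sigma> x - p\<bar> < d" using q(2) unfolding dist_real_def by linarith
      then show "dist (\<phi> q) (\<phi> p) < e"
        using d(2)[of x] d'(2)[of x] x dist_triangle_half_r[of x "\<phi> q" e "\<phi> p"] by auto
    qed (use d in simp)
  qed
  have meas: "\<phi> \<in> borel_measurable borel"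
  proof -
    have Z: "Z \<in> sets borel" by (simp add: Z_def)
    have "(\<lambda>p. if p \<in> Z then \<phi> p else undefined) \<in> borel_measurable borel"
      using Z borel_measurable_continuous_on_restrict[OF cont]
      by (subst measurable_If_restrict_space_iff) auto
    moreover have "(\<lambda>p. if p \<in> Z then \<phi> p else undefined) = \<phi>" by (auto simp: \<phi>_def)
    ultimately show ?thesis by simp
  qed
  have inv: "\<phi> (\<sigma> x) = x" for x
  proof -
    have "\<sigma> x \<in> Z" using closure_subset[of "range \<sigma>"] by (auto simp: Z_def)
    from \<phi>[OF this] have "dist x (\<phi> (\<sigma> x)) < e" if "0 < e" for e
      using that unfolding lim_def by force
    then have "dist x (\<phi> (\<sigma> x)) = 0" by (metis less_irrefl zero_less_dist_iff dist_nz dist_eq_0_iff)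
    then show ?thesis by simp
  qed
  show ?thesis using that[OF meas cont[unfolded Z_def] inv] .
qed

text \<open>The coded laws live in the unit interval and are tight, so a subsequence converges on
  the line; the decoder carries the limit back. Discontinuity of the code is circumvented on the
  side of the test functions: \<open>f\<close> composed with the decoder is continuous on
  \<open>Z\<close> and extends to the line by Tietze with the same bound.\<close>

theorem weakly_convergent_subsequence:
  fixes \<nu>s :: "nat \<Rightarrow> 'a::metric_space measure"
  assumes cpt: "compact (UNIV :: 'a set)" and \<nu>s: "\<And>n. \<nu>s n \<in> space (prob_algebra borel)"
  obtains r \<mu> where "strict_mono r" "\<mu> \<in> space (prob_algebra borel)" "weakly_converges (\<nu>s \<circ> r) \<mu>"
proof -
  obtain U :: "nat \<Rightarrow> 'a set" where U: "\<And>j. open (U j)"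
    "\<And>e. 0 < e \<Longrightarrow> \<exists>K. \<forall>x y. (\<forall>j\<le>K. x \<in> U j \<longleftrightarrow> y \<in> U j) \<longrightarrow> dist x y < e"
    using compact_metric_separating_sequence[OF cpt] by blast
  define \<sigma> where "\<sigma> = cantor_code U"
  have \<sigma>[measurable]: "\<sigma> \<in> borel_measurable borel"
    unfolding \<sigma>_def by (rule cantor_code_measurable[OF U(1)])
  have unif: "\<exists>d>0. \<forall>x y. \<bar>\<sigma> x - \<sigma> y\<bar> < d \<longrightarrow> dist x y < e" if "0 < e" for e
  proof -
    from U(2)[OF that] obtain K where K: "\<And>x y. (\<And>j. j \<le> K \<Longrightarrow> x \<in> U j \<longleftrightarrow> y \<in> U j) \<Longrightarrow> dist x y < e" by blast
    show ?thesis
      unfolding \<sigma>_def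
      by (intro exI[of _ "(1 / 3) ^ Suc K"] conjI allI impI K cantor_code_digits) auto
  qed
  define Z where "Z = closure (range \<sigma>)"
  obtain \<phi> where \<phi>[measurable]: "\<phi> \<in> borel_measurable borel"
    and cont: "continuous_on Z \<phi>" and inv: "\<And>x. \<phi> (\<sigma> x) = x"
    using measurable_limit_decoder[OF cpt unif] unfolding Z_def by blast
  have \<sigma>Z: "\<sigma> x \<in> Z" for x using closure_subset[of "range \<sigma>"] by (auto simp: Z_def)
  have sets\<nu>[measurable_cong, simp]: "sets (\<nu>s n) = sets borel" and prob\<nu>: "prob_space (\<nu>s n)" for n
    using \<nu>s by (auto simp: space_prob_algebra)
  define \<rho> where "\<rho> n = distr (\<nu>s n) borel \<sigma>" for n
  have \<rho>: "real_distribution (\<rho> n)" for n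
    unfolding \<rho>_def by (rule prob_space.real_distribution_distr[OF prob\<nu>]) measurable
  have "tight \<rho>"
    unfolding tight_def
  proof (intro conjI allI impI \<rho>)
    fix e :: real assume "0 < e"
    \<comment> \<open>The intervals in \<open>tight\<close> are open on the left, while the range
      bound admits the code 0; hence -1.\<close>
    have "measure (\<rho> n) {-1<..1} = 1" for n
    proof -
      have "-1 < \<sigma> x" "\<sigma> x \<le> 1" for x
        using cantor_code_range[of U x] unfolding \<sigma>_def by linarith+
      then have "\<sigma> -` {-1<..1} \<inter> space (\<nu>s n) = space (\<nu>s n)"
        by auto
      then show ?thesis
        unfolding \<rho>_def by (subst measure_distr) (auto simp: prob_space.prob_space[OF prob\<nu>])
    qed
    then show "\<exists>a b. a < b \<and> (\<forall>n. measure (\<rho> n) {a<..b} > 1 - e)"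
      using \<open>0 < e\<close> by (intro exI[of _ "-1"] exI[of _ 1]) auto
  qed
  then obtain r m where r: "strict_mono r" "real_distribution m" "weak_conv_m (\<rho> \<circ> r) m"
    using tight_imp_convergent_subsubsequence[of \<rho> id] by (auto simp: strict_mono_id)
  interpret m: real_distribution m by fact
  have conv: "(\<lambda>n. \<integral>x. F (\<sigma> x) \<partial>\<nu>s (r n)) \<longlonglongrightarrow> (\<integral>p. F p \<partial>m)"
    if F: "continuous_on UNIV F" "\<And>p. \<bar>F p\<bar> \<le> B" for F :: "real \<Rightarrow> real" and B
  proof -
    have Fm[measurable]: "F \<in> borel_measurable borel" by (rule borel_measurable_continuous_onI[OF F(1)])
    have "(\<lambda>n. integral\<^sup>L ((\<rho> \<circ> r) n) F) \<longlonglongrightarrow> integral\<^sup>L m F"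
      by (rule weak_conv_imp_integral_bdd_continuous_conv[OF _ r(2,3), where B=B])
         (use F \<rho> in \<open>auto simp: continuous_on_eq_continuous_at\<close>)
    then show ?thesis by (simp add: \<rho>_def comp_def integral_distr)
  qed
  have mZ: "AE p in m. p \<in> Z"
  proof -
    \<comment> \<open>A bounded continuous function whose zero set is \<open>Z\<close>: its
      integrals vanish along the sequence, hence in the limit.\<close>
    define G where "G p = min 1 (infdist p Z)" for p
    have G: "continuous_on UNIV G" unfolding G_def by (intro continuous_intros)
    have Gm[measurable]: "G \<in> borel_measurable borel" by (rule borel_measurable_continuous_onI[OF G])
    have G1: "\<bar>G p\<bar> \<le> 1" and G0: "0 \<le> G p" for p by (auto simp: G_def infdist_nonneg)
    have "(\<lambda>n. \<integral>x. G (\<sigma> x) \<partial>\<nu>s (r n)) = (\<lambda>n. 0)"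
      using \<sigma>Z by (simp add: G_def)
    with conv[OF G G1] have "(\<integral>p. G p \<partial>m) = 0"
      by (simp add: tendsto_const_iff LIMSEQ_const_iff)
    then have "AE p in m. G p = 0"
      using G0 G1 by (subst (asm) integral_nonneg_eq_0_iff_AE)
         (auto intro!: m.integrable_const_bound[where B=1])
    then show ?thesis
    proof eventually_elim
      case (elim p)
      have "closed Z" "Z \<noteq> {}" by (auto simp: Z_def)
      moreover have "infdist p Z = 0" using elim by (auto simp: G_def min_def split: if_splits)
      ultimately show ?case by (simp add: in_closed_iff_infdist_zero)
    qed
  qed
  show ?thesis
  proof (rule that[OF r(1)])
    show "distr m borel \<phi> \<in> space (prob_algebra borel)"
      by (auto simp: space_prob_algebra intro!: m.prob_space_distr)
    show "weakly_converges (\<nu>s \<circ> r) (distr m borel \<phi>)"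
      unfolding weakly_converges_def
    proof
      fix f :: "'a \<Rightarrow> real" assume f: "f \<in> Cb"
      have fc: "continuous_on UNIV f" using f by (simp add: Cb_def)
      have fm[measurable]: "f \<in> borel_measurable borel" by (rule borel_measurable_continuous_onI[OF fc])
      obtain B where B: "0 < B" "\<And>x. \<bar>f x\<bar> \<le> B"
        using f unfolding Cb_def bounded_pos by auto
      have "continuous_on Z (\<lambda>p. f (\<phi> p))"
        by (rule continuous_on_compose2[OF fc cont]) auto
      then obtain F where F: "continuous_on UNIV F" "\<And>p. p \<in> Z \<Longrightarrow> F p = f (\<phi> p)" "\<And>p. norm (F p) \<le> B"
        using Tietze[of Z "\<lambda>p. f (\<phi> p)" UNIV B] B by (auto simp: Z_def)
      have "(\<lambda>n. \<integral>x. F (\<sigma> x) \<partial>\<nu>s (r n)) \<longlonglongrightarrow> (\<integral>p. F p \<partial>m)"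
        using F by (intro conv[of F B]) auto
      moreover have "F (\<sigma> x) = f x" for x using F(2)[OF \<sigma>Z] inv by simp
      moreover have "(\<integral>p. F p \<partial>m) = (\<integral>p. f (\<phi> p) \<partial>m)"
        using mZ F(2) borel_measurable_continuous_onI[OF F(1)]
        by (intro integral_cong_AE) auto
      ultimately show "(\<lambda>n. \<integral>x. f x \<partial>(\<nu>s \<circ> r) n) \<longlonglongrightarrow> (\<integral>x. f x \<partial>distr m borel \<phi>)"
        by (simp add: integral_distr)
    qed
  qed
qed

section \<open>Deterministic processes\<close>

lemma subalgebra_natural_filtration:
  assumes "\<And>t. 0 \<le> t \<Longrightarrow> X t \<in> M \<rightarrow>\<^sub>M borel"
  shows "subalgebra M (natural_filtration M X s)"
proof -
  let ?G = "{X r -` B \<inter> space M | r B. 0 \<le> r \<and> r \<le> s \<and> B \<in> sets borel}"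
  have sub: "?G \<subseteq> sets M" using assms by (auto intro: measurable_sets)
  then have "?G \<subseteq> Pow (space M)" by auto
  then show ?thesis
    using sub unfolding subalgebra_def natural_filtration_def
    by (simp add: sets_measure_of space_measure_of sets.sigma_sets_subset)
qed

text \<open>Taking expectations in the Markov property at time 0 removes the conditional
  expectation: the mean of \<open>f (X t)\<close> equals the mean of
  \<open>trans_op P t f (X 0)\<close>, and \<open>X 0\<close> has a Dirac law.\<close>

lemma nonrandom_transition:
  fixes P :: "real \<Rightarrow> 'a::metric_space \<Rightarrow> 'a measure"
  assumes proc: "cadlag_Markov_process P (return borel x) M X"
    and path: "AE \<omega> in M. \<forall>t\<ge>0. X t \<omega> = \<xi> t"
    and t: "0 \<le> t" and f: "f \<in> Bb" "trans_op P t f \<in> Bb"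
  shows "trans_op P t f x = f (\<xi> t)"
proof -
  from proc interpret M: prob_space M by (simp add: cadlag_Markov_process_def)
  have X[measurable]: "X t \<in> M \<rightarrow>\<^sub>M borel" if "0 \<le> t" for t
    using proc that by (simp add: cadlag_Markov_process_def)
  have X0: "distr M borel (X 0) = return borel x"
    using proc by (simp add: cadlag_Markov_process_def)
  define F where "F = natural_filtration M X 0"
  have "subalgebra M F" unfolding F_def by (rule subalgebra_natural_filtration[OF X])
  then interpret F: finite_measure_subalgebra M F by unfold_locales
  have fm[measurable]: "f \<in> borel_measurable borel" and Tm[measurable]: "trans_op P t f \<in> borel_measurable borel"
    using f by (auto simp: Bb_def)
  have fX[measurable]: "(\<lambda>\<omega>. f (X t \<omega>)) \<in> borel_measurable M" using X[OF t] by measurable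
  have TX[measurable]: "(\<lambda>\<omega>. trans_op P t f (X 0 \<omega>)) \<in> borel_measurable M" using X[of 0] by measurable
  obtain K where K: "\<And>y. \<bar>f y\<bar> \<le> K" using Bb_boundedE[OF f(1)] by metis
  have int: "integrable M (\<lambda>\<omega>. f (X t \<omega>))"
    using K by (intro M.integrable_const_bound[where B=K]) auto
  have Markov: "AE \<omega> in M. real_cond_exp M F (\<lambda>\<omega>'. f (X t \<omega>')) \<omega> = trans_op P t f (X 0 \<omega>)"
    using proc[unfolded cadlag_Markov_process_def, THEN conjunct2, THEN conjunct2, THEN conjunct2,
        THEN conjunct1, rule_format, OF order_refl t f(1)]
    by (simp add: F_def)
  have "trans_op P t f x = (\<integral>y. trans_op P t f y \<partial>distr M borel (X 0))"
    unfolding X0 by (simp add: integral_return)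
  also have "\<dots> = (\<integral>\<omega>. trans_op P t f (X 0 \<omega>) \<partial>M)"
    using X[of 0] by (subst integral_distr) auto
  also have "\<dots> = (\<integral>\<omega>. real_cond_exp M F (\<lambda>\<omega>'. f (X t \<omega>')) \<omega> \<partial>M)"
    using Markov by (intro integral_cong_AE) auto
  also have "\<dots> = (\<integral>\<omega>. f (X t \<omega>) \<partial>M)"
    by (rule F.real_cond_exp_int(2)[OF int])
  also have "\<dots> = (\<integral>\<omega>. f (\<xi> t) \<partial>M)"
    using path t by (intro integral_cong_AE) auto
  finally show ?thesis by (simp add: M.prob_space)
qed

text \<open>An almost sure event of a probability space is nonempty, so on nonnegative times \<xi>
  coincides with an actual cadlag path.\<close>

lemma nonrandom_path_right_continuous:
  assumes proc: "cadlag_Markov_process P init M X"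
    and path: "AE \<omega> in M. \<forall>t\<ge>0. X t \<omega> = \<xi> t" and t: "0 \<le> t"
  shows "(\<xi> \<longlongrightarrow> \<xi> t) (at_right t)"
proof -
  from proc interpret M: prob_space M by (simp add: cadlag_Markov_process_def)
  have "\<exists>\<omega>\<in>space M. \<forall>t\<ge>0. X t \<omega> = \<xi> t"
  proof (rule ccontr)
    assume "\<not> ?thesis"
    then have "\<And>\<omega>. \<omega> \<in> space M \<Longrightarrow> (\<forall>t\<ge>0. X t \<omega> = \<xi> t) \<Longrightarrow> False" by auto
    then have "AE \<omega> in M. False" using AE_mp[OF path AE_I2[of M "\<lambda>\<omega>. (\<forall>t\<ge>0. X t \<omega> = \<xi> t) \<longrightarrow> False"]] by blast
    then show False by simp
  qed
  then obtain \<omega> where \<omega>: "\<omega> \<in> space M" "\<And>t. 0 \<le> t \<Longrightarrow> X t \<omega> = \<xi> t" by auto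
  have "((\<lambda>s. X s \<omega>) \<longlongrightarrow> X t \<omega>) (at_right t)"
    using proc \<omega>(1) t by (auto simp: cadlag_Markov_process_def cadlag_def)
  moreover have "\<forall>\<^sub>F s in at_right t. X s \<omega> = \<xi> s"
    using eventually_at_right_less by eventually_elim (use t \<omega>(2) in auto)
  ultimately show ?thesis using \<omega>(2)[OF t] by (simp add: filterlim_cong cong: filterlim_cong)
qed

text \<open>Measurability and invariance of \<Phi> are derived: the first from that of
  \<open>trans_op P t (indicator B)\<close>, whose level set at 1 is the preimage of
  \<open>B\<close>, the second from contractivity.\<close>

locale deterministic_semigroup =
  fixes \<mu> :: "'a::metric_space measure" and P :: "real \<Rightarrow> 'a \<Rightarrow> 'a measure" and \<Phi> :: "real \<Rightarrow> 'a \<Rightarrow> 'a"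
  assumes mu': "\<mu> \<in> space (prob_algebra borel)"
    and kernel': "transition_probability P"
    and C0': "C0_semigroup_L2 \<mu> (trans_op P)"
    and contractive: "contractive_L2 \<mu> (trans_op P)"
    and flow: "\<And>t f x. 0 \<le> t \<Longrightarrow> f \<in> Bb \<Longrightarrow> trans_op P t f x = f (\<Phi> t x)"
begin

text \<open>The formula on indicators identifies the kernel as a Dirac measure, so it extends to
  unbounded functions.\<close>

lemma flow_all:
  assumes t: "0 \<le> t" and f: "f \<in> borel_measurable borel"
  shows "trans_op P t f x = f (\<Phi> t x)"
proof -
  have space: "P t x \<in> space (prob_algebra borel)"
    using measurable_space[of "P t" borel "prob_algebra borel" x] kernel' t by (simp add: transition_probability_def)
  then interpret P: prob_space "P t x" by (simp add: space_prob_algebra)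
  have "P t x = return borel (\<Phi> t x)"
  proof (rule measure_eqI)
    show "sets (P t x) = sets (return borel (\<Phi> t x))" using space by (simp add: space_prob_algebra)
    fix B assume "B \<in> sets (P t x)"
    then have B: "B \<in> sets borel" using space by (simp add: space_prob_algebra)
    have "measure (P t x) B = indicator B (\<Phi> t x)"
      using trans_op_indicator[OF t kernel' B, of x] flow[OF t Bb_indicator[OF B], of x] by simp
    then show "emeasure (P t x) B = emeasure (return borel (\<Phi> t x)) B"
      using B by (simp add: P.emeasure_eq_measure ennreal_indicator)
  qed
  then show ?thesis using f by (simp add: trans_op_def integral_return)
qed

lemma flow_measurable:
  assumes t: "0 \<le> t"
  shows "\<Phi> t \<in> borel \<rightarrow>\<^sub>M borel"
proof (rule measurableI)
  fix B :: "'a set" assume B: "B \<in> sets borel"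
  have "trans_op P t (indicator B) \<in> L2 \<mu>"
    using C0' Bb_L2[OF mu' Bb_indicator[OF B]] t by (simp add: C0_semigroup_L2_def)
  then have "trans_op P t (indicator B) \<in> borel_measurable borel"
    using mu' by (simp add: L2_def space_prob_algebra cong: measurable_cong_sets)
  then have "trans_op P t (indicator B) -` {1} \<inter> space borel \<in> sets borel"
    by (rule measurable_sets) simp
  moreover have "trans_op P t (indicator B) -` {1} = \<Phi> t -` B"
    using flow[OF t Bb_indicator[OF B]] by (auto simp: indicator_def split: if_splits)
  ultimately show "\<Phi> t -` B \<inter> space borel \<in> sets borel" by simp
qed simp

text \<open>Contractivity applied to the indicators of a set and of its complement.\<close>

lemma flow_invariant:
  assumes t: "0 \<le> t"
  shows "distr \<mu> borel (\<Phi> t) = \<mu>"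
proof -
  interpret prob_space \<mu> using mu' by (simp add: space_prob_algebra)
  have s[measurable_cong, simp]: "sets \<mu> = sets borel" using mu' by (simp add: space_prob_algebra)
  have sp[simp]: "space \<mu> = UNIV" using sets_eq_imp_space_eq[OF s] by simp
  note [measurable] = flow_measurable[OF t]
  have le: "measure \<mu> (\<Phi> t -` B) \<le> measure \<mu> B" if B[measurable]: "B \<in> sets borel" for B
  proof -
    have BL: "indicator B \<in> L2 \<mu>" by (rule Bb_L2[OF mu' Bb_indicator[OF B]])
    have "(norm2 \<mu> (trans_op P t (indicator B)))\<^sup>2 \<le> (norm2 \<mu> (indicator B))\<^sup>2"
      using contractive BL t by (intro power_mono norm2_nonneg) (auto simp: contractive_L2_def)
    moreover have "ip \<mu> (trans_op P t (indicator B)) (trans_op P t (indicator B)) = measure \<mu> (\<Phi> t -` B)"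
    proof -
      have "ip \<mu> (trans_op P t (indicator B)) (trans_op P t (indicator B)) = (\<integral>x. indicator (\<Phi> t -` B) x \<partial>\<mu>)"
        unfolding ip_def using flow[OF t Bb_indicator[OF B]]
        by (intro Bochner_Integration.integral_cong) (auto split: split_indicator)
      then show ?thesis by simp
    qed
    moreover have "ip \<mu> (indicator B) (indicator B) = measure \<mu> B"
    proof -
      have "ip \<mu> (indicator B) (indicator B) = (\<integral>x. indicator B x \<partial>\<mu>)"
        unfolding ip_def by (intro Bochner_Integration.integral_cong) (auto split: split_indicator)
      then show ?thesis using B by simp
    qed
    ultimately show ?thesis by (simp add: norm2_sq)
  qed
  show ?thesis
  proof (rule measure_eqI)
    fix B assume "B \<in> sets (distr \<mu> borel (\<Phi> t))"
    then have B[measurable]: "B \<in> sets borel" by simp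
    have V: "\<Phi> t -` B \<in> sets borel" using measurable_sets[OF flow_measurable[OF t] B] by simp
    have "measure \<mu> (\<Phi> t -` (- B)) \<le> measure \<mu> (- B)" using B by (intro le) auto
    then have "1 - measure \<mu> (\<Phi> t -` B) \<le> 1 - measure \<mu> B"
      using prob_compl[of B] prob_compl[of "\<Phi> t -` B"] V B by (simp add: Compl_eq_Diff_UNIV vimage_Diff)
    with le[OF B] have "measure \<mu> (\<Phi> t -` B) = measure \<mu> B" by simp
    then show "emeasure (distr \<mu> borel (\<Phi> t)) B = emeasure \<mu> B"
      by (simp add: emeasure_distr emeasure_eq_measure)
  qed simp
qed

sublocale invariant_semigroup \<mu> P
proof
  show "\<mu> \<in> space (prob_algebra borel)" "transition_probability P" "C0_semigroup_L2 \<mu> (trans_op P)"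
    by (rule mu', rule kernel', rule C0')
  have s[measurable_cong, simp]: "sets \<mu> = sets borel" using mu' by (simp add: space_prob_algebra)
  show "invariant_measure \<mu> (trans_op P)"
    unfolding invariant_measure_def
  proof (intro allI impI ballI)
    fix t :: real and f :: "'a \<Rightarrow> real" assume t: "0 \<le> t" and "f \<in> borel_measurable \<mu>"
    then have f[measurable]: "f \<in> borel_measurable borel" by (simp cong: measurable_cong_sets)
    note [measurable] = flow_measurable[OF t]
    have "(\<integral>x. trans_op P t f x \<partial>\<mu>) = (\<integral>x. f (\<Phi> t x) \<partial>\<mu>)"
      by (simp add: flow_all[OF t f])
    also have "\<dots> = (\<integral>x. f x \<partial>distr \<mu> borel (\<Phi> t))"
      by (rule integral_distr[symmetric]) auto
    finally show "(\<integral>x. trans_op P t f x \<partial>\<mu>) = (\<integral>x. f x \<partial>\<mu>)"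
      by (simp add: flow_invariant[OF t])
  qed
qed

lemma integral_T:
  assumes "0 \<le> t" "f \<in> borel_measurable borel"
  shows "(\<integral>x. f (\<Phi> t x) \<partial>\<mu>) = (\<integral>x. (f x :: real) \<partial>\<mu>)"
proof -
  have "(\<integral>x. f (\<Phi> t x) \<partial>\<mu>) = (\<integral>x. f x \<partial>distr \<mu> borel (\<Phi> t))"
    using flow_measurable[OF assms(1)] assms(2) by (intro integral_distr[symmetric]) auto
  then show ?thesis by (simp add: flow_invariant[OF assms(1)])
qed

lemma isometry:
  assumes t: "0 \<le> t" and "f \<in> L2 \<mu>" "g \<in> L2 \<mu>"
  shows "ip \<mu> (T t f) (T t g) = ip \<mu> f g"
proof -
  have m: "f \<in> borel_measurable borel" "g \<in> borel_measurable borel"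
    using assms by (auto simp: L2_def cong: measurable_cong_sets)
  then show ?thesis
    unfolding ip_def using integral_T[OF t, of "\<lambda>x. f x * g x"] by (simp add: flow_all[OF t])
qed

lemma norm2_T_diff_sq:
  assumes t: "0 \<le> t" and u: "u \<in> L2 \<mu>"
  shows "ip \<mu> (\<lambda>x. T t u x - u x) (\<lambda>x. T t u x - u x) = 2 * (ip \<mu> u u - ip \<mu> (T t u) u)"
  using assms by (simp add: ip_diff_self T_L2 isometry)

end

section \<open>Isometric semigroups that must be trivial\<close>

text \<open>By convexity an increase from \<open>x\<close> to \<open>y\<close> grows at least
  \<open>n\<close>-fold up to \<open>z = x + n (y - x)\<close>, which eventually exceeds the maximal
  oscillation \<open>2 * K\<close>.\<close>

lemma bounded_convex_antimono:
  fixes f :: "real \<Rightarrow> real"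
  assumes conv: "convex_on {0..} f" and bd: "\<And>t. 0 \<le> t \<Longrightarrow> \<bar>f t\<bar> \<le> K" and xy: "0 \<le> x" "x \<le> y"
  shows "f y \<le> f x"
proof (rule ccontr)
  assume "\<not> f y \<le> f x"
  then have pos: "0 < f y - f x" by simp
  obtain n where n: "2 * K / (f y - f x) < real n" using reals_Archimedean2 by blast
  have K: "0 \<le> K" using bd[of 0] by simp
  have n0: "1 \<le> n" using n divide_nonneg_pos[OF _ pos, of "2 * K"] K by (cases n) auto
  define z where "z = x + real n * (y - x)"
  have z: "0 \<le> z" using xy by (simp add: z_def)
  have "f ((1 - 1 / real n) *\<^sub>R x + (1 / real n) *\<^sub>R z) \<le> (1 - 1 / real n) * f x + (1 / real n) * f z"
    using n0 xy z by (intro convex_onD[OF conv]) auto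
  moreover have "(1 - 1 / real n) *\<^sub>R x + (1 / real n) *\<^sub>R z = y"
    using n0 by (simp add: z_def field_simps)
  ultimately have "real n * f y \<le> real n * ((1 - 1 / real n) * f x + (1 / real n) * f z)"
    by (intro mult_left_mono) auto
  also have "\<dots> = real n * f x - f x + f z"
    using n0 by (simp add: distrib_left left_diff_distrib right_diff_distrib)
  finally have "real n * (f y - f x) \<le> f z - f x"
    by (simp add: right_diff_distrib)
  also have "\<dots> \<le> 2 * K" using bd[OF z] bd[OF xy(1)] by linarith
  finally show False using n pos by (simp add: field_simps)
qed

text \<open>A concave sequence that falls once goes on falling at least as fast and becomes
  negative.\<close>

lemma bounded_below_decreasing_increments:
  fixes c :: "nat \<Rightarrow> real"
  assumes nonneg: "\<And>k. 0 \<le> c k" and dec: "\<And>k. c (Suc (Suc k)) - c (Suc k) \<le> c (Suc k) - c k"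
  shows "c k \<le> c (Suc k)"
proof (rule ccontr)
  assume "\<not> c k \<le> c (Suc k)"
  define \<delta> where "\<delta> = c k - c (Suc k)"
  have \<delta>: "0 < \<delta>" using \<open>\<not> c k \<le> c (Suc k)\<close> by (simp add: \<delta>_def)
  have inc: "c (Suc (k + n)) - c (k + n) \<le> - \<delta>" for n
  proof (induction n)
    case (Suc n)
    then show ?case using dec[of "k + n"] by simp
  qed (simp add: \<delta>_def)
  have "c (k + n) \<le> c k - real n * \<delta>" for n
  proof (induction n)
    case (Suc n)
    then show ?case using inc[of n] by (simp add: algebra_simps)
  qed simp
  moreover obtain n where "c k / \<delta> < real n" using reals_Archimedean2 by blast
  then have "c k < real n * \<delta>" using \<delta> by (simp add: field_simps)
  ultimately show False using nonneg[of "k + n"] by (metis diff_less_0_iff_less leD le_less_trans order_trans)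
qed

text \<open>The decrements \<open>c k\<close> are nonnegative by \<open>dec\<close>, nonincreasing
  by \<open>conv\<close>, and concave in k by \<open>curv\<close>, hence also nondecreasing. So they
  are constant, \<open>a\<close> is affine, and boundedness makes its slope 0.\<close>

lemma bounded_sequence_with_monotone_curvature:
  fixes a :: "nat \<Rightarrow> real"
  assumes bd: "\<And>k. \<bar>a k\<bar> \<le> K" and dec: "\<And>k. a (Suc k) \<le> a k"
    and conv: "\<And>k. 2 * a (Suc k) \<le> a k + a (Suc (Suc k))"
    and curv: "\<And>k. 2 * a (Suc (Suc k)) - a (Suc k) - a (Suc (Suc (Suc k))) \<le> 2 * a (Suc k) - a k - a (Suc (Suc k))"
  shows "a 1 = a 0"
proof -
  define c where "c k = a k - a (Suc k)" for k
  have up: "c k \<le> c (Suc k)" for k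
  proof (rule bounded_below_decreasing_increments)
    show "0 \<le> c k" for k using dec[of k] by (simp add: c_def)
    show "c (Suc (Suc k)) - c (Suc k) \<le> c (Suc k) - c k" for k using curv[of k] by (simp add: c_def)
  qed
  have const: "c k = c 0" for k
  proof (induction k)
    case (Suc k)
    have "c (Suc k) \<le> c k" using conv[of k] by (simp add: c_def)
    then show ?case using up[of k] Suc by simp
  qed simp
  have lin: "a n = a 0 - real n * c 0" for n
  proof (induction n)
    case (Suc n)
    then show ?case using const[of n] by (simp add: c_def[of n] algebra_simps)
  qed simp
  have "c 0 \<le> 0"
  proof (rule ccontr)
    assume "\<not> c 0 \<le> 0"
    then have pos: "0 < c 0" by simp
    obtain n where "2 * K / c 0 < real n" using reals_Archimedean2 by blast
    then have "2 * K < real n * c 0" using pos by (simp add: field_simps)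
    then show False using lin[of n] bd[of n] bd[of 0] by linarith
  qed
  moreover have "0 \<le> c 0" using dec[of 0] by (simp add: c_def)
  ultimately show ?thesis by (simp add: c_def)
qed

context deterministic_semigroup
begin

text \<open>
  An isometric semigroup for which all \<open>t \<mapsto> \<langle>T\<^sub>t u, u\<rangle>\<close> are convex is trivial: convexity for
  \<open>u - T\<^sub>h u\<close> says that the second differences of \<open>\<langle>T\<^sub>t u, u\<rangle>\<close> are monotone, which a bounded
  convex function allows only if it is constant.
\<close>

lemma T_trivial_of_convex:
  assumes conv: "\<And>u. u \<in> L2 \<mu> \<Longrightarrow> convex_on {0..} (\<lambda>t. ip \<mu> (T t u) u)"
    and u: "u \<in> L2 \<mu>" and h: "0 \<le> h"
  shows "AE x in \<mu>. T h u x = u x"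
proof -
  have bd: "\<bar>ip \<mu> (T t v) v\<bar> \<le> norm2 \<mu> v * norm2 \<mu> v" if "0 \<le> t" "v \<in> L2 \<mu>" for t v
    using that by (intro order_trans[OF ip_Cauchy_Schwarz] mult_right_mono contraction norm2_nonneg T_L2)
  have anti: "ip \<mu> (T t v) v \<le> ip \<mu> (T s v) v" if "0 \<le> s" "s \<le> t" "v \<in> L2 \<mu>" for s t v
    by (rule bounded_convex_antimono[OF conv[OF that(3)] bd[OF _ that(3)] that(1,2)])
  define a where "a k = ip \<mu> (T (real k * h) u) u" for k :: nat
  define w where "w = (\<lambda>x. u x - T h u x)"
  note TL = T_L2[OF _ u]
  have hL: "T h u \<in> L2 \<mu>" by (rule TL[OF h])
  have wL: "w \<in> L2 \<mu>" unfolding w_def by (intro L2_diff u hL)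
  have kh: "0 \<le> real k * h" for k using h by simp
  \<comment> \<open>Of the four pairings, the two with \<open>T h u\<close> on the right lose a
    common factor \<open>T h\<close> by isometry, which lowers their index by 1. The time is
    \<open>Suc k\<close> steps because at least one step must be available for this.\<close>
  have curv: "ip \<mu> (T (real (Suc k) * h) w) w = 2 * a (Suc k) - a k - a (Suc (Suc k))" for k
  proof -
    let ?t = "real (Suc k) * h"
    have t: "0 \<le> ?t" by (rule kh)
    have e1: "AE x in \<mu>. T ?t w x = T ?t u x - T ?t (T h u) x"
      unfolding w_def by (rule T_diff[OF t u hL])
    have e2: "AE x in \<mu>. T ?t (T h u) x = T (real (Suc (Suc k)) * h) u x"
      using T_add[OF t h u] by eventually_elim (simp add: algebra_simps)
    have e3: "AE x in \<mu>. T (real (Suc (Suc k)) * h) u x = T h (T ?t u) x"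
      using T_add[OF h t u] by eventually_elim (simp add: algebra_simps)
    have e4: "AE x in \<mu>. T ?t u x = T h (T (real k * h) u) x"
      using T_add[OF h kh[of k] u] by eventually_elim (simp add: algebra_simps)
    have "AE x in \<mu>. T ?t w x = T ?t u x - T (real (Suc (Suc k)) * h) u x"
      using e1 e2 by eventually_elim simp
    then have "ip \<mu> (T ?t w) w = ip \<mu> (\<lambda>x. T ?t u x - T (real (Suc (Suc k)) * h) u x) w"
      by (intro ip_cong_AE L2_diff TL T_L2[OF t wL] kh wL) auto
    also have "\<dots> = (ip \<mu> (T ?t u) u - ip \<mu> (T ?t u) (T h u)) -
        (ip \<mu> (T (real (Suc (Suc k)) * h) u) u - ip \<mu> (T (real (Suc (Suc k)) * h) u) (T h u))"
      unfolding ip_diff_left[OF TL[OF t] TL[OF kh] wL] unfolding w_def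
      by (simp only: ip_diff_right u hL TL kh)
    also have "ip \<mu> (T ?t u) (T h u) = ip \<mu> (T h (T (real k * h) u)) (T h u)"
      using e4 by (intro ip_cong_AE TL T_L2 h kh hL) auto
    also have "\<dots> = a k" unfolding a_def by (rule isometry[OF h TL[OF kh] u])
    also have "ip \<mu> (T (real (Suc (Suc k)) * h) u) (T h u) = ip \<mu> (T h (T ?t u)) (T h u)"
      using e3 by (intro ip_cong_AE TL T_L2 h kh hL) auto
    also have "\<dots> = a (Suc k)" unfolding a_def by (rule isometry[OF h TL[OF kh] u])
    finally show ?thesis by (simp add: a_def)
  qed
  have "a 1 = a 0"
  proof (rule bounded_sequence_with_monotone_curvature)
    show "\<bar>a k\<bar> \<le> norm2 \<mu> u * norm2 \<mu> u" for k unfolding a_def by (rule bd[OF kh u])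
    show "a (Suc k) \<le> a k" for k
      unfolding a_def using h by (intro anti kh u mult_right_mono) auto
    show "2 * a (Suc k) \<le> a k + a (Suc (Suc k))" for k
    proof -
      have "ip \<mu> (T ((1 - 1 / 2) *\<^sub>R (real k * h) + (1 / 2) *\<^sub>R (real (Suc (Suc k)) * h)) u) u \<le>
          (1 - 1 / 2) * a k + (1 / 2) * a (Suc (Suc k))"
        unfolding a_def using kh[of k] kh[of "Suc (Suc k)"] by (intro convex_onD[OF conv[OF u]]) auto
      moreover have "(1 - 1 / 2) *\<^sub>R (real k * h) + (1 / 2) *\<^sub>R (real (Suc (Suc k)) * h) = real (Suc k) * h"
        by (simp add: field_simps)
      ultimately show ?thesis unfolding a_def by simp
    qed
    show "2 * a (Suc (Suc k)) - a (Suc k) - a (Suc (Suc (Suc k))) \<le> 2 * a (Suc k) - a k - a (Suc (Suc k))" for k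
      unfolding curv[symmetric] using h by (intro anti kh wL mult_right_mono) auto
  qed
  moreover have "a 0 = ip \<mu> u u"
    unfolding a_def using T_zero[OF u] by (auto intro!: ip_cong_AE TL u)
  ultimately have "ip \<mu> (T h u) u = ip \<mu> u u" by (simp add: a_def)
  then have "ip \<mu> (\<lambda>x. T h u x - u x) (\<lambda>x. T h u x - u x) = 0"
    by (simp add: norm2_T_diff_sq[OF h u])
  then have "norm2 \<mu> (\<lambda>x. T h u x - u x) = 0" by (simp add: norm2_def)
  from norm2_eq_0_AE[OF L2_diff[OF hL u] this] show ?thesis by simp
qed

text \<open>
  For indicators the squared distance \<open>\<parallel>T\<^sub>t u - u\<parallel>\<^sup>2\<close> is also the \<open>L\<^sup>1\<close>-distance, hence subadditive
  in \<open>t\<close>; if it is \<open>o(t)\<close>, it vanishes.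
\<close>

lemma T_trivial_of_form_nonpos:
  assumes B: "B \<in> sets borel" and form: "form \<mu> T (indicator B) (indicator B) \<le> 0" and t: "0 \<le> t"
  shows "AE x in \<mu>. T t (indicator B) x = indicator B x"
proof -
  define u where "u = (indicator B :: 'a \<Rightarrow> real)"
  have uB: "u \<in> Bb" unfolding u_def by (rule Bb_indicator[OF B])
  have um: "u \<in> borel_measurable borel" by (rule Bb_measurable[OF uB])
  have u: "u \<in> L2 \<mu>" by (rule Bb_in_L2[OF uB])
  define D where "D s = (\<integral>x. \<bar>T s u x - u x\<bar> \<partial>\<mu>)" for s
  have D0: "0 \<le> D s" for s by (simp add: D_def)
  have TB: "T s u \<in> Bb" if "0 \<le> s" for s by (rule T_Bb[OF that uB])
  have int: "integrable \<mu> (\<lambda>x. \<bar>f x\<bar>)" if "f \<in> Bb" for f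
    using integrable_mult_Bb[OF that Bb_const[of 1]] by simp
  have D_ip: "D s = 2 * (ip \<mu> u u - ip \<mu> (T s u) u)" if s: "0 \<le> s" for s
  proof -
    have "D s = ip \<mu> (\<lambda>x. T s u x - u x) (\<lambda>x. T s u x - u x)"
      unfolding D_def ip_def
    proof (rule Bochner_Integration.integral_cong)
      fix x
      \<comment> \<open>Both values are 0 or 1, because \<open>T s\<close> composes the indicator
        with \<open>\<Phi> s\<close>.\<close>
      show "\<bar>T s u x - u x\<bar> = (T s u x - u x) * (T s u x - u x)"
        unfolding flow[OF s uB] by (auto simp: u_def indicator_def)
    qed simp
    then show ?thesis using norm2_T_diff_sq[OF s u] by simp
  qed
  have D_add: "D (s + r) \<le> D s + D r" if s: "0 \<le> s" and r: "0 \<le> r" for s r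
  proof -
    define v where "v x = \<bar>T r u x - u x\<bar>" for x
    have vm: "v \<in> borel_measurable borel"
      unfolding v_def using um Bb_measurable[OF TB[OF r]] by auto
    have TT: "T s (T r u) \<in> Bb" by (rule T_Bb[OF s TB[OF r]])
    have "D (s + r) = (\<integral>x. \<bar>T s (T r u) x - u x\<bar> \<partial>\<mu>)"
      unfolding D_def
    proof (rule integral_cong_AE)
      show "(\<lambda>x. \<bar>T (s + r) u x - u x\<bar>) \<in> borel_measurable \<mu>" "(\<lambda>x. \<bar>T s (T r u) x - u x\<bar>) \<in> borel_measurable \<mu>"
        using int[OF Bb_diff[OF TB uB], of "s + r"] int[OF Bb_diff[OF TT uB]] s r by auto
      show "AE x in \<mu>. \<bar>T (s + r) u x - u x\<bar> = \<bar>T s (T r u) x - u x\<bar>"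
        using T_add[OF s r u] by eventually_elim simp
    qed
    also have "\<dots> \<le> (\<integral>x. \<bar>T s (T r u) x - T s u x\<bar> + \<bar>T s u x - u x\<bar> \<partial>\<mu>)"
    proof (rule integral_mono)
      show "integrable \<mu> (\<lambda>x. \<bar>T s (T r u) x - T s u x\<bar> + \<bar>T s u x - u x\<bar>)"
        using int[OF Bb_diff[OF TT TB[OF s]]] int[OF Bb_diff[OF TB[OF s] uB]]
        by (rule Bochner_Integration.integrable_add)
    qed (use int[OF Bb_diff[OF TT uB]] in auto)
    also have "\<dots> = (\<integral>x. \<bar>T s (T r u) x - T s u x\<bar> \<partial>\<mu>) + D s"
      unfolding D_def using int[OF Bb_diff[OF TT TB[OF s]]] int[OF Bb_diff[OF TB[OF s] uB]]
      by (intro Bochner_Integration.integral_add)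
    also have "(\<integral>x. \<bar>T s (T r u) x - T s u x\<bar> \<partial>\<mu>) = (\<integral>x. v (\<Phi> s x) \<partial>\<mu>)"
      by (simp add: flow[OF s TB[OF r]] flow[OF s uB] v_def)
    also have "\<dots> = D r" unfolding integral_T[OF s vm] by (simp add: D_def v_def[abs_def])
    finally show ?thesis by simp
  qed
  have D_mult: "D (real n * s) \<le> real n * D s" if s: "0 \<le> s" for n s
  proof (induction n)
    case 0
    have "ip \<mu> (T 0 u) u = ip \<mu> u u"
      using T_zero[OF u] u T_L2[OF order_refl u] by (intro ip_cong_AE) auto
    then have "D 0 = 0" using D_ip[of 0] by simp
    then show ?case by simp
  next
    case (Suc n)
    have "D (real (Suc n) * s) = D (s + real n * s)" by (simp add: algebra_simps)
    also have "\<dots> \<le> D s + D (real n * s)" using s by (intro D_add) auto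
    also have "\<dots> \<le> D s + real n * D s" using Suc by simp
    finally show ?case by (simp add: algebra_simps)
  qed
  \<comment> \<open>A value at most 0 differs from the default \<infinity>, so the indicator lies in
    the domain and the defining limit exists as a real number.\<close>
  have dom: "u \<in> form_dom \<mu> T" using form unfolding form_def u_def by (auto split: if_splits)
  then obtain l where l: "((\<lambda>s. ip \<mu> (\<lambda>x. (u x - T s u x) / s) u) \<longlongrightarrow> l) (at_right 0)"
    using u by (auto simp: form_dom_def)
  have "l \<le> 0"
    using form dom tendsto_Lim[OF _ l] unfolding form_def u_def[symmetric] by simp
  have Dl: "((\<lambda>s. D s / s) \<longlongrightarrow> 2 * l) (at_right 0)"
  proof (rule Lim_transform_eventually[OF tendsto_mult_left[OF l]])
    show "\<forall>\<^sub>F s in at_right 0. 2 * ip \<mu> (\<lambda>x. (u x - T s u x) / s) u = D s / s"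
      using eventually_at_right_less
      by eventually_elim (use u in \<open>simp add: D_ip ip_divide_left ip_diff_left T_L2\<close>)
  qed
  have "0 \<le> 2 * l"
    by (rule tendsto_lowerbound[OF Dl])
       (use D0 in \<open>auto intro!: eventually_mono[OF eventually_at_right_less]\<close>)
  with \<open>l \<le> 0\<close> Dl have Dl0: "((\<lambda>s. D s / s) \<longlongrightarrow> 0) (at_right 0)" by simp
  have "D t = 0"
  proof (cases "t = 0")
    case True
    then show ?thesis using D_mult[of 0 0] D0[of 0] by simp
  next
    case False
    then have t: "0 < t" using t by simp
    \<comment> \<open>For the step \<open>r = t / real (Suc n)\<close>, subadditivity bounds
      \<open>D t\<close> by \<open>real (Suc n) * D r\<close>, which is \<open>t\<close> times the
      quotient \<open>D r / r\<close>; that quotient tends to 0.\<close>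
    have "filterlim (\<lambda>n. real (Suc n)) at_top sequentially"
      by (rule filterlim_compose[OF filterlim_real_sequentially filterlim_Suc])
    then have "(\<lambda>n. t / real (Suc n)) \<longlonglongrightarrow> 0"
      by (intro tendsto_divide_0[OF tendsto_const] filterlim_at_top_imp_at_infinity)
    then have lim: "filterlim (\<lambda>n. t / real (Suc n)) (at_right 0) sequentially"
      unfolding filterlim_at using t by (auto intro!: always_eventually)
    have "(\<lambda>n. t * (D (t / real (Suc n)) / (t / real (Suc n)))) \<longlonglongrightarrow> t * 0"
      by (intro tendsto_mult tendsto_const filterlim_compose[OF Dl0 lim])
    moreover have "D t \<le> t * (D (t / real (Suc n)) / (t / real (Suc n)))" for n
    proof -
      define N where "N = real (Suc n)"
      have N: "0 < N" by (simp add: N_def)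
      have "D (N * (t / N)) \<le> N * D (t / N)"
        unfolding N_def using t by (intro D_mult) auto
      moreover have "N * (t / N) = t" "t * (D (t / N) / (t / N)) = N * D (t / N)" using N t by simp_all
      ultimately show ?thesis by (simp add: N_def)
    qed
    ultimately have "D t \<le> 0" by (intro LIMSEQ_le_const[where a="D t"]) (auto)
    then show ?thesis using D0[of t] by simp
  qed
  then have "AE x in \<mu>. \<bar>T t u x - u x\<bar> = 0"
    unfolding D_def using int[OF Bb_diff[OF TB[OF t] uB]] by (subst (asm) integral_nonneg_eq_0_iff_AE) auto
  then show ?thesis by (simp add: u_def)
qed

end

section \<open>The form on the generator domain\<close>

context deterministic_semigroup
begin

lemma gen_dom_form:
  assumes "u \<in> gen_dom \<mu> T"
  shows "u \<in> form_dom \<mu> T" "form \<mu> T u u = 0"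
proof -
  obtain w where w: "has_generator_value \<mu> T u w" using assms by (auto simp: gen_dom_def)
  then have u: "u \<in> L2 \<mu>" and wL: "w \<in> L2 \<mu>" by (auto simp: has_generator_value_def)
  have lim: "((\<lambda>t. ip \<mu> (\<lambda>x. (u x - T t u x) / t) v) \<longlongrightarrow> - ip \<mu> w v) (at_right 0)" if v: "v \<in> L2 \<mu>" for v
  proof -
    have "ip \<mu> (\<lambda>x. (u x - T t u x) / t) v = - ip \<mu> (\<lambda>x. (T t u x - u x) / t) v" for t
      using ip_mult_left[of \<mu> "-1" "\<lambda>x. (T t u x - u x) / t" v] by (simp add: minus_divide_left)
    then show ?thesis using tendsto_minus[OF difference_quotient_ip_tendsto[OF w v]] by simp
  qed
  then show dom: "u \<in> form_dom \<mu> T" using u by (auto simp: form_dom_def)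
  text \<open>By isometry \<open>\<langle>u - T\<^sub>t u, u\<rangle> / t\<close> is \<open>t / 2\<close> times the squared norm of the difference quotient.\<close>
  have "((\<lambda>t. t / 2 * (norm2 \<mu> (\<lambda>x. (T t u x - u x) / t))\<^sup>2) \<longlongrightarrow> 0 / 2 * (norm2 \<mu> w)\<^sup>2) (at_right 0)"
  proof (intro tendsto_intros)
    have "\<forall>\<^sub>F t in at_right 0. \<bar>norm2 \<mu> (\<lambda>x. (T t u x - u x) / t) - norm2 \<mu> w\<bar> \<le>
        norm2 \<mu> (\<lambda>x. (T t u x - u x) / t - w x)"
      using eventually_at_right_less
    proof eventually_elim
      case (elim t)
      let ?q = "\<lambda>x. (T t u x - u x) / t"
      have q: "?q \<in> L2 \<mu>" by (rule difference_quotient_L2[OF u elim])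
      have d: "norm2 \<mu> (\<lambda>x. w x - ?q x) = norm2 \<mu> (\<lambda>x. ?q x - w x)"
        using norm2_mult[of \<mu> "-1" "\<lambda>x. ?q x - w x"] by simp
      have "norm2 \<mu> ?q \<le> norm2 \<mu> (\<lambda>x. ?q x - w x) + norm2 \<mu> w"
        using norm2_triangle[OF L2_diff[OF q wL] wL] by simp
      moreover have "norm2 \<mu> w \<le> norm2 \<mu> (\<lambda>x. w x - ?q x) + norm2 \<mu> ?q"
        using norm2_triangle[OF L2_diff[OF wL q] q] by simp
      ultimately show ?case using d by simp
    qed
    then have "((\<lambda>t. norm2 \<mu> (\<lambda>x. (T t u x - u x) / t) - norm2 \<mu> w) \<longlongrightarrow> 0) (at_right 0)"
      unfolding real_norm_def[symmetric]
      by (rule Lim_null_comparison) (use w in \<open>simp add: has_generator_value_def\<close>)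
    then show "((\<lambda>t. norm2 \<mu> (\<lambda>x. (T t u x - u x) / t)) \<longlongrightarrow> norm2 \<mu> w) (at_right 0)"
      by (rule LIM_zero_cancel)
  qed simp
  then have "((\<lambda>t. t / 2 * (norm2 \<mu> (\<lambda>x. (T t u x - u x) / t))\<^sup>2) \<longlongrightarrow> 0) (at_right 0)" by simp
  moreover have "\<forall>\<^sub>F t in at_right 0. t / 2 * (norm2 \<mu> (\<lambda>x. (T t u x - u x) / t))\<^sup>2 = ip \<mu> (\<lambda>x. (u x - T t u x) / t) u"
    using eventually_at_right_less
  proof eventually_elim
    case (elim t)
    have "(norm2 \<mu> (\<lambda>x. (T t u x - u x) / t))\<^sup>2 = ip \<mu> (\<lambda>x. T t u x - u x) (\<lambda>x. T t u x - u x) / t\<^sup>2"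
      unfolding norm2_sq by (simp add: ip_divide_left ip_commute[of \<mu> _ "\<lambda>x. (T t u x - u x) / t"] power2_eq_square)
    also have "\<dots> = 2 * (ip \<mu> u u - ip \<mu> (T t u) u) / t\<^sup>2"
      using elim by (simp add: norm2_T_diff_sq u)
    also have "ip \<mu> u u - ip \<mu> (T t u) u = ip \<mu> (\<lambda>x. u x - T t u x) u"
      using elim u by (simp add: ip_diff_left T_L2)
    finally show ?case using elim by (simp add: ip_divide_left power2_eq_square)
  qed
  ultimately have "((\<lambda>t. ip \<mu> (\<lambda>x. (u x - T t u x) / t) u) \<longlongrightarrow> 0) (at_right 0)"
    by (rule Lim_transform_eventually)
  then have "Lim (at_right 0) (\<lambda>t. ip \<mu> (\<lambda>x. (u x - T t u x) / t) u) = 0"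
    by (intro tendsto_Lim) auto
  then show "form \<mu> T u u = 0" using dom by (simp add: form_def zero_ereal_def)
qed

end

section \<open>Convergence of forms\<close>

text \<open>The definition speaks of continuous versions that vary with k; almost everywhere
  equality transfers the convergence of norms to \<open>g\<close> itself.\<close>

lemma class_C_ip_tendsto:
  assumes \<nu>: "\<And>n. \<nu> n \<in> space (prob_algebra borel)" and g: "g \<in> class_C \<nu> s \<mu>"
  shows "(\<lambda>k. ip (\<nu> (s k)) g g) \<longlonglongrightarrow> ip \<mu> g g"
proof -
  obtain gn where gn: "\<And>k. gn k \<in> Cb" "\<And>k. AE x in \<nu> (s k). g x = gn k x"
    and lim: "(\<lambda>k. ip (\<nu> (s k)) (gn k) (gn k)) \<longlonglongrightarrow> ip \<mu> g g"
    using g unfolding class_C_def by blast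
  have "ip (\<nu> (s k)) g g = ip (\<nu> (s k)) (gn k) (gn k)" for k
  proof -
    have "g \<in> L2 (\<nu> (s k))" using g by (simp add: class_C_def)
    moreover have "gn k \<in> L2 (\<nu> (s k))" using gn(1) Cb_subset_Bb by (intro Bb_L2 \<nu>) auto
    ultimately show ?thesis using gn(2)[of k] by (intro ip_cong_AE)
  qed
  then show ?thesis using lim by simp
qed

text \<open>Members of \<open>C\<close> are functions defined everywhere and lie in
  \<open>L2 \<mu>\<close> and in all spaces \<open>L2 (\<nu> (s k))\<close> at once. They are the
  fixed reference points through which elements of different spaces are compared.\<close>

locale varying_L2 =
  fixes \<nu> :: "nat \<Rightarrow> 'a::topological_space measure" and s :: "nat \<Rightarrow> nat" and \<mu> :: "'a measure"
    and C :: "('a \<Rightarrow> real) set"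
  assumes prob: "\<And>n. \<nu> n \<in> space (prob_algebra borel)"
    and linear: "linear_set C" and C: "C \<subseteq> class_C \<nu> s \<mu>"
begin

lemma C_L2: "g \<in> C \<Longrightarrow> g \<in> L2 \<mu>" "g \<in> C \<Longrightarrow> g \<in> L2 (\<nu> (s k))"
  using C by (auto simp: class_C_def)

lemma C_lincomb: "f \<in> C \<Longrightarrow> g \<in> C \<Longrightarrow> (\<lambda>x. a * f x + b * g x) \<in> C"
  using linear by (simp add: linear_set_def)

text \<open>Polarisation: linearity of \<open>C\<close> puts \<open>f - g\<close> into
  \<open>C\<close>, so convergence of squared norms on \<open>C\<close> yields convergence of inner
  products.\<close>

lemma C_ip_tendsto:
  assumes f: "f \<in> C" and g: "g \<in> C"
  shows "(\<lambda>k. ip (\<nu> (s k)) f g) \<longlonglongrightarrow> ip \<mu> f g"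
proof -
  have lim: "(\<lambda>k. ip (\<nu> (s k)) h h) \<longlonglongrightarrow> ip \<mu> h h" if "h \<in> C" for h
    using that C prob by (intro class_C_ip_tendsto) auto
  have polar: "ip m f g = (ip m f f + ip m g g - ip m (\<lambda>x. 1 * f x + - 1 * g x) (\<lambda>x. 1 * f x + - 1 * g x)) / 2"
    if "f \<in> L2 m" "g \<in> L2 m" for m
    using ip_diff_self[OF that] by simp
  have "(\<lambda>k. (ip (\<nu> (s k)) f f + ip (\<nu> (s k)) g g -
        ip (\<nu> (s k)) (\<lambda>x. 1 * f x + - 1 * g x) (\<lambda>x. 1 * f x + - 1 * g x)) / 2) \<longlonglongrightarrow>
      (ip \<mu> f f + ip \<mu> g g - ip \<mu> (\<lambda>x. 1 * f x + - 1 * g x) (\<lambda>x. 1 * f x + - 1 * g x)) / 2"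
    by (intro tendsto_intros lim f g C_lincomb) simp
  then show ?thesis using f g C_L2 by (simp only: polar)
qed

text \<open>In the expanded square the three terms converge by s-convergence, by w-convergence, and
  by \<open>C_ip_tendsto\<close>. This carries distances in \<open>L2 \<mu>\<close> over to the
  approximating spaces.\<close>

lemma s_converges_norm2_diff:
  assumes r: "strict_mono r" and conv: "s_converges \<nu> (s \<circ> r) \<mu> C \<psi>s \<psi>" and c: "c \<in> C"
  shows "(\<lambda>k. norm2 (\<nu> (s (r k))) (\<lambda>x. \<psi>s k x - c x)) \<longlonglongrightarrow> norm2 \<mu> (\<lambda>x. \<psi> x - c x)"
proof -
  have \<psi>: "\<psi> \<in> L2 \<mu>" "\<And>k. \<psi>s k \<in> C"
    and w: "(\<lambda>k. ip (\<nu> (s (r k))) (\<psi>s k) c) \<longlonglongrightarrow> ip \<mu> \<psi> c"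
    and n: "(\<lambda>k. ip (\<nu> (s (r k))) (\<psi>s k) (\<psi>s k)) \<longlonglongrightarrow> ip \<mu> \<psi> \<psi>"
    using conv c by (auto simp: s_converges_def w_converges_def)
  have cc: "(\<lambda>k. ip (\<nu> (s (r k))) c c) \<longlonglongrightarrow> ip \<mu> c c"
    using LIMSEQ_subseq_LIMSEQ[OF C_ip_tendsto[OF c c] r] by (simp add: comp_def)
  have "(\<lambda>k. sqrt (ip (\<nu> (s (r k))) (\<psi>s k) (\<psi>s k) - 2 * ip (\<nu> (s (r k))) (\<psi>s k) c + ip (\<nu> (s (r k))) c c))
      \<longlonglongrightarrow> sqrt (ip \<mu> \<psi> \<psi> - 2 * ip \<mu> \<psi> c + ip \<mu> c c)"
    by (intro tendsto_intros n w cc)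
  then show ?thesis
    unfolding norm2_def using c \<psi> C_L2 by (simp add: ip_diff_self)
qed

text \<open>The element \<open>c i\<close> mediates between the spaces: \<open>near\<close> compares
  with it in the varying spaces, \<open>close\<close> in \<open>L2 \<mu>\<close>, and its own
  pairings converge for fixed \<open>i\<close>.\<close>

lemma w_converges_by_approximation:
  assumes m: "strict_mono m" and \<phi>s: "\<And>j. \<phi>s j \<in> C" and \<phi>: "\<phi> \<in> L2 \<mu>"
    and c: "\<And>i. c i \<in> C" and e: "e \<longlonglongrightarrow> 0" "\<And>i. 0 \<le> e i"
    and close: "\<And>i. norm2 \<mu> (\<lambda>x. c i x - \<phi> x) \<le> e i"
    and near: "\<And>i j. i \<le> j \<Longrightarrow> norm2 (\<nu> (s (m j))) (\<lambda>x. \<phi>s j x - c i x) \<le> 3 * e i"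
  shows "w_converges \<nu> (s \<circ> m) \<mu> C \<phi>s \<phi>"
  unfolding w_converges_def comp_def
proof (intro conjI ballI allI \<phi>s \<phi>)
  fix h assume h: "h \<in> C"
  have lim: "(\<lambda>j. ip (\<nu> (s (m j))) f g) \<longlonglongrightarrow> ip \<mu> f g" if "f \<in> C" "g \<in> C" for f g
    using LIMSEQ_subseq_LIMSEQ[OF C_ip_tendsto[OF that] m] by (simp add: comp_def)
  define N where "N = norm2 \<mu> h + 1"
  have N: "1 \<le> N" by (simp add: N_def norm2_nonneg)
  have "(\<lambda>j. norm2 (\<nu> (s (m j))) h) \<longlonglongrightarrow> norm2 \<mu> h"
    unfolding norm2_def by (intro tendsto_real_sqrt lim h)
  then have evN: "\<forall>\<^sub>F j in sequentially. norm2 (\<nu> (s (m j))) h < N"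
    by (rule order_tendstoD) (simp add: N_def)
  show "(\<lambda>j. ip (\<nu> (s (m j))) (\<phi>s j) h) \<longlonglongrightarrow> ip \<mu> \<phi> h"
  proof (rule tendstoI)
    fix \<epsilon> :: real assume \<epsilon>: "0 < \<epsilon>"
    have "\<forall>\<^sub>F i in sequentially. e i < \<epsilon> / (8 * N)"
      using \<epsilon> N by (intro order_tendstoD(2)[OF e(1)]) simp
    \<comment> \<open>The two comparisons with \<open>c i\<close> cost \<open>3 * e i * N\<close>
      and \<open>e i * N\<close>; together they stay below \<open>\<epsilon> / 2\<close>.\<close>
    then obtain i where i: "e i < \<epsilon> / (8 * N)" by (auto dest: eventually_happens)
    then have eN: "4 * e i * N < \<epsilon> / 2" using N by (simp add: field_simps)
    have "\<forall>\<^sub>F j in sequentially. \<bar>ip (\<nu> (s (m j))) (c i) h - ip \<mu> (c i) h\<bar> < \<epsilon> / 2"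
      using tendstoD[OF lim[OF c h], of "\<epsilon> / 2"] \<epsilon> by (simp add: dist_real_def)
    then show "\<forall>\<^sub>F j in sequentially. dist (ip (\<nu> (s (m j))) (\<phi>s j) h) (ip \<mu> \<phi> h) < \<epsilon>"
      using evN eventually_ge_at_top[of i]
    proof eventually_elim
      case (elim j)
      let ?n = "\<nu> (s (m j))"
      have "\<bar>ip ?n (\<phi>s j) h - ip ?n (c i) h\<bar> = \<bar>ip ?n (\<lambda>x. \<phi>s j x - c i x) h\<bar>"
        using \<phi>s c h C_L2 by (simp add: ip_diff_left)
      also have "\<dots> \<le> norm2 ?n (\<lambda>x. \<phi>s j x - c i x) * norm2 ?n h"
        using \<phi>s c h C_L2 by (intro ip_Cauchy_Schwarz L2_diff) auto
      also have "\<dots> \<le> 3 * e i * N"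
        using near[OF elim(3)] elim(2) e(2)[of i] by (intro mult_mono norm2_nonneg) auto
      finally have 1: "\<bar>ip ?n (\<phi>s j) h - ip ?n (c i) h\<bar> \<le> 3 * e i * N" .
      have "\<bar>ip \<mu> (c i) h - ip \<mu> \<phi> h\<bar> = \<bar>ip \<mu> (\<lambda>x. c i x - \<phi> x) h\<bar>"
        using \<phi> c h C_L2 by (simp add: ip_diff_left)
      also have "\<dots> \<le> norm2 \<mu> (\<lambda>x. c i x - \<phi> x) * norm2 \<mu> h"
        using \<phi> c h C_L2 by (intro ip_Cauchy_Schwarz L2_diff) auto
      also have "\<dots> \<le> e i * N"
        using close[of i] e(2)[of i] by (intro mult_mono norm2_nonneg) (auto simp: N_def)
      finally have 2: "\<bar>ip \<mu> (c i) h - ip \<mu> \<phi> h\<bar> \<le> e i * N" .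
      show ?case using 1 2 elim(1) eN unfolding dist_real_def by linarith
    qed
  qed
qed

text \<open>
  The lower bound is applied to a diagonal sequence, whose \<open>j\<close>-th member is taken from a recovery
  sequence for the \<open>j\<close>-th approximation of \<open>\<phi>\<close>.
\<close>

lemma form_nonpos_of_recovery:
  assumes liminf: "form_liminf \<nu> Tn s \<mu> C S"
    and recov: "\<And>\<psi>. \<psi> \<in> D \<Longrightarrow> \<exists>r \<psi>s. strict_mono r \<and> recovery_sequence \<nu> Tn (s \<circ> r) \<mu> C S \<psi>s \<psi>"
    and D: "D \<subseteq> L2 \<mu>" "\<And>\<psi>. \<psi> \<in> D \<Longrightarrow> S \<psi> \<psi> \<le> 0"
    and dense: "dense_L2 \<mu> (C \<inter> Bb)"
    and \<phi>: "\<phi> \<in> L2 \<mu>" "\<And>e. 0 < e \<Longrightarrow> \<exists>\<psi>\<in>D. norm2 \<mu> (\<lambda>x. \<psi> x - \<phi> x) \<le> e"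
  shows "S \<phi> \<phi> \<le> 0"
proof -
  define e where "e j = 1 / real (Suc j)" for j
  have e_pos: "0 < e j" for j by (simp add: e_def)
  have e_lim: "e \<longlonglongrightarrow> 0" unfolding e_def by (rule LIMSEQ_Suc[OF lim_1_over_n])
  have e_mono: "e j \<le> e i" if "i \<le> j" for i j using that by (simp add: e_def field_simps)
  have "\<exists>c\<in>C. norm2 \<mu> (\<lambda>x. \<phi> x - c x) < e i" for i
    using dense \<phi>(1) e_pos[of i] unfolding dense_L2_def by blast
  then obtain c where c: "\<And>i. c i \<in> C" "\<And>i. norm2 \<mu> (\<lambda>x. \<phi> x - c i x) < e i" by metis
  have c': "norm2 \<mu> (\<lambda>x. c i x - \<phi> x) \<le> e i" for i
    using c(2)[of i] norm2_mult[of \<mu> "-1" "\<lambda>x. \<phi> x - c i x"] by simp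
  \<comment> \<open>Closeness is required to all \<open>c i\<close> with \<open>i \<le> j\<close>,
    since w-convergence fixes \<open>i\<close> while \<open>j\<close> grows. An approximation of
    \<phi> within \<open>e j\<close> has distance below \<open>e j + e i \<le> 2 * e i\<close> from
    \<open>c i\<close>; the factor 3 leaves room for passing from \<mu> to the measures of the
    sequence.\<close>
  define good where "good j m f \<longleftrightarrow> f \<in> C \<and> form (\<nu> (s m)) (Tn (s m)) f f \<le> ereal (e j) \<and>
      (\<forall>i\<le>j. norm2 (\<nu> (s m)) (\<lambda>x. f x - c i x) \<le> 3 * e i)" for j m f
  have ex: "\<exists>m f. N < m \<and> good j m f" for N j
  proof -
    obtain \<psi> where \<psi>: "\<psi> \<in> D" "norm2 \<mu> (\<lambda>x. \<psi> x - \<phi> x) \<le> e j" using \<phi>(2)[OF e_pos] by blast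
    obtain r \<psi>s where r: "strict_mono r" and rec: "recovery_sequence \<nu> Tn (s \<circ> r) \<mu> C S \<psi>s \<psi>"
      using recov[OF \<psi>(1)] by blast
    have sc: "s_converges \<nu> (s \<circ> r) \<mu> C \<psi>s \<psi>" and inC: "\<And>k. \<psi>s k \<in> C"
      and lsup: "limsup (\<lambda>k. form (\<nu> (s (r k))) (Tn (s (r k))) (\<psi>s k) (\<psi>s k)) \<le> S \<psi> \<psi>"
      using rec by (auto simp: recovery_sequence_def)
    have "limsup (\<lambda>k. form (\<nu> (s (r k))) (Tn (s (r k))) (\<psi>s k) (\<psi>s k)) < ereal (e j)"
      using order_trans[OF lsup D(2)[OF \<psi>(1)]] e_pos[of j] by (simp add: le_less_trans)
    then have ev1: "\<forall>\<^sub>F k in sequentially. form (\<nu> (s (r k))) (Tn (s (r k))) (\<psi>s k) (\<psi>s k) < ereal (e j)"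
      by (rule Limsup_lessD)
    have ev2: "\<forall>\<^sub>F k in sequentially. \<forall>i\<in>{..j}. norm2 (\<nu> (s (r k))) (\<lambda>x. \<psi>s k x - c i x) < 3 * e i"
    proof (rule eventually_ball_finite)
      show "\<forall>i\<in>{..j}. \<forall>\<^sub>F k in sequentially. norm2 (\<nu> (s (r k))) (\<lambda>x. \<psi>s k x - c i x) < 3 * e i"
      proof
        fix i assume "i \<in> {..j}"
        then have "e j \<le> e i" by (simp add: e_mono)
        have "norm2 \<mu> (\<lambda>x. \<psi> x - c i x) \<le> norm2 \<mu> (\<lambda>x. \<psi> x - \<phi> x) + norm2 \<mu> (\<lambda>x. \<phi> x - c i x)"
          using norm2_triangle[of "\<lambda>x. \<psi> x - \<phi> x" \<mu> "\<lambda>x. \<phi> x - c i x"] D(1) \<psi>(1) \<phi>(1) C_L2(1)[OF c(1)]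
          by (auto simp: L2_diff)
        also have "\<dots> < 3 * e i" using \<psi>(2) c(2)[of i] \<open>e j \<le> e i\<close> e_pos[of i] by linarith
        finally show "\<forall>\<^sub>F k in sequentially. norm2 (\<nu> (s (r k))) (\<lambda>x. \<psi>s k x - c i x) < 3 * e i"
          by (rule order_tendstoD(2)[OF s_converges_norm2_diff[OF r sc c(1)]])
      qed
    qed simp
    have "\<forall>\<^sub>F k in sequentially. N < r k \<and> good j (r k) (\<psi>s k)"
      using ev1 ev2 eventually_gt_at_top[of N]
    proof eventually_elim
      case (elim k)
      have "k \<le> r k" by (rule strict_mono_imp_increasing[OF r])
      then show ?case using elim inC by (auto simp: good_def intro: less_imp_le)
    qed
    then obtain k where "N < r k \<and> good j (r k) (\<psi>s k)" by (auto dest: eventually_happens)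
    then show ?thesis by blast
  qed
  \<comment> \<open>Dependent choice forces the indices to increase strictly, so that the diagonal
    sequence runs along a subsequence, as the lower bound demands.\<close>
  have "\<exists>F. \<forall>j. (case F j of (m, f) \<Rightarrow> good j m f) \<and> fst (F j) < fst (F (Suc j))"
  proof (rule dependent_nat_choice)
    show "\<exists>p. case p of (m, f) \<Rightarrow> good 0 m f" using ex[of 0 0] by auto
    show "\<exists>q. (case q of (m, f) \<Rightarrow> good (Suc j) m f) \<and> fst p < fst q" for p j
      using ex[of "fst p" "Suc j"] by auto
  qed
  then obtain F where F: "\<And>j. good j (fst (F j)) (snd (F j))" "\<And>j. fst (F j) < fst (F (Suc j))"
    by (auto simp: case_prod_beta)
  define m where "m j = fst (F j)" for j
  define \<phi>s where "\<phi>s j = snd (F j)" for j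
  have m: "strict_mono m" unfolding m_def strict_mono_Suc_iff using F(2) by simp
  have g: "\<phi>s j \<in> C" "form (\<nu> (s (m j))) (Tn (s (m j))) (\<phi>s j) (\<phi>s j) \<le> ereal (e j)"
    "i \<le> j \<Longrightarrow> norm2 (\<nu> (s (m j))) (\<lambda>x. \<phi>s j x - c i x) \<le> 3 * e i" for i j
    using F(1)[of j] by (auto simp: good_def m_def \<phi>s_def)
  have "w_converges \<nu> (s \<circ> m) \<mu> C \<phi>s \<phi>"
    using m g(1) \<phi>(1) c(1) e_lim less_imp_le[OF e_pos] c' g(3) by (rule w_converges_by_approximation)
  then have "S \<phi> \<phi> \<le> liminf (\<lambda>j. form (\<nu> (s (m j))) (Tn (s (m j))) (\<phi>s j) (\<phi>s j))"
    using liminf \<phi>(1) m unfolding form_liminf_def by blast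
  also have "\<dots> \<le> liminf (\<lambda>j. ereal (e j))"
    by (intro Liminf_mono always_eventually allI g)
  also have "\<dots> = 0"
    using lim_imp_Liminf[of sequentially "\<lambda>j. ereal (e j)" "ereal 0"] e_lim by (simp add: zero_ereal_def)
  finally show ?thesis .
qed

end

text \<open>Common consequence of both senses of convergence: a recovery sequence along some
  subsequence, with the identity in the first sense. The diagonal argument takes only single members
  from each sequence, so this suffices for it.\<close>

lemma form_convergence_recovery:
  assumes "form_convergence_first \<nu> Tn s \<mu> T C D S \<or> form_convergence_second \<nu> Tn s \<mu> T C D S" "\<psi> \<in> D"
  shows "\<exists>r \<psi>s. strict_mono r \<and> recovery_sequence \<nu> Tn (s \<circ> r) \<mu> C S \<psi>s \<psi>"
  using assms(1)
proof
  assume "form_convergence_first \<nu> Tn s \<mu> T C D S"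
  then obtain \<psi>s where "recovery_sequence \<nu> Tn s \<mu> C S \<psi>s \<psi>"
    using assms(2) unfolding form_convergence_first_def by blast
  then have "strict_mono (id :: nat \<Rightarrow> nat) \<and> recovery_sequence \<nu> Tn (s \<circ> id) \<mu> C S \<psi>s \<psi>"
    by (simp add: strict_mono_id)
  then show ?thesis by blast
next
  assume "form_convergence_second \<nu> Tn s \<mu> T C D S"
  then obtain r \<psi>s where "strict_mono r" "recovery_sequence \<nu> Tn (s \<circ> id \<circ> r) \<mu> C S \<psi>s \<psi>"
    using assms(2) strict_mono_id unfolding form_convergence_second_def by blast
  then show ?thesis by auto
qed

lemma form_convergence_trivial:
  assumes "deterministic_semigroup \<mu> P \<Phi>" "varying_L2 \<nu> s \<mu> C" and dense: "dense_L2 \<mu> (C \<inter> Bb)"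
    and iii: "cond_iii \<nu> Tn s \<mu> (trans_op P) C"
    and B: "B \<in> sets borel" and t: "0 \<le> t"
  shows "AE x in \<mu>. trans_op P t (indicator B) x = indicator B x"
proof -
  interpret deterministic_semigroup \<mu> P \<Phi> by fact
  interpret varying_L2 \<nu> s \<mu> C by fact
  have uB: "indicator B \<in> Bb" by (rule Bb_indicator[OF B])
  consider "cform_admissible \<mu> T"
    | "form_convergence_first \<nu> Tn s \<mu> T C (form_dom \<mu> T) (form \<mu> T) \<or>
       form_convergence_second \<nu> Tn s \<mu> T C (form_dom \<mu> T) (form \<mu> T)"
    using iii unfolding cond_iii_def by blast
  then show ?thesis
  proof cases
    case 1
    then show ?thesis
      using t by (intro T_trivial_of_convex Bb_in_L2[OF uB]) (auto simp: cform_admissible_def)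
  next
    case 2
    have "form \<mu> T (indicator B) (indicator B) \<le> 0"
    \<comment> \<open>The generator domain is contained in the form domain, so recovery sequences
      exist; isometry gives the form the value 0 there, and averages over exponential times
      approximate the indicator from it.\<close>
    proof (rule form_nonpos_of_recovery[where D="gen_dom \<mu> T" and S="form \<mu> T"])
      show "form_liminf \<nu> Tn s \<mu> C (form \<mu> T)"
        using 2 by (auto simp: form_convergence_first_def form_convergence_second_def)
      show "\<exists>r \<psi>s. strict_mono r \<and> recovery_sequence \<nu> Tn (s \<circ> r) \<mu> C (form \<mu> T) \<psi>s \<psi>"
        if "\<psi> \<in> gen_dom \<mu> T" for \<psi>
        by (rule form_convergence_recovery[OF 2 gen_dom_form(1)[OF that]])
      show "gen_dom \<mu> T \<subseteq> L2 \<mu>" by (auto simp: gen_dom_def has_generator_value_def)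
      show "\<exists>\<psi>\<in>gen_dom \<mu> T. norm2 \<mu> (\<lambda>x. \<psi> x - indicator B x) \<le> e" if "0 < e" for e
        using weak_resolvent_approx[OF uB _ _ that] by (metis indicator_pos_le indicator_le_1)
    qed (use gen_dom_form dense Bb_in_L2[OF uB] in auto)
    then show ?thesis by (rule T_trivial_of_form_nonpos[OF B _ t])
  qed
qed

section \<open>The limit\<close>

lemma eq_return_borel:
  assumes "\<mu> \<in> space (prob_algebra borel)" "AE x in \<mu>. x = z"
  shows "\<mu> = return borel z"
proof (rule measure_eqI)
  interpret prob_space \<mu> using assms(1) by (simp add: space_prob_algebra)
  have s: "sets \<mu> = sets borel" using assms(1) by (simp add: space_prob_algebra)
  then show "sets \<mu> = sets (return borel z)" by simp
  fix B assume B: "B \<in> sets \<mu>"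
  have "emeasure \<mu> B = (\<integral>\<^sup>+x. indicator B x \<partial>\<mu>)" using B by simp
  also have "\<dots> = (\<integral>\<^sup>+x. indicator B z \<partial>\<mu>)"
    using assms(2) by (intro nn_integral_cong_AE) (auto elim!: eventually_mono)
  also have "\<dots> = emeasure (return borel z) B" using B s by (simp add: emeasure_space_1)
  finally show "emeasure \<mu> B = emeasure (return borel z) B" .
qed

text \<open>Exceptional null sets depend on the event and on the time. They are collected over the
  countably many separating sets \<open>U j\<close> and the rational times; right continuity of the
  paths then gives rest at all times.\<close>

lemma accumulation_point_eq_return:
  fixes \<mu> :: "'a::metric_space measure"
  assumes cpt: "compact (UNIV :: 'a set)" and det: "deterministic_semigroup \<mu> P \<Phi>"
    and trivial: "\<And>B t. B \<in> sets borel \<Longrightarrow> 0 \<le> t \<Longrightarrow> AE x in \<mu>. trans_op P t (indicator B) x = indicator B x"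
    and rc: "\<And>x t. 0 \<le> t \<Longrightarrow> ((\<lambda>s. \<Phi> s x) \<longlongrightarrow> \<Phi> t x) (at_right t)"
    and fixed: "\<And>x. (\<And>t. 0 < t \<Longrightarrow> \<Phi> t x = x) \<Longrightarrow> x = z"
  shows "\<mu> = return borel z"
proof -
  interpret deterministic_semigroup \<mu> P \<Phi> by fact
  obtain U :: "nat \<Rightarrow> 'a set" where U: "\<And>j. open (U j)"
    "\<And>e. 0 < e \<Longrightarrow> \<exists>K. \<forall>x y. (\<forall>j\<le>K. x \<in> U j \<longleftrightarrow> y \<in> U j) \<longrightarrow> dist x y < e"
    using compact_metric_separating_sequence[OF cpt] by blast
  have eqI: "x = y" if "\<And>j. x \<in> U j \<longleftrightarrow> y \<in> U j" for x y
  proof (rule ccontr)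
    assume "x \<noteq> y"
    then have "0 < dist x y" by simp
    from U(2)[OF this] that have "dist x y < dist x y" by blast
    then show False by simp
  qed
  have "AE x in \<mu>. \<forall>j. \<Phi> (real_of_rat q) x \<in> U j \<longleftrightarrow> x \<in> U j" if q: "0 \<le> real_of_rat q" for q
    unfolding AE_all_countable
  proof
    fix j
    have Uj: "U j \<in> sets borel" using U(1) by simp
    show "AE x in \<mu>. \<Phi> (real_of_rat q) x \<in> U j \<longleftrightarrow> x \<in> U j"
      using trivial[OF Uj q]
    proof eventually_elim
      case (elim x)
      then show ?case unfolding flow[OF q Bb_indicator[OF Uj]] by (auto simp: indicator_def split: if_splits)
    qed
  qed
  then have "AE x in \<mu>. 0 \<le> real_of_rat q \<longrightarrow> (\<forall>j. \<Phi> (real_of_rat q) x \<in> U j \<longleftrightarrow> x \<in> U j)" for q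
    by (cases "0 \<le> real_of_rat q") auto
  then have "AE x in \<mu>. \<forall>q. 0 \<le> real_of_rat q \<longrightarrow> (\<forall>j. \<Phi> (real_of_rat q) x \<in> U j \<longleftrightarrow> x \<in> U j)"
    unfolding AE_all_countable by blast
  then have "AE x in \<mu>. x = z"
  proof eventually_elim
    case (elim x)
    then have rat: "\<Phi> (real_of_rat q) x = x" if "0 \<le> real_of_rat q" for q
      using that by (intro eqI) blast
    show "x = z"
    proof (rule fixed, rule ccontr)
      fix t :: real assume t: "0 < t" and ne: "\<Phi> t x \<noteq> x"
      then have "0 < dist x (\<Phi> t x)" by simp
      from tendstoD[OF rc[OF less_imp_le[OF t]] this] obtain b where b: "t < b"
        "\<And>s. t < s \<Longrightarrow> s < b \<Longrightarrow> dist (\<Phi> s x) (\<Phi> t x) < dist x (\<Phi> t x)"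
        unfolding eventually_at_right_field by auto
      \<comment> \<open>At a rational time just after \<open>t\<close> the path is back at
        \<open>x\<close>, yet closer to \<open>\<Phi> t x\<close> than \<open>x\<close> is.\<close>
      obtain q where q: "t < real_of_rat q" "real_of_rat q < b" using of_rat_dense[OF b(1)] by blast
      then have "0 \<le> real_of_rat q" using t by linarith
      then show False using b(2)[OF q] rat[of q] by simp
    qed
  qed
  then show ?thesis by (rule eq_return_borel[OF mu'])
qed

text \<open>If convergence failed for one test function, infinitely many indices would keep a fixed
  distance from the limit. Compactness extracts a weakly convergent subsequence from them, whose
  limit is an accumulation point and hence \<nu>, a contradiction.\<close>

lemma weakly_converges_of_unique_accumulation_point:
  fixes \<nu>s :: "nat \<Rightarrow> 'a::metric_space measure"
  assumes cpt: "compact (UNIV :: 'a set)" and prob: "\<And>n. \<nu>s n \<in> space (prob_algebra borel)"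
    and unique: "\<And>\<mu>. accumulation_point \<nu>s \<mu> \<Longrightarrow> \<mu> = \<nu>"
  shows "weakly_converges \<nu>s \<nu>"
  unfolding weakly_converges_def
proof (rule ballI, rule ccontr)
  fix f :: "'a \<Rightarrow> real" assume f: "f \<in> Cb" and no: "\<not> (\<lambda>n. \<integral>x. f x \<partial>\<nu>s n) \<longlonglongrightarrow> (\<integral>x. f x \<partial>\<nu>)"
  then obtain e where e: "0 < e" "\<exists>\<^sub>F n in sequentially. e \<le> dist (\<integral>x. f x \<partial>\<nu>s n) (\<integral>x. f x \<partial>\<nu>)"
    unfolding tendsto_iff by (auto simp: not_eventually not_less)
  define A where "A = {n. e \<le> dist (\<integral>x. f x \<partial>\<nu>s n) (\<integral>x. f x \<partial>\<nu>)}"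
  have inf: "infinite A"
    using e(2) by (simp add: A_def frequently_cofinite cofinite_eq_sequentially[symmetric])
  define s where "s = enumerate A"
  have s: "strict_mono s" "\<And>n. s n \<in> A"
    unfolding s_def using inf by (auto simp: strict_mono_enumerate enumerate_in_set)
  obtain r \<mu> where r: "strict_mono r" "\<mu> \<in> space (prob_algebra borel)" "weakly_converges ((\<nu>s \<circ> s) \<circ> r) \<mu>"
    using weakly_convergent_subsequence[OF cpt, of "\<nu>s \<circ> s"] prob by auto
  have "accumulation_point \<nu>s \<mu>"
    unfolding accumulation_point_def using r strict_mono_o[OF s(1) r(1)] by (auto simp: comp_assoc)
  then have "\<mu> = \<nu>" by (rule unique)
  then have "(\<lambda>n. \<integral>x. f x \<partial>\<nu>s (s (r n))) \<longlonglongrightarrow> (\<integral>x. f x \<partial>\<nu>)"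
    using r(3) f by (simp add: weakly_converges_def)
  from tendstoD[OF this e(1)] have "\<forall>\<^sub>F n in sequentially. False"
    by eventually_elim (use s(2) in \<open>auto simp: A_def not_less[symmetric]\<close>)
  then show False by simp
qed

theorem proposition3p4:
  fixes \<nu>s :: "nat \<Rightarrow> 'a::metric_space measure"
    and \<nu> :: "'a measure"
    and En :: "nat \<Rightarrow> 'a set"
    and Pn :: "nat \<Rightarrow> real \<Rightarrow> 'a \<Rightarrow> 'a measure"
    and Mn :: "nat \<Rightarrow> 'v measure"
    and Xn :: "nat \<Rightarrow> real \<Rightarrow> 'v \<Rightarrow> 'a"
    and P :: "real \<Rightarrow> 'a \<Rightarrow> 'a measure"
    and M :: "'a \<Rightarrow> 'w measure"
    and X :: "real \<Rightarrow> 'w \<Rightarrow> 'a"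
  assumes "compact (UNIV :: 'a set)"
    and "\<forall>n. \<nu>s n \<in> space (prob_algebra borel)"
    and "\<nu> \<in> space (prob_algebra borel)"
    and "\<forall>m n. m \<noteq> n \<longrightarrow> orthogonal_measures (\<nu>s m) (\<nu>s n)"
    and "\<forall>n. orthogonal_measures (\<nu>s n) \<nu>"
    and "\<forall>n. En n \<in> sets borel"
    and "disjoint_family En"
    and "\<forall>n. emeasure (\<nu>s n) (UNIV - En n) = 0"
    and "\<forall>n. transition_probability (Pn n)"
    and "\<forall>n. C0_semigroup_L2 (\<nu>s n) (trans_op (Pn n))"
    and "\<forall>n. invariant_measure (\<nu>s n) (trans_op (Pn n))"
    and "\<forall>n. cadlag_Markov_process (Pn n) (\<nu>s n) (Mn n) (Xn n)"
    and "transition_probability P"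
    and "Bb_semigroup (trans_op P)"
    and "\<forall>x. cadlag_Markov_process P (return borel x) (M x) X"
    and "C0_semigroup_L2 \<nu> (trans_op P) \<and> contractive_L2 \<nu> (trans_op P)"
    and "\<forall>\<mu>. accumulation_point \<nu>s \<mu> \<longrightarrow> C0_semigroup_L2 \<mu> (trans_op P) \<and> contractive_L2 \<mu> (trans_op P)"
  shows
    "(\<forall>\<mu>0.
        emeasure \<nu> {\<mu>0} = 1 \<and> \<mu>0 \<in> UNIV - (\<Union>n. En n) \<and> cond_v M X \<mu>0 \<and>
        (\<forall>\<mu>. accumulation_point \<nu>s \<mu> \<longrightarrow>
           (\<exists>s C. strict_mono s \<and> weakly_converges (\<nu>s \<circ> s) \<mu> \<and>
              linear_set C \<and> C \<subseteq> class_C \<nu>s s \<mu> \<and> dense_L2 \<mu> (C \<inter> Bb) \<and>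
              cond_i \<nu>s (\<lambda>n. trans_op (Pn n)) C \<and> cond_ii \<mu> (trans_op P) C \<and>
              cond_iii \<nu>s (\<lambda>n. trans_op (Pn n)) s \<mu> (trans_op P) C \<and>
              cond_iv \<nu>s (\<lambda>n. trans_op (Pn n)) s \<mu> C))
        \<longrightarrow> weakly_converges \<nu>s \<nu> \<and> \<nu> = return borel \<mu>0)
     \<and>
     (\<forall>\<mu>0. weakly_converges \<nu>s \<nu> \<and> \<nu> = return borel \<mu>0 \<longrightarrow>
        (\<forall>\<beta>>0. \<forall>g\<in>Cb.
           (\<lambda>n. ip (\<nu>s n)
                  (\<lambda>x. \<beta> * resolvent (\<nu>s n) (trans_op (Pn n)) \<beta> g x - g x)
                  (\<lambda>x. \<beta> * resolvent (\<nu>s n) (trans_op (Pn n)) \<beta> g x - g x)) \<longlonglongrightarrow> 0))"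
proof (intro conjI allI impI ballI)
  note cpt = assms(1) and probn = assms(2)[rule_format] and prob = assms(3)
  fix \<mu>0
  assume A: "emeasure \<nu> {\<mu>0} = 1 \<and> \<mu>0 \<in> UNIV - (\<Union>n. En n) \<and> cond_v M X \<mu>0 \<and>
        (\<forall>\<mu>. accumulation_point \<nu>s \<mu> \<longrightarrow>
           (\<exists>s C. strict_mono s \<and> weakly_converges (\<nu>s \<circ> s) \<mu> \<and>
              linear_set C \<and> C \<subseteq> class_C \<nu>s s \<mu> \<and> dense_L2 \<mu> (C \<inter> Bb) \<and>
              cond_i \<nu>s (\<lambda>n. trans_op (Pn n)) C \<and> cond_ii \<mu> (trans_op P) C \<and>
              cond_iii \<nu>s (\<lambda>n. trans_op (Pn n)) s \<mu> (trans_op P) C \<and>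
              cond_iv \<nu>s (\<lambda>n. trans_op (Pn n)) s \<mu> C))"
  have "cond_v M X \<mu>0" using A by (elim conjE)
  then have nonrandom: "\<forall>x. \<exists>\<xi>. AE \<omega> in M x. \<forall>t\<ge>0. X t \<omega> = \<xi> t"
    and rest: "\<And>z. resting_point M X z \<longleftrightarrow> z = \<mu>0"
    by (simp_all add: cond_v_def nonrandom_trajectories_def)
  obtain \<Xi> where "\<forall>x. AE \<omega> in M x. \<forall>t\<ge>0. X t \<omega> = \<Xi> x t"
    using choice[OF nonrandom] by (elim exE)
  then have \<Xi>: "AE \<omega> in M x. \<forall>t\<ge>0. X t \<omega> = \<Xi> x t" for x by (rule spec)
  \<comment> \<open>One path is selected for each starting point; the resulting flow is the same for
    every accumulation point.\<close>
  define \<Phi> where "\<Phi> t x = \<Xi> x t" for t x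
  have proc: "cadlag_Markov_process P (return borel x) (M x) X" for x using assms(15) by blast
  have flow: "trans_op P t f x = f (\<Phi> t x)" if "0 \<le> t" "f \<in> Bb" for t f x
    unfolding \<Phi>_def using that assms(14)
    by (intro nonrandom_transition[OF proc \<Xi>]) (auto simp: Bb_semigroup_def)
  have rc: "((\<lambda>s. \<Phi> s x) \<longlongrightarrow> \<Phi> t x) (at_right t)" if "0 \<le> t" for x t
    unfolding \<Phi>_def by (rule nonrandom_path_right_continuous[OF proc \<Xi> that])
  have fixed: "x = \<mu>0" if "\<And>t. 0 < t \<Longrightarrow> \<Phi> t x = x" for x
  proof -
    have "resting_point M X x"
      unfolding resting_point_def using \<Xi>[of x] by eventually_elim (use that in \<open>auto simp: \<Phi>_def\<close>)
    then show ?thesis using rest by simp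
  qed
  interpret \<nu>: prob_space \<nu> using prob by (simp add: space_prob_algebra)
  have "AE x in \<nu>. x \<in> {\<mu>0}"
    using A by (intro \<nu>.AE_prob_1) (simp add: \<nu>.emeasure_eq_measure)
  then show \<nu>: "\<nu> = return borel \<mu>0"
    by (intro eq_return_borel[OF prob]) simp
  show "weakly_converges \<nu>s \<nu>"
  proof (rule weakly_converges_of_unique_accumulation_point[OF cpt probn])
    fix \<mu> assume acc: "accumulation_point \<nu>s \<mu>"
    then obtain s C where C: "linear_set C" "C \<subseteq> class_C \<nu>s s \<mu>" "dense_L2 \<mu> (C \<inter> Bb)"
      and iii: "cond_iii \<nu>s (\<lambda>n. trans_op (Pn n)) s \<mu> (trans_op P) C"
      using A by blast
    have det: "deterministic_semigroup \<mu> P \<Phi>"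
      using acc assms(13,17) flow by unfold_locales (auto simp: accumulation_point_def)
    have var: "varying_L2 \<nu>s s \<mu> C" using probn C by unfold_locales
    show "\<mu> = \<nu>"
      unfolding \<nu>
      using cpt det form_convergence_trivial[OF det var C(3) iii] rc fixed
      by (rule accumulation_point_eq_return)
  qed
next
  fix \<mu>0 and \<beta> :: real and g :: "'a \<Rightarrow> real"
  assume w: "weakly_converges \<nu>s \<nu> \<and> \<nu> = return borel \<mu>0" and "0 < \<beta>" "g \<in> Cb"
  moreover have "invariant_semigroup (\<nu>s n) (Pn n)" for n
    using assms(2,9,10,11) by unfold_locales auto
  ultimately show "(\<lambda>n. ip (\<nu>s n)
      (\<lambda>x. \<beta> * resolvent (\<nu>s n) (trans_op (Pn n)) \<beta> g x - g x)
      (\<lambda>x. \<beta> * resolvent (\<nu>s n) (trans_op (Pn n)) \<beta> g x - g x)) \<longlonglongrightarrow> 0"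
    by (intro resolvent_converges[of \<nu>s Pn \<mu>0]) auto
qed

end
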